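(* Let $(M,g)$ be an $n$-dimensional compact Riemannian manifold with Riemannian volume measure $\nu$, and let $c\in(0,\infty)$. Let $u:(0,T)\to(0,\infty)$ be a smooth solution of $c^2u''+u'=\frac1{2u}$, and put $\alpha=u'/u$. Let $(\rho,\phi)$ be a smooth solution on $M\times(0,T)$, with $\rho(\cdot,t)>0$ a probability density with respect to $\nu$, of $$\partial_t\rho+\nabla\cdot(\rho\nabla\phi)=0,\qquad c^2\left(\partial_t\phi+\tfrac12|\nabla\phi|^2\right)=-\phi-\log\rho-1 .$$ Let $W_c(\rho(t))$ be the $W$-entropy defined in the context, and $W_c(\rho_n(t))$ the same quantity for the reference density $\rho_n(x,t)=\frac1{(4\pi u^2(t))^{n/2}}e^{-\frac{\|x\|^2}{4u^2(t)}}$ on $(\mathbb R^n,dx)$. Then $$\frac{d}{dt}\bigl(W_c(\rho(t))-W_c(\rho_n(t))\bigr)=\int_M\left|\mathrm{Hess}\,\phi-\alpha(t)g\right|^2\rho\,d\nu+\int_M\mathrm{Ric}(\nabla\phi,\nabla\phi)\rho\,d\nu .$$ In particular, if $\mathrm{Ric}\ge0$, then for all $t\in(0,T)$, $$\frac{d}{dt}W_c(\rho(t))\ge\frac{d}{dt}W_c(\rho_n(t)).$$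
   Context: $\mathrm{Ent}(\rho)=\int\rho\log\rho$ with respect to the volume measure ($\nu$ on $M$, $dx$ on $\mathbb R^n$). The $W$-entropy $W_c(\rho(t))$ is defined, up to an additive constant, by $$\frac{d}{dt}W_c(\rho(t))=\frac{d^2}{dt^2}\mathrm{Ent}(\rho(t))+\left(2\alpha(t)+\frac1{c^2}\right)\frac{d}{dt}\mathrm{Ent}(\rho(t))+\frac1{c^2}\int\frac{|\nabla\rho(t)|^2}{\rho(t)},$$ the last integral being with respect to the same volume measure. *)

theory Defs
  imports "HOL-Analysis.Analysis"
begin

section \<open>Smooth maps between normed spaces\<close>

text \<open>For open \<open>S\<close> this is the usual notion of class \<open>C\<^sup>k\<close>: all iterated directional derivatives up
  to order \<open>k\<close> exist on \<open>S\<close> (as total derivatives of one another) and are continuous.\<close>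

primrec Ck_on ::
  "nat \<Rightarrow> ('a::real_normed_vector) set \<Rightarrow> ('a \<Rightarrow> 'b::real_normed_vector) \<Rightarrow> bool" where
  "Ck_on 0 S f \<longleftrightarrow> continuous_on S f"
| "Ck_on (Suc k) S f \<longleftrightarrow>
     (\<forall>x\<in>S. f differentiable (at x)) \<and> (\<forall>v. Ck_on k S (\<lambda>x. frechet_derivative f (at x) v))"

definition smooth_on ::
  "('a::real_normed_vector) set \<Rightarrow> ('a \<Rightarrow> 'b::real_normed_vector) \<Rightarrow> bool" where
  "smooth_on S f \<longleftrightarrow> (\<forall>k. Ck_on k S f)"


section \<open>Smooth manifolds\<close>

text \<open>The manifold is the whole type \<open>'m\<close>; its dimension is \<open>CARD('n)\<close>. A chart is a domain
  together with a coordinate map. An atlas is not required to be maximal. The Hausdorff property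
  comes from the class \<open>t2_space\<close>; second countability is automatic in the compact case.\<close>

type_synonym ('m, 'n) chart = "'m set \<times> ('m \<Rightarrow> real ^ 'n)"

abbreviation chart_dom :: "('m, 'n) chart \<Rightarrow> 'm set" where
  "chart_dom \<kappa> \<equiv> fst \<kappa>"

abbreviation chart_map :: "('m, 'n) chart \<Rightarrow> 'm \<Rightarrow> real ^ 'n" where
  "chart_map \<kappa> \<equiv> snd \<kappa>"

abbreviation chart_codom :: "('m, 'n) chart \<Rightarrow> (real ^ 'n) set" where
  "chart_codom \<kappa> \<equiv> chart_map \<kappa> ` chart_dom \<kappa>"

abbreviation chart_inv :: "('m, 'n) chart \<Rightarrow> real ^ 'n \<Rightarrow> 'm" where
  "chart_inv \<kappa> \<equiv> inv_into (chart_dom \<kappa>) (chart_map \<kappa>)"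

definition smooth_atlas :: "('m::t2_space, 'n::finite) chart set \<Rightarrow> bool" where
  "smooth_atlas A \<longleftrightarrow>
     (\<Union>\<kappa>\<in>A. chart_dom \<kappa>) = UNIV \<and>
     (\<forall>\<kappa>\<in>A. open (chart_dom \<kappa>) \<and> open (chart_codom \<kappa>) \<and>
        homeomorphism (chart_dom \<kappa>) (chart_codom \<kappa>) (chart_map \<kappa>) (chart_inv \<kappa>)) \<and>
     (\<forall>\<kappa>\<in>A. \<forall>\<kappa>'\<in>A. smooth_on (chart_map \<kappa> ` (chart_dom \<kappa> \<inter> chart_dom \<kappa>'))
        (\<lambda>x. chart_map \<kappa>' (chart_inv \<kappa> x)))"

text \<open>Pointwise quantities below are evaluated in some chart around the point; by tensoriality the
  values do not depend on the choice.\<close>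

definition chart_at :: "('m, 'n) chart set \<Rightarrow> 'm \<Rightarrow> ('m, 'n) chart" where
  "chart_at A p = (SOME \<kappa>. \<kappa> \<in> A \<and> p \<in> chart_dom \<kappa>)"

text \<open>The coordinate derivative \<open>\<partial>\<^sub>i f\<close> in the chart \<open>\<kappa>\<close>, again as a function on the manifold
  (meaningful on \<open>chart_dom \<kappa>\<close>).\<close>

definition pd :: "('m, 'n::finite) chart \<Rightarrow> 'n \<Rightarrow> ('m \<Rightarrow> real) \<Rightarrow> 'm \<Rightarrow> real" where
  "pd \<kappa> i f p =
     frechet_derivative (\<lambda>x. f (chart_inv \<kappa> x)) (at (chart_map \<kappa> p)) (axis i 1)"

text \<open>Joint smoothness of a time-dependent function on (manifold) \<open>\<times>\<close> \<open>J\<close>, \<open>J\<close> an open interval.\<close>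

definition smooth_evolution ::
  "('m, 'n::finite) chart set \<Rightarrow> real set \<Rightarrow> (real \<Rightarrow> 'm \<Rightarrow> real) \<Rightarrow> bool" where
  "smooth_evolution A J f \<longleftrightarrow>
     (\<forall>\<kappa>\<in>A. smooth_on (chart_codom \<kappa> \<times> J) (\<lambda>(x, t). f t (chart_inv \<kappa> x)))"


section \<open>Riemannian geometry in components\<close>

text \<open>Vector fields \<open>X\<^sup>i\<close> and covariant 2-tensor fields \<open>S\<^sub>i\<^sub>j\<close> are given by their components in each
  chart, as functions on the manifold (meaningful on the chart domain).\<close>

type_synonym ('m, 'n) vfield = "('m, 'n) chart \<Rightarrow> 'm \<Rightarrow> real ^ 'n"
type_synonym ('m, 'n) tensor2 = "('m, 'n) chart \<Rightarrow> 'm \<Rightarrow> real ^ 'n ^ 'n"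

definition riemannian_metric ::
  "('m::t2_space, 'n::finite) chart set \<Rightarrow> ('m, 'n) tensor2 \<Rightarrow> bool" where
  "riemannian_metric A g \<longleftrightarrow>
     (\<forall>\<kappa>\<in>A. \<forall>p\<in>chart_dom \<kappa>.
        transpose (g \<kappa> p) = g \<kappa> p \<and> (\<forall>v. v \<noteq> 0 \<longrightarrow> v \<bullet> (g \<kappa> p *v v) > 0)) \<and>
     (\<forall>\<kappa>\<in>A. \<forall>i j. smooth_on (chart_codom \<kappa>) (\<lambda>x. g \<kappa> (chart_inv \<kappa> x) $ i $ j)) \<and>
     (\<forall>\<kappa>\<in>A. \<forall>\<kappa>'\<in>A. \<forall>p\<in>chart_dom \<kappa> \<inter> chart_dom \<kappa>'. \<forall>i j.
        g \<kappa> p $ i $ j =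
          (\<Sum>k\<in>UNIV. \<Sum>l\<in>UNIV. g \<kappa>' p $ k $ l *
             pd \<kappa> i (\<lambda>q. chart_map \<kappa>' q $ k) p * pd \<kappa> j (\<lambda>q. chart_map \<kappa>' q $ l) p))"

definition riemannian_volume ::
  "('m::t2_space, 'n::finite) chart set \<Rightarrow> ('m, 'n) tensor2 \<Rightarrow> 'm measure \<Rightarrow> bool" where
  "riemannian_volume A g \<nu> \<longleftrightarrow> sets \<nu> = sets borel \<and>
     (\<forall>\<kappa>\<in>A. \<forall>B\<in>sets borel. B \<subseteq> chart_dom \<kappa> \<longrightarrow>
        emeasure \<nu> B =
          (\<integral>\<^sup>+x \<in> chart_map \<kappa> ` B. ennreal (sqrt (det (g \<kappa> (chart_inv \<kappa> x)))) \<partial>lborel))"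

text \<open>\<open>S(X, Y) = S\<^sub>i\<^sub>j X\<^sup>i Y\<^sup>j\<close> at a point, used for \<open>S = g\<close> and \<open>S = Ric\<close>.\<close>

definition vinner ::
  "('m, 'n::finite) chart set \<Rightarrow> ('m, 'n) tensor2 \<Rightarrow> ('m, 'n) vfield \<Rightarrow> ('m, 'n) vfield \<Rightarrow> 'm \<Rightarrow> real"
  where
  "vinner A S X Y p = (let \<kappa> = chart_at A p in
     \<Sum>i\<in>UNIV. \<Sum>j\<in>UNIV. S \<kappa> p $ i $ j * X \<kappa> p $ i * Y \<kappa> p $ j)"

definition grad :: "('m, 'n::finite) tensor2 \<Rightarrow> ('m \<Rightarrow> real) \<Rightarrow> ('m, 'n) vfield" where
  "grad g f \<kappa> p = (\<chi> i. \<Sum>j\<in>UNIV. matrix_inv (g \<kappa> p) $ i $ j * pd \<kappa> j f p)"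

definition grad_sq ::
  "('m, 'n::finite) chart set \<Rightarrow> ('m, 'n) tensor2 \<Rightarrow> ('m \<Rightarrow> real) \<Rightarrow> 'm \<Rightarrow> real" where
  "grad_sq A g f = vinner A g (grad g f) (grad g f)"

definition divergence ::
  "('m, 'n::finite) chart set \<Rightarrow> ('m, 'n) tensor2 \<Rightarrow> ('m, 'n) vfield \<Rightarrow> 'm \<Rightarrow> real" where
  "divergence A g X p = (let \<kappa> = chart_at A p in
     (\<Sum>i\<in>UNIV. pd \<kappa> i (\<lambda>q. sqrt (det (g \<kappa> q)) * X \<kappa> q $ i) p) / sqrt (det (g \<kappa> p)))"

text \<open>\<open>christoffel g \<kappa> k i j\<close> is \<open>\<Gamma>\<^sup>k\<^sub>i\<^sub>j\<close>, for the Levi-Civita connection.\<close>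

definition christoffel ::
  "('m, 'n::finite) tensor2 \<Rightarrow> ('m, 'n) chart \<Rightarrow> 'n \<Rightarrow> 'n \<Rightarrow> 'n \<Rightarrow> 'm \<Rightarrow> real" where
  "christoffel g \<kappa> k i j p =
     (\<Sum>l\<in>UNIV. matrix_inv (g \<kappa> p) $ k $ l *
        (pd \<kappa> i (\<lambda>q. g \<kappa> q $ j $ l) p + pd \<kappa> j (\<lambda>q. g \<kappa> q $ i $ l) p
           - pd \<kappa> l (\<lambda>q. g \<kappa> q $ i $ j) p)) / 2"

definition hess :: "('m, 'n::finite) tensor2 \<Rightarrow> ('m \<Rightarrow> real) \<Rightarrow> ('m, 'n) tensor2" where
  "hess g f \<kappa> p =
     (\<chi> i j. pd \<kappa> i (pd \<kappa> j f) p - (\<Sum>k\<in>UNIV. christoffel g \<kappa> k i j p * pd \<kappa> k f p))"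

text \<open>\<open>riemann g \<kappa> l k i j\<close> is the \<open>l\<close>-th component of \<open>R(\<partial>\<^sub>i, \<partial>\<^sub>j) \<partial>\<^sub>k\<close>, where
  \<open>R(X, Y) Z = \<nabla>\<^sub>X \<nabla>\<^sub>Y Z - \<nabla>\<^sub>Y \<nabla>\<^sub>X Z - \<nabla>\<^sub>[\<^sub>X\<^sub>,\<^sub>Y\<^sub>] Z\<close>; \<open>Ric(Y, Z)\<close> is the trace of \<open>X \<mapsto> R(X, Y) Z\<close>
  (positive on round spheres).\<close>

definition riemann ::
  "('m, 'n::finite) tensor2 \<Rightarrow> ('m, 'n) chart \<Rightarrow> 'n \<Rightarrow> 'n \<Rightarrow> 'n \<Rightarrow> 'n \<Rightarrow> 'm \<Rightarrow> real" where
  "riemann g \<kappa> l k i j p =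
     pd \<kappa> i (christoffel g \<kappa> l j k) p - pd \<kappa> j (christoffel g \<kappa> l i k) p
     + (\<Sum>m\<in>UNIV. christoffel g \<kappa> l i m p * christoffel g \<kappa> m j k p
          - christoffel g \<kappa> l j m p * christoffel g \<kappa> m i k p)"

definition ricci :: "('m, 'n::finite) tensor2 \<Rightarrow> ('m, 'n) tensor2" where
  "ricci g \<kappa> p = (\<chi> j k. \<Sum>i\<in>UNIV. riemann g \<kappa> i k i j p)"

definition nonneg_tensor ::
  "('m, 'n::finite) chart set \<Rightarrow> ('m, 'n) tensor2 \<Rightarrow> bool" where
  "nonneg_tensor A S \<longleftrightarrow> (\<forall>\<kappa>\<in>A. \<forall>p\<in>chart_dom \<kappa>. \<forall>v. v \<bullet> (S \<kappa> p *v v) \<ge> 0)"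

text \<open>The squared norm \<open>|S|\<^sup>2 = g\<^sup>i\<^sup>k g\<^sup>j\<^sup>l S\<^sub>i\<^sub>j S\<^sub>k\<^sub>l\<close> induced by \<open>g\<close>.\<close>

definition tensor_norm_sq ::
  "('m, 'n::finite) chart set \<Rightarrow> ('m, 'n) tensor2 \<Rightarrow> ('m, 'n) tensor2 \<Rightarrow> 'm \<Rightarrow> real" where
  "tensor_norm_sq A g S p = (let \<kappa> = chart_at A p; h = matrix_inv (g \<kappa> p) in
     \<Sum>i\<in>UNIV. \<Sum>j\<in>UNIV. \<Sum>k\<in>UNIV. \<Sum>l\<in>UNIV.
       h $ i $ k * h $ j $ l * S \<kappa> p $ i $ j * S \<kappa> p $ k $ l)"

text \<open>Euclidean space as a Riemannian manifold with a single global chart; its volume is \<open>lborel\<close>.\<close>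

definition euclidean_atlas :: "(real ^ 'n, 'n::finite) chart set" where
  "euclidean_atlas = {(UNIV, \<lambda>x. x)}"

definition flat_metric :: "(real ^ 'n, 'n::finite) tensor2" where
  "flat_metric \<kappa> p = mat 1"


section \<open>Entropy and the W-entropy\<close>

definition Ent :: "'m measure \<Rightarrow> ('m \<Rightarrow> real) \<Rightarrow> real" where
  "Ent \<mu> f = (\<integral>p. f p * ln (f p) \<partial>\<mu>)"

text \<open>The W-entropy is only determined up to an additive constant: \<open>is_W_entropy \<dots> W\<close> says that
  \<open>W\<close> is one of the admissible functions of time on the open interval \<open>J\<close>.\<close>

definition is_W_entropy ::
  "('m, 'n::finite) chart set \<Rightarrow> ('m, 'n) tensor2 \<Rightarrow> 'm measure \<Rightarrow> real \<Rightarrow> (real \<Rightarrow> real) \<Rightarrow> real set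
     \<Rightarrow> (real \<Rightarrow> 'm \<Rightarrow> real) \<Rightarrow> (real \<Rightarrow> real) \<Rightarrow> bool" where
  "is_W_entropy A g \<mu> c \<alpha> J \<rho> W \<longleftrightarrow>
     (\<forall>t\<in>J. (W has_real_derivative
        deriv (deriv (\<lambda>s. Ent \<mu> (\<rho> s))) t
        + (2 * \<alpha> t + 1 / c\<^sup>2) * deriv (\<lambda>s. Ent \<mu> (\<rho> s)) t
        + 1 / c\<^sup>2 * (\<integral>p. grad_sq A g (\<rho> t) p / \<rho> t p \<partial>\<mu>)) (at t))"

definition reference_density :: "(real \<Rightarrow> real) \<Rightarrow> real \<Rightarrow> real ^ 'n::finite \<Rightarrow> real" where
  "reference_density u t x =
     exp (- ((norm x)\<^sup>2 / (4 * (u t)\<^sup>2))) / (4 * pi * (u t)\<^sup>2) powr (real CARD('n) / 2)"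

end

theory Submission
  imports Defs "HOL-Probability.Distributions"
begin

text \<open>The idea is to differentiate the entropy twice along the flow. Write \<open>\<Gamma>(a, b) = \<langle>\<nabla>a, \<nabla>b\<rangle>\<close> and
  \<open>\<Delta>\<close> for the Laplacian. Integration by parts and the continuity equation give
  \<open>Ent' = \<integral> \<Gamma>(\<rho>, \<phi>) = - \<integral> \<rho> \<Delta>\<phi>\<close>. Differentiating the first expression again, the Hamilton-Jacobi
  equation for \<open>\<partial>\<^sub>t\<phi>\<close> turns \<open>Ent''\<close> into
  \<open>\<integral> \<rho> (\<Delta>(|\<nabla>\<phi>|\<^sup>2 / 2) - \<Gamma>(\<phi>, \<Delta>\<phi>)) - c\<^sup>-\<^sup>2 (Ent' + \<integral> |\<nabla>\<rho>|\<^sup>2 / \<rho>)\<close>, and Bochner's formula identifies the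
  first integrand with \<open>\<rho> (|Hess \<phi>|\<^sup>2 + Ric(\<nabla>\<phi>, \<nabla>\<phi>))\<close>. The \<open>\<alpha>\<close>-term of the W-entropy completes the square
  up to the constant \<open>- n \<alpha>\<^sup>2\<close>, and \<open>- n \<alpha>\<^sup>2\<close> is exactly the rate of the Gaussian reference solution.

  The Laplacian, \<open>|Hess f|\<^sup>2\<close> and hence \<open>Ric(\<nabla>f, \<nabla>f)\<close> are independent of the chart because the Hessian
  is determined by iterated \<open>\<Gamma>\<close>, and \<open>\<Gamma>\<close> is invariant by the chain rule. Integration by parts
  is reduced to one chart by finitely many \<open>C\<^sup>1\<close> bump functions; there it follows from the translation
  invariance of Lebesgue measure.\<close>

text \<open>Transforming Christoffel symbols would bring in second derivatives of the coordinate
  changes. This is avoided because the rule for differentiating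
  \<open>\<langle>\<nabla>a, \<nabla>b\<rangle>\<close>, taken in three cyclic arrangements as in
  Koszul's formula, isolates \<open>Hess f(\<nabla>a, \<nabla>b)\<close>, and gradients of
  coordinates are enough to test it. The Ricci tensor is never transformed: it is what remains in
  Bochner's formula once all other terms are known, and this also settles its integrability. Bumps
  of class C^1 are enough because integration by parts differentiates the cut-off factor only once,
  while all second derivatives fall on a smooth function. The squared positive part of a quadratic
  polynomial therefore serves. The Gaussian's rate has a geometric reason: it is transported by the
  potential \<open>\<alpha> |x|^2 / 2\<close> up to a function of time, whose Hessian is
  \<open>\<alpha>\<close> times the identity, and the equation for \<open>u\<close> is the
  Hamilton-Jacobi equation of that potential. Hence its Hessian defect and its Ricci term both
  vanish.\<close>

abbreviation (input) sum_all :: "('i::finite \<Rightarrow> 'a::comm_monoid_add) \<Rightarrow> 'a" (binder "\<Sum>" 10) where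
  "sum_all f \<equiv> sum f UNIV"

section \<open>Calculus of iterated directional derivatives\<close>

text \<open>Holds also at points where nothing is differentiable: near \<open>x\<close> both
  functions have the same derivatives, so the choice inside \<open>frechet_derivative\<close> picks
  the same value.\<close>

lemma frechet_derivative_cong_on:
  assumes "open S" "x \<in> S" "\<And>y. y \<in> S \<Longrightarrow> f y = g y"
  shows "frechet_derivative f (at x) = frechet_derivative g (at x)"
proof -
  have "(f has_derivative D) (at x) = (g has_derivative D) (at x)" for D
    using assms by (metis has_derivative_transform_within_open)
  then show ?thesis unfolding frechet_derivative_def by simp
qed

lemma differentiable_cong_on:
  assumes "open S" "x \<in> S" "\<And>y. y \<in> S \<Longrightarrow> f y = g y"
  shows "f differentiable at x \<longleftrightarrow> g differentiable at x"
  using assms unfolding differentiable_def by (metis has_derivative_transform_within_open)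

lemma Ck_on_cong:
  assumes "open S" "\<And>x. x \<in> S \<Longrightarrow> f x = g x"
  shows "Ck_on k S f \<longleftrightarrow> Ck_on k S g"
  using assms(2)
proof (induction k arbitrary: f g)
  case 0
  then show ?case by (simp cong: continuous_on_cong)
next
  case (Suc k)
  have 1: "f differentiable at x \<longleftrightarrow> g differentiable at x" if "x \<in> S" for x
    using differentiable_cong_on[OF assms(1) that] Suc.prems by blast
  have "Ck_on k S (\<lambda>x. frechet_derivative f (at x) v) \<longleftrightarrow>
      Ck_on k S (\<lambda>x. frechet_derivative g (at x) v)" for v
    by (rule Suc.IH) (use frechet_derivative_cong_on[OF assms(1)] Suc.prems in metis)
  with 1 show ?case by simp
qed

lemma Ck_on_subset: "Ck_on k S f \<Longrightarrow> T \<subseteq> S \<Longrightarrow> Ck_on k T f"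
  by (induction k arbitrary: f) (auto intro: continuous_on_subset)

lemma Ck_on_SucD: "Ck_on (Suc k) S f \<Longrightarrow> Ck_on k S f"
proof (induction k arbitrary: f)
  case 0
  then show ?case
    by (auto intro!: continuous_at_imp_continuous_on differentiable_imp_continuous_within)
qed auto

lemma Ck_on_imp_continuous_on: "Ck_on k S f \<Longrightarrow> continuous_on S f"
  using Ck_on_SucD by (induction k) (simp, blast)

text \<open>Derivatives are unique, so the abstract \<open>frechet_derivative\<close> may be traded
  for any formula. The closure rules below exhibit the formula from the matching rule of calculus
  and then argue by induction on the order.\<close>

lemma Ck_on_Suc_I:
  assumes "open S" "\<And>x. x \<in> S \<Longrightarrow> (f has_derivative f' x) (at x)" "\<And>v. Ck_on k S (\<lambda>x. f' x v)"
  shows "Ck_on (Suc k) S f"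
proof -
  have "Ck_on k S (\<lambda>x. frechet_derivative f (at x) v)" for v
    using Ck_on_cong[OF assms(1), of "\<lambda>x. frechet_derivative f (at x) v" "\<lambda>x. f' x v" k]
      frechet_derivative_at[OF assms(2)] assms(3) by metis
  then show ?thesis using assms(2) by (auto simp: differentiable_def)
qed

lemma Ck_on_SucE:
  assumes "Ck_on (Suc k) S f"
  obtains f' where "\<And>x. x \<in> S \<Longrightarrow> (f has_derivative f' x) (at x)" "\<And>v. Ck_on k S (\<lambda>x. f' x v)"
  using assms that[of "\<lambda>x. frechet_derivative f (at x)"] by (simp add: frechet_derivative_works)

lemma Ck_on_const: "Ck_on k S (\<lambda>x. a)"
  by (induction k arbitrary: a) auto

lemma Ck_on_linear:
  assumes "bounded_linear f" "open S"
  shows "Ck_on k S f"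
proof (cases k)
  case 0
  then show ?thesis using assms by (simp add: linear_continuous_on)
next
  case (Suc l)
  then show ?thesis
    using Ck_on_Suc_I[OF assms(2) bounded_linear_imp_has_derivative[OF assms(1)]] Ck_on_const by blast
qed

lemma Ck_on_add:
  assumes "open S"
  shows "Ck_on k S f \<Longrightarrow> Ck_on k S g \<Longrightarrow> Ck_on k S (\<lambda>x. f x + g x)"
proof (induction k arbitrary: f g)
  case 0
  then show ?case by (auto intro: continuous_intros)
next
  case (Suc k)
  obtain f' where f': "\<And>x. x \<in> S \<Longrightarrow> (f has_derivative f' x) (at x)" "\<And>v. Ck_on k S (\<lambda>x. f' x v)"
    using Suc.prems(1) by (rule Ck_on_SucE) blast
  obtain g' where g': "\<And>x. x \<in> S \<Longrightarrow> (g has_derivative g' x) (at x)" "\<And>v. Ck_on k S (\<lambda>x. g' x v)"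
    using Suc.prems(2) by (rule Ck_on_SucE) blast
  show ?case
    by (rule Ck_on_Suc_I[OF assms, where f' = "\<lambda>x v. f' x v + g' x v"])
      (auto intro!: Suc.IH f' g' has_derivative_add)
qed

lemma Ck_on_mult:
  fixes f g :: "'a::real_normed_vector \<Rightarrow> real"
  assumes "open S"
  shows "Ck_on k S f \<Longrightarrow> Ck_on k S g \<Longrightarrow> Ck_on k S (\<lambda>x. f x * g x)"
proof (induction k arbitrary: f g)
  case 0
  then show ?case by (auto intro: continuous_intros)
next
  case (Suc k)
  obtain f' where f': "\<And>x. x \<in> S \<Longrightarrow> (f has_derivative f' x) (at x)" "\<And>v. Ck_on k S (\<lambda>x. f' x v)"
    using Suc.prems(1) by (rule Ck_on_SucE) blast
  obtain g' where g': "\<And>x. x \<in> S \<Longrightarrow> (g has_derivative g' x) (at x)" "\<And>v. Ck_on k S (\<lambda>x. g' x v)"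
    using Suc.prems(2) by (rule Ck_on_SucE) blast
  \<comment> \<open>The product rule leaves \<open>f\<close> and \<open>g\<close> undifferentiated,
    so both are also needed one order lower.\<close>
  have fg: "Ck_on k S f" "Ck_on k S g" using Suc.prems by (simp_all only: Ck_on_SucD)
  show ?case
    by (rule Ck_on_Suc_I[OF assms, where f' = "\<lambda>x v. f x * g' x v + f' x v * g x"])
      (auto intro!: Suc.IH f' g' fg has_derivative_mult Ck_on_add[OF assms])
qed

text \<open>Regularity is asked of the composite \<open>h' (f x)\<close> and not of
  \<open>h'\<close> itself. Inverse, logarithm and square root can then be treated one after the
  other without a chain rule of higher order.\<close>

lemma Ck_on_compose_real:
  fixes f :: "'a::real_normed_vector \<Rightarrow> real" and h :: "real \<Rightarrow> real"
  assumes "open S"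
    and "\<And>x. x \<in> S \<Longrightarrow> (h has_real_derivative h' (f x)) (at (f x))"
    and "Ck_on (Suc k) S f" "Ck_on k S (\<lambda>x. h' (f x))"
  shows "Ck_on (Suc k) S (\<lambda>x. h (f x))"
proof -
  obtain f' where f': "\<And>x. x \<in> S \<Longrightarrow> (f has_derivative f' x) (at x)" "\<And>v. Ck_on k S (\<lambda>x. f' x v)"
    using assms(3) by (rule Ck_on_SucE) blast
  show ?thesis
  proof (rule Ck_on_Suc_I[OF assms(1), where f' = "\<lambda>x v. h' (f x) * f' x v"])
    show "((\<lambda>x. h (f x)) has_derivative (\<lambda>v. h' (f x) * f' x v)) (at x)" if "x \<in> S" for x
      using has_derivative_compose[OF f'(1)[OF that] assms(2)[OF that, unfolded has_field_derivative_def]]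
      by simp
  qed (intro Ck_on_mult assms f')
qed

lemma Ck_on_inverse:
  fixes f :: "'a::real_normed_vector \<Rightarrow> real"
  assumes "open S" "\<And>x. x \<in> S \<Longrightarrow> f x \<noteq> 0" "Ck_on k S f"
  shows "Ck_on k S (\<lambda>x. inverse (f x))"
  using assms(3)
proof (induction k)
  case 0
  then show ?case using assms(2) by (auto intro: continuous_intros)
next
  case (Suc k)
  have "Ck_on k S (\<lambda>x. inverse (f x))"
    using Suc Ck_on_SucD by blast
  \<comment> \<open>The derivative of the inverse is a polynomial in the inverse, to which the
    induction hypothesis applies.\<close>
  then have 1: "Ck_on k S (\<lambda>x. - 1 * (inverse (f x) * inverse (f x)))"
    by (intro Ck_on_mult assms(1) Ck_on_const)
  show ?case
    by (rule Ck_on_compose_real[where h' = "\<lambda>y. - 1 * (inverse y * inverse y)", OF assms(1) _ Suc.prems 1])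
      (use assms(2) in \<open>auto intro!: derivative_eq_intros\<close>)
qed

lemma Ck_on_ln:
  fixes f :: "'a::real_normed_vector \<Rightarrow> real"
  assumes "open S" "\<And>x. x \<in> S \<Longrightarrow> f x > 0" "Ck_on k S f"
  shows "Ck_on k S (\<lambda>x. ln (f x))"
proof (cases k)
  case 0
  then show ?thesis using assms by (auto intro!: continuous_on_ln simp: less_le)
next
  case (Suc l)
  have f: "Ck_on (Suc l) S f" using assms(3) Suc by simp
  have "Ck_on l S (\<lambda>x. inverse (f x))"
    by (intro Ck_on_inverse assms(1) Ck_on_SucD[OF f]) (use assms(2) in force)
  then show ?thesis unfolding Suc
    by (intro Ck_on_compose_real[where h' = inverse, OF assms(1) _ f])
      (use assms(2) in \<open>auto intro!: derivative_eq_intros simp: divide_inverse\<close>)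
qed

section \<open>Closure properties of smooth functions\<close>

named_theorems smooth_intros

lemma smooth_on_cong:
  "open S \<Longrightarrow> (\<And>x. x \<in> S \<Longrightarrow> f x = g x) \<Longrightarrow> smooth_on S f \<longleftrightarrow> smooth_on S g"
  unfolding smooth_on_def using Ck_on_cong[of S f g] by blast

lemma smooth_on_subset: "smooth_on S f \<Longrightarrow> T \<subseteq> S \<Longrightarrow> smooth_on T f"
  unfolding smooth_on_def using Ck_on_subset by blast

lemma smooth_on_imp_continuous_on: "smooth_on S f \<Longrightarrow> continuous_on S f"
  unfolding smooth_on_def using Ck_on_imp_continuous_on by blast

lemma smooth_on_imp_differentiable: "smooth_on S f \<Longrightarrow> x \<in> S \<Longrightarrow> f differentiable at x"
  unfolding smooth_on_def using Ck_on.simps(2)[of 0 S f] by blast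

lemma smooth_on_frechet_derivative:
  "smooth_on S f \<Longrightarrow> smooth_on S (\<lambda>x. frechet_derivative f (at x) v)"
  unfolding smooth_on_def using Ck_on.simps(2)[of _ S f] by blast

lemma smooth_on_const [smooth_intros]: "smooth_on S (\<lambda>x. a)"
  by (simp add: smooth_on_def Ck_on_const)

lemma smooth_on_linear: "bounded_linear f \<Longrightarrow> open S \<Longrightarrow> smooth_on S f"
  by (simp add: smooth_on_def Ck_on_linear)

lemma smooth_on_add [smooth_intros]:
  "open S \<Longrightarrow> smooth_on S f \<Longrightarrow> smooth_on S g \<Longrightarrow> smooth_on S (\<lambda>x. f x + g x)"
  by (simp add: smooth_on_def Ck_on_add)

lemma smooth_on_mult [smooth_intros]:
  fixes f g :: "'a::real_normed_vector \<Rightarrow> real"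
  shows "open S \<Longrightarrow> smooth_on S f \<Longrightarrow> smooth_on S g \<Longrightarrow> smooth_on S (\<lambda>x. f x * g x)"
  by (simp add: smooth_on_def Ck_on_mult)

lemma smooth_on_minus [smooth_intros]:
  fixes f :: "'a::real_normed_vector \<Rightarrow> real"
  shows "open S \<Longrightarrow> smooth_on S f \<Longrightarrow> smooth_on S (\<lambda>x. - f x)"
  using smooth_on_mult[OF _ smooth_on_const[of S "- 1"], of f] by simp

lemma smooth_on_diff [smooth_intros]:
  fixes f g :: "'a::real_normed_vector \<Rightarrow> real"
  shows "open S \<Longrightarrow> smooth_on S f \<Longrightarrow> smooth_on S g \<Longrightarrow> smooth_on S (\<lambda>x. f x - g x)"
  using smooth_on_add[OF _ _ smooth_on_minus, of S f g] by simp

lemma smooth_on_sum [smooth_intros]: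
  "open S \<Longrightarrow> (\<And>i. i \<in> I \<Longrightarrow> smooth_on S (f i)) \<Longrightarrow> smooth_on S (\<lambda>x. \<Sum>i\<in>I. f i x)"
  by (induction I rule: infinite_finite_induct) (auto intro!: smooth_intros)

lemma smooth_on_prod [smooth_intros]:
  fixes f :: "'i \<Rightarrow> 'a::real_normed_vector \<Rightarrow> real"
  shows "open S \<Longrightarrow> (\<And>i. i \<in> I \<Longrightarrow> smooth_on S (f i)) \<Longrightarrow> smooth_on S (\<lambda>x. \<Prod>i\<in>I. f i x)"
  by (induction I rule: infinite_finite_induct) (auto intro!: smooth_intros)

lemma smooth_on_inverse [smooth_intros]:
  fixes f :: "'a::real_normed_vector \<Rightarrow> real"
  shows "open S \<Longrightarrow> (\<And>x. x \<in> S \<Longrightarrow> f x \<noteq> 0) \<Longrightarrow> smooth_on S f \<Longrightarrow> smooth_on S (\<lambda>x. inverse (f x))"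
  by (simp add: smooth_on_def Ck_on_inverse)

lemma smooth_on_divide [smooth_intros]:
  fixes f g :: "'a::real_normed_vector \<Rightarrow> real"
  assumes "open S" "\<And>x. x \<in> S \<Longrightarrow> g x \<noteq> 0" "smooth_on S f" "smooth_on S g"
  shows "smooth_on S (\<lambda>x. f x / g x)"
  unfolding divide_inverse by (intro smooth_intros assms)

lemma smooth_on_ln [smooth_intros]:
  fixes f :: "'a::real_normed_vector \<Rightarrow> real"
  shows "open S \<Longrightarrow> (\<And>x. x \<in> S \<Longrightarrow> f x > 0) \<Longrightarrow> smooth_on S f \<Longrightarrow> smooth_on S (\<lambda>x. ln (f x))"
  by (simp add: smooth_on_def Ck_on_ln)

lemma smooth_on_det [smooth_intros]:
  fixes M :: "'a::real_normed_vector \<Rightarrow> real ^ 'n ^ 'n"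
  assumes "open S" "\<And>i j. smooth_on S (\<lambda>x. M x $ i $ j)"
  shows "smooth_on S (\<lambda>x. det (M x))"
  unfolding det_def by (intro smooth_intros assms)

section \<open>Matrix inverses with smooth entries\<close>

lemma matrix_inv_right_left:
  fixes M :: "'a::semiring_1 ^ 'n ^ 'm"
  assumes "invertible M"
  shows "M ** matrix_inv M = mat 1" "matrix_inv M ** M = mat 1"
  using someI_ex[OF assms[unfolded invertible_def]] by (simp_all add: matrix_inv_def)

text \<open>Cramer's rule for the \<open>j\<close>-th column of the inverse. It makes every entry a
  quotient of polynomials in the entries of \<open>M\<close>, so the inverse metric inherits
  smoothness.\<close>

lemma matrix_inv_entry_cramer:
  fixes M :: "real ^ 'n ^ 'n"
  assumes "det M \<noteq> 0"
  shows "matrix_inv M $ k $ j = det (\<chi> i l. if l = k then (if i = j then 1 else 0) else M $ i $ l) / det M"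
proof -
  have "invertible M" using assms by (simp add: invertible_det_nz)
  then have "M ** matrix_inv M = mat 1" by (rule matrix_inv_right_left)
  then have "M *v (column j (matrix_inv M)) = axis j 1"
    by (metis matrix_vector_mul_assoc matrix_vector_mul_lid matrix_vector_mult_basis)
  then have "column j (matrix_inv M) = (\<chi> k. det (\<chi> i l. if l = k then axis j 1 $ i else M $ i $ l) / det M)"
    using cramer[OF assms] by blast
  then have "column j (matrix_inv M) $ k = det (\<chi> i l. if l = k then axis j 1 $ i else M $ i $ l) / det M"
    by simp
  moreover have "axis j 1 $ i = (if i = j then 1 else 0 :: real)" for i :: 'n by (simp add: axis_def)
  ultimately show ?thesis by (simp add: column_def cong: if_cong)
qed

lemma smooth_on_matrix_inv [smooth_intros]:
  fixes M :: "'a::real_normed_vector \<Rightarrow> real ^ 'n ^ 'n"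
  assumes "open S" "\<And>x. x \<in> S \<Longrightarrow> det (M x) \<noteq> 0" "\<And>i j. smooth_on S (\<lambda>x. M x $ i $ j)"
  shows "smooth_on S (\<lambda>x. matrix_inv (M x) $ k $ j)"
proof -
  have 1: "smooth_on S (\<lambda>x. (\<chi> i l. if l = k then (if i = j then 1 else 0) else M x $ i $ l) $ a $ b)" for a b
    using assms(3) smooth_on_const by (cases "b = k") auto
  have "smooth_on S (\<lambda>x. det (\<chi> i l. if l = k then (if i = j then 1 else 0) else M x $ i $ l) / det (M x))"
    by (intro smooth_intros assms 1)
  then show ?thesis
    by (subst smooth_on_cong[OF assms(1) matrix_inv_entry_cramer[OF assms(2)]])
qed

section \<open>Symmetry of second derivatives\<close>

lemma frechet_derivative_line:
  fixes F :: "'a::real_normed_vector \<Rightarrow> real"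
  assumes "F differentiable at (x + s *\<^sub>R v)"
  shows "((\<lambda>s. F (x + s *\<^sub>R v)) has_real_derivative frechet_derivative F (at (x + s *\<^sub>R v)) v) (at s)"
proof -
  have "((\<lambda>s. x + s *\<^sub>R v) has_derivative (\<lambda>h. h *\<^sub>R v)) (at s)"
    by (auto intro!: derivative_eq_intros)
  from has_derivative_compose[OF this frechet_derivative_works[THEN iffD1, OF assms]]
  have "((\<lambda>s. F (x + s *\<^sub>R v)) has_derivative (\<lambda>h. frechet_derivative F (at (x + s *\<^sub>R v)) (h *\<^sub>R v))) (at s)" .
  moreover have "frechet_derivative F (at (x + s *\<^sub>R v)) (h *\<^sub>R v) = frechet_derivative F (at (x + s *\<^sub>R v)) v * h" for h
    using linear_frechet_derivative[OF assms] by (simp add: linear_cmul)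
  ultimately show ?thesis by (simp add: has_field_derivative_def)
qed

text \<open>The mean value theorem is used first in direction \<open>v\<close>, for the difference
  of \<open>F\<close> along two parallel sides, then in direction \<open>w\<close>. Exchanging
  \<open>v\<close> and \<open>w\<close> preserves the second difference but turns the right-hand
  side into the other mixed derivative.\<close>

lemma second_difference_mvt:
  fixes F :: "'a::real_normed_vector \<Rightarrow> real"
  assumes C: "Ck_on 2 S F" and h: "h > 0"
    and sub: "\<And>s t. 0 \<le> s \<Longrightarrow> s \<le> h \<Longrightarrow> 0 \<le> t \<Longrightarrow> t \<le> h \<Longrightarrow> x + s *\<^sub>R v + t *\<^sub>R w \<in> S"
  shows "\<exists>s t. 0 < s \<and> s < h \<and> 0 < t \<and> t < h \<and>
    F (x + h *\<^sub>R v + h *\<^sub>R w) - F (x + h *\<^sub>R v) - F (x + h *\<^sub>R w) + F x =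
      h * (h * frechet_derivative (\<lambda>y. frechet_derivative F (at y) v) (at (x + s *\<^sub>R v + t *\<^sub>R w)) w)"
proof -
  let ?G = "\<lambda>y. frechet_derivative F (at y) v"
  have d1: "F differentiable at y" and d2: "?G differentiable at y" if "y \<in> S" for y
    using C that by (auto simp: numeral_2_eq_2)
  define p where "p s = F ((x + h *\<^sub>R w) + s *\<^sub>R v) - F (x + s *\<^sub>R v)" for s
  have "(p has_real_derivative ?G ((x + h *\<^sub>R w) + s *\<^sub>R v) - ?G (x + s *\<^sub>R v)) (at s)"
    if "0 \<le> s" "s \<le> h" for s
  proof -
    have "(x + h *\<^sub>R w) + s *\<^sub>R v \<in> S" "x + s *\<^sub>R v \<in> S"
      using sub[OF that, of h] sub[OF that, of 0] h by (simp_all add: algebra_simps)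
    then show ?thesis unfolding p_def
      by (intro DERIV_diff frechet_derivative_line d1)
  qed
  from MVT2[OF h this] obtain s where s: "0 < s" "s < h"
    "p h - p 0 = h * (?G ((x + h *\<^sub>R w) + s *\<^sub>R v) - ?G (x + s *\<^sub>R v))" by auto
  have "((\<lambda>t. ?G ((x + s *\<^sub>R v) + t *\<^sub>R w)) has_real_derivative
      frechet_derivative ?G (at ((x + s *\<^sub>R v) + t *\<^sub>R w)) w) (at t)" if "0 \<le> t" "t \<le> h" for t
    using sub[of s t] that s by (intro frechet_derivative_line d2) auto
  from MVT2[OF h this] obtain t where t: "0 < t" "t < h"
    "?G ((x + s *\<^sub>R v) + h *\<^sub>R w) - ?G ((x + s *\<^sub>R v) + 0 *\<^sub>R w) =
      h * frechet_derivative ?G (at ((x + s *\<^sub>R v) + t *\<^sub>R w)) w" by auto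
  have "p h - p 0 = h * (h * frechet_derivative ?G (at (x + s *\<^sub>R v + t *\<^sub>R w)) w)"
    using s(3) t(3) by (simp add: algebra_simps)
  then show ?thesis using s t unfolding p_def
    by (intro exI[of _ s] exI[of _ t]) (simp add: algebra_simps)
qed

text \<open>Schwarz's theorem: one second difference equals \<open>h * h\<close> times either mixed
  derivative at points near \<open>x\<close>, and continuity of both forces them to agree at
  \<open>x\<close>.\<close>

theorem frechet_derivative_commute:
  fixes F :: "'a::real_normed_vector \<Rightarrow> real"
  assumes "open S" "x \<in> S" and C: "Ck_on 2 S F"
  shows "frechet_derivative (\<lambda>y. frechet_derivative F (at y) v) (at x) w =
    frechet_derivative (\<lambda>y. frechet_derivative F (at y) w) (at x) v"
    (is "?P x = ?Q x")
proof -
  have cont: "isCont (\<lambda>x. frechet_derivative (\<lambda>y. frechet_derivative F (at y) a) (at x) b) x" for a b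
  proof -
    have "Ck_on (Suc (Suc 0)) S F" using C by (simp only: numeral_2_eq_2)
    then have "continuous_on S (\<lambda>x. frechet_derivative (\<lambda>y. frechet_derivative F (at y) a) (at x) b)"
      by (simp only: Ck_on.simps)
    then show ?thesis using assms(1,2) by (simp only: continuous_on_eq_continuous_at)
  qed
  have le: "\<bar>?P x - ?Q x\<bar> \<le> e" if "e > 0" for e
  proof -
    have e: "e / 2 > 0" using that by simp
    obtain d1 where d1: "d1 > 0" "\<And>y. dist y x < d1 \<Longrightarrow> dist (?P y) (?P x) < e / 2"
      using cont e unfolding continuous_at_eps_delta by meson
    obtain d2 where d2: "d2 > 0" "\<And>y. dist y x < d2 \<Longrightarrow> dist (?Q y) (?Q x) < e / 2"
      using cont e unfolding continuous_at_eps_delta by meson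
    obtain d3 where d3: "d3 > 0" "ball x d3 \<subseteq> S" using assms open_contains_ball by blast
    define d where "d = min d1 (min d2 d3)"
    have d: "d > 0" using d1 d2 d3 by (simp add: d_def)
    \<comment> \<open>With this \<open>h\<close> the parallelogram spanned by
      \<open>h *\<^sub>R v\<close> and \<open>h *\<^sub>R w\<close> stays within distance
      \<open>d\<close> of \<open>x\<close>; the summand 1 makes the estimate strict and covers zero
      vectors.\<close>
    define h where "h = d / (norm v + norm w + 1)"
    have nn: "norm v + norm w + 1 > 0" by (smt (verit) norm_ge_zero)
    have h: "h > 0" using d nn by (simp add: h_def)
    have near: "dist (x + s *\<^sub>R v + t *\<^sub>R w) x < d" if "0 \<le> s" "s \<le> h" "0 \<le> t" "t \<le> h" for s t
    proof -
      have "dist (x + s *\<^sub>R v + t *\<^sub>R w) x = norm (s *\<^sub>R v + t *\<^sub>R w)" by (simp add: dist_norm)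
      also have "\<dots> \<le> s * norm v + t * norm w"
        using norm_triangle_ineq[of "s *\<^sub>R v" "t *\<^sub>R w"] that by simp
      also have "\<dots> \<le> h * norm v + h * norm w" using that by (intro add_mono mult_right_mono) auto
      also have "\<dots> < h * (norm v + norm w + 1)" using h by (simp add: algebra_simps)
      also have "\<dots> = d" using nn by (simp add: h_def)
      finally show ?thesis .
    qed
    have sub: "x + s *\<^sub>R v + t *\<^sub>R w \<in> S" if "0 \<le> s" "s \<le> h" "0 \<le> t" "t \<le> h" for s t
      using near[OF that] d3 by (auto simp: d_def dist_commute)
    have sub': "x + s *\<^sub>R w + t *\<^sub>R v \<in> S" if "0 \<le> s" "s \<le> h" "0 \<le> t" "t \<le> h" for s t
      using sub[of t s] that by (simp add: algebra_simps)
    obtain s t where st: "0 < s" "s < h" "0 < t" "t < h"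
      "F (x + h *\<^sub>R v + h *\<^sub>R w) - F (x + h *\<^sub>R v) - F (x + h *\<^sub>R w) + F x = h * (h * ?P (x + s *\<^sub>R v + t *\<^sub>R w))"
      using second_difference_mvt[OF C h sub] by blast
    obtain s' t' where st': "0 < s'" "s' < h" "0 < t'" "t' < h"
      "F (x + h *\<^sub>R w + h *\<^sub>R v) - F (x + h *\<^sub>R w) - F (x + h *\<^sub>R v) + F x = h * (h * ?Q (x + s' *\<^sub>R w + t' *\<^sub>R v))"
      using second_difference_mvt[OF C h sub'] by blast
    have "h * (h * ?P (x + s *\<^sub>R v + t *\<^sub>R w)) = h * (h * ?Q (x + s' *\<^sub>R w + t' *\<^sub>R v))"
      by (rule trans[OF st(5)[symmetric] trans[OF _ st'(5)]]) (simp add: add.commute add.left_commute)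
    then have "?P (x + s *\<^sub>R v + t *\<^sub>R w) = ?Q (x + s' *\<^sub>R w + t' *\<^sub>R v)"
      using h by (metis mult_cancel_left less_irrefl)
    moreover have "x + s' *\<^sub>R w + t' *\<^sub>R v = x + t' *\<^sub>R v + s' *\<^sub>R w"
      by (simp add: algebra_simps)
    ultimately have "?P (x + s *\<^sub>R v + t *\<^sub>R w) = ?Q (x + t' *\<^sub>R v + s' *\<^sub>R w)"
      by (simp only:)
    moreover have "dist (?P (x + s *\<^sub>R v + t *\<^sub>R w)) (?P x) < e / 2"
      using near[of s t] st by (intro d1) (auto simp: d_def)
    moreover have "dist (?Q (x + t' *\<^sub>R v + s' *\<^sub>R w)) (?Q x) < e / 2"
      using near[of t' s'] st' by (intro d2) (auto simp: d_def)
    ultimately show ?thesis unfolding dist_real_def by linarith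
  qed
  have "\<bar>?P x - ?Q x\<bar> \<le> 0" 
  proof (rule field_le_epsilon)
    fix e :: real assume "e > 0"
    from le[OF this] show "\<bar>?P x - ?Q x\<bar> \<le> 0 + e" by linarith
  qed
  then show ?thesis by linarith
qed

section \<open>Functions of space and time\<close>

lemma frechet_derivative_slice:
  fixes F :: "'a::real_normed_vector \<times> real \<Rightarrow> real"
  assumes "F differentiable at (x, t)"
  shows "(\<lambda>x. F (x, t)) differentiable at x"
    and "frechet_derivative (\<lambda>x. F (x, t)) (at x) v = frechet_derivative F (at (x, t)) (v, 0)"
    and "((\<lambda>t. F (x, t)) has_real_derivative frechet_derivative F (at (x, t)) (0, 1)) (at t)"
proof -
  have F: "(F has_derivative frechet_derivative F (at (x, t))) (at (x, t))"
    using assms frechet_derivative_works by blast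
  have "((\<lambda>x. (x, t)) has_derivative (\<lambda>v. (v, 0))) (at x)"
    by (intro has_derivative_Pair has_derivative_ident has_derivative_const)
  from has_derivative_compose[OF this F]
  have 1: "((\<lambda>x. F (x, t)) has_derivative (\<lambda>v. frechet_derivative F (at (x, t)) (v, 0))) (at x)" .
  then show "(\<lambda>x. F (x, t)) differentiable at x" unfolding differentiable_def by blast
  show "frechet_derivative (\<lambda>x. F (x, t)) (at x) v = frechet_derivative F (at (x, t)) (v, 0)"
    by (simp add: frechet_derivative_at[OF 1, symmetric])
  show "((\<lambda>t. F (x, t)) has_real_derivative frechet_derivative F (at (x, t)) (0, 1)) (at t)"
    using frechet_derivative_line[of F "(x, 0)" t "(0, 1)"] assms by simp
qed

lemma Ck_on_slice:
  fixes F :: "'a::real_normed_vector \<times> real \<Rightarrow> real"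
  assumes "open U" "t \<in> J"
  shows "Ck_on k (U \<times> J) F \<Longrightarrow> Ck_on k U (\<lambda>x. F (x, t))"
proof (induction k arbitrary: F)
  case 0
  then have "continuous_on (U \<times> J) F" by simp
  moreover have "continuous_on U (\<lambda>x. (x, t))" by (intro continuous_intros)
  ultimately have "continuous_on U (\<lambda>x. F (x, t))"
    by (rule continuous_on_compose2) (use assms(2) in auto)
  then show ?case by simp
next
  case (Suc k)
  have d: "F differentiable at (x, t)" if "x \<in> U" for x using Suc.prems assms(2) that by auto
  have "frechet_derivative (\<lambda>x. F (x, t)) (at x) = (\<lambda>v. frechet_derivative F (at (x, t)) (v, 0))"
    if "x \<in> U" for x
    using frechet_derivative_slice(2)[OF d[OF that]] by blast
  then have "((\<lambda>x. F (x, t)) has_derivative (\<lambda>v. frechet_derivative F (at (x, t)) (v, 0))) (at x)"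
    if "x \<in> U" for x
    using frechet_derivative_slice(1)[OF d[OF that]] that by (metis frechet_derivative_works)
  moreover have "Ck_on k U (\<lambda>x. frechet_derivative F (at (x, t)) (v, 0))" for v
    by (rule Suc.IH) (use Suc.prems in simp)
  ultimately show ?case
    by (rule Ck_on_Suc_I[OF assms(1), where f' = "\<lambda>x v. frechet_derivative F (at (x, t)) (v, 0)"])
qed

lemma smooth_on_slice:
  fixes F :: "'a::real_normed_vector \<times> real \<Rightarrow> real"
  shows "open U \<Longrightarrow> t \<in> J \<Longrightarrow> smooth_on (U \<times> J) F \<Longrightarrow> smooth_on U (\<lambda>x. F (x, t))"
  unfolding smooth_on_def using Ck_on_slice by blast

text \<open>Meant for coefficients that do not depend on time, such as the inverse metric.\<close>

lemma Ck_on_fst: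
  fixes f :: "'a::real_normed_vector \<Rightarrow> real"
  assumes "open U" "open J"
  shows "Ck_on k U f \<Longrightarrow> Ck_on k (U \<times> (J::real set)) (\<lambda>z. f (fst z))"
proof (induction k arbitrary: f)
  case 0
  then have "continuous_on U f" by simp
  moreover have "continuous_on (U \<times> J) fst" by (intro continuous_intros)
  ultimately have "continuous_on (U \<times> J) (\<lambda>z. f (fst z))"
    by (rule continuous_on_compose2) auto
  then show ?case by simp
next
  case (Suc k)
  show ?case
  proof (rule Ck_on_Suc_I[where f' = "\<lambda>z v. frechet_derivative f (at (fst z)) (fst v)"])
    show "open (U \<times> J)" using assms by (simp add: open_Times)
    show "((\<lambda>z. f (fst z)) has_derivative (\<lambda>v. frechet_derivative f (at (fst z)) (fst v))) (at z)"
      if "z \<in> U \<times> J" for z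
    proof -
      have "(f has_derivative frechet_derivative f (at (fst z))) (at (fst z))"
        using Suc.prems that by (auto simp: frechet_derivative_works)
      from has_derivative_compose[OF bounded_linear_imp_has_derivative[OF bounded_linear_fst] this]
      show ?thesis .
    qed
    show "Ck_on k (U \<times> J) (\<lambda>x. frechet_derivative f (at (fst x)) (fst v))" for v
      by (rule Suc.IH) (use Suc.prems in simp)
  qed
qed

lemma smooth_on_fst:
  fixes f :: "'a::real_normed_vector \<Rightarrow> real"
  shows "open U \<Longrightarrow> open (J::real set) \<Longrightarrow> smooth_on U f \<Longrightarrow> smooth_on (U \<times> J) (\<lambda>z. f (fst z))"
  unfolding smooth_on_def using Ck_on_fst by blast

section \<open>Coordinate derivatives in a chart\<close>

definition chart_gamma ::
  "('m, 'n::finite) tensor2 \<Rightarrow> ('m, 'n) chart \<Rightarrow> ('m \<Rightarrow> real) \<Rightarrow> ('m \<Rightarrow> real) \<Rightarrow> 'm \<Rightarrow> real" where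
  "chart_gamma g \<kappa> a b p = (\<Sum>i. pd \<kappa> i a p * grad g b \<kappa> p $ i)"

text \<open>The covariant form \<open>\<partial>\<^sub>k X\<^sup>k +
  \<Gamma>\<^sup>l\<^sub>l\<^sub>k X\<^sup>k\<close> is preferred to the one with the volume
  density: Bochner's formula then becomes index algebra in which no determinant is
  differentiated.\<close>

definition chart_div :: "('m, 'n::finite) tensor2 \<Rightarrow> ('m, 'n) chart \<Rightarrow> ('m \<Rightarrow> real ^ 'n) \<Rightarrow> 'm \<Rightarrow> real" where
  "chart_div g \<kappa> X p =
     (\<Sum>k. pd \<kappa> k (\<lambda>q. X q $ k) p) + (\<Sum>k l. christoffel g \<kappa> l l k p * X p $ k)"

definition chart_lap :: "('m, 'n::finite) tensor2 \<Rightarrow> ('m, 'n) chart \<Rightarrow> ('m \<Rightarrow> real) \<Rightarrow> 'm \<Rightarrow> real" where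
  "chart_lap g \<kappa> f = chart_div g \<kappa> (grad g f \<kappa>)"

definition csmooth :: "('m, 'n::finite) chart \<Rightarrow> 'm set \<Rightarrow> ('m \<Rightarrow> real) \<Rightarrow> bool" where
  "csmooth \<kappa> V f \<longleftrightarrow> smooth_on (chart_map \<kappa> ` V) (\<lambda>x. f (chart_inv \<kappa> x))"

text \<open>Kept apart from \<open>csmooth\<close> because the product and chain rules must also
  serve for bump functions, which are only of class C^1.\<close>

definition cdiff :: "('m, 'n::finite) chart \<Rightarrow> ('m \<Rightarrow> real) \<Rightarrow> 'm \<Rightarrow> bool" where
  "cdiff \<kappa> f p \<longleftrightarrow> (\<lambda>x. f (chart_inv \<kappa> x)) differentiable at (chart_map \<kappa> p)"

lemma pd_eqI:
  assumes "((\<lambda>x. f (chart_inv \<kappa> x)) has_derivative D) (at (chart_map \<kappa> p))"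
  shows "pd \<kappa> i f p = D (axis i 1)"
  unfolding pd_def using frechet_derivative_at[OF assms] by simp

lemma cdiff_has_derivative:
  assumes "cdiff \<kappa> f p"
  obtains D where "((\<lambda>x. f (chart_inv \<kappa> x)) has_derivative D) (at (chart_map \<kappa> p))"
    "\<And>i. pd \<kappa> i f p = D (axis i 1)"
proof -
  obtain D where D: "((\<lambda>x. f (chart_inv \<kappa> x)) has_derivative D) (at (chart_map \<kappa> p))"
    using assms unfolding cdiff_def differentiable_def by blast
  show ?thesis by (rule that[OF D pd_eqI[OF D]])
qed

locale chart =
  fixes \<kappa> :: "('m::t2_space, 'n::finite) chart"
  assumes open_dom: "open (chart_dom \<kappa>)" and open_codom: "open (chart_codom \<kappa>)"
    and homeo: "homeomorphism (chart_dom \<kappa>) (chart_codom \<kappa>) (chart_map \<kappa>) (chart_inv \<kappa>)"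
begin

lemma inv_map [simp]: "p \<in> chart_dom \<kappa> \<Longrightarrow> chart_inv \<kappa> (chart_map \<kappa> p) = p"
  using homeo by (simp add: homeomorphism_def)

lemma inv_map': "V \<subseteq> chart_dom \<kappa> \<Longrightarrow> p \<in> V \<Longrightarrow> chart_inv \<kappa> (chart_map \<kappa> p) = p"
  by auto

lemma open_map: "open V \<Longrightarrow> V \<subseteq> chart_dom \<kappa> \<Longrightarrow> open (chart_map \<kappa> ` V)"
  using homeomorphism_imp_open_map[OF homeo, of V] open_codom
  by (metis Int_absorb1 Int_absorb2 open_Int open_openin_trans openin_open openin_open_trans)

lemma pd_cong:
  assumes "open V" "V \<subseteq> chart_dom \<kappa>" "p \<in> V" "\<And>q. q \<in> V \<Longrightarrow> f q = h q"
  shows "pd \<kappa> i f p = pd \<kappa> i h p"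
proof -
  have "frechet_derivative (\<lambda>x. f (chart_inv \<kappa> x)) (at (chart_map \<kappa> p)) =
      frechet_derivative (\<lambda>x. h (chart_inv \<kappa> x)) (at (chart_map \<kappa> p))"
    by (rule frechet_derivative_cong_on[OF open_map[OF assms(1,2)]])
      (use assms inv_map'[OF assms(2)] in auto)
  then show ?thesis by (simp add: pd_def)
qed

lemma csmooth_cong:
  assumes "open V" "V \<subseteq> chart_dom \<kappa>" "\<And>q. q \<in> V \<Longrightarrow> f q = h q"
  shows "csmooth \<kappa> V f \<longleftrightarrow> csmooth \<kappa> V h"
  unfolding csmooth_def
  by (rule smooth_on_cong[OF open_map[OF assms(1,2)]]) (use assms inv_map'[OF assms(2)] in auto)

lemma csmooth_subset: "csmooth \<kappa> V f \<Longrightarrow> W \<subseteq> V \<Longrightarrow> csmooth \<kappa> W f"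
  unfolding csmooth_def by (rule smooth_on_subset) auto

lemma csmooth_imp_cdiff: "csmooth \<kappa> V f \<Longrightarrow> p \<in> V \<Longrightarrow> cdiff \<kappa> f p"
  unfolding csmooth_def cdiff_def by (rule smooth_on_imp_differentiable) auto

lemma cdiff_const: "cdiff \<kappa> (\<lambda>q. a) p" by (simp add: cdiff_def)
lemma cdiff_add: "cdiff \<kappa> f p \<Longrightarrow> cdiff \<kappa> h p \<Longrightarrow> cdiff \<kappa> (\<lambda>q. f q + h q) p"
  unfolding cdiff_def by (rule differentiable_add)
lemma cdiff_mult: "cdiff \<kappa> f p \<Longrightarrow> cdiff \<kappa> h p \<Longrightarrow> cdiff \<kappa> (\<lambda>q. f q * h q) p"
  unfolding cdiff_def by (rule differentiable_mult)
lemma cdiff_sum: "finite I \<Longrightarrow> (\<And>i. i \<in> I \<Longrightarrow> cdiff \<kappa> (f i) p) \<Longrightarrow> cdiff \<kappa> (\<lambda>q. \<Sum>i\<in>I. f i q) p"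
  unfolding cdiff_def by (rule differentiable_sum) auto

lemma pd_const: "pd \<kappa> i (\<lambda>q. a) p = 0"
  by (simp add: pd_def)

lemma pd_add:
  assumes "cdiff \<kappa> f p" "cdiff \<kappa> h p"
  shows "pd \<kappa> i (\<lambda>q. f q + h q) p = pd \<kappa> i f p + pd \<kappa> i h p"
proof -
  obtain D where D: "((\<lambda>x. f (chart_inv \<kappa> x)) has_derivative D) (at (chart_map \<kappa> p))"
    "\<And>i. pd \<kappa> i f p = D (axis i 1)" using cdiff_has_derivative[OF assms(1)] by blast
  obtain E where E: "((\<lambda>x. h (chart_inv \<kappa> x)) has_derivative E) (at (chart_map \<kappa> p))"
    "\<And>i. pd \<kappa> i h p = E (axis i 1)" using cdiff_has_derivative[OF assms(2)] by blast
  show ?thesis using pd_eqI[OF has_derivative_add[OF D(1) E(1)]] D(2) E(2) by simp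
qed

lemma pd_mult:
  assumes "cdiff \<kappa> f p" "cdiff \<kappa> h p" "p \<in> chart_dom \<kappa>"
  shows "pd \<kappa> i (\<lambda>q. f q * h q) p = pd \<kappa> i f p * h p + f p * pd \<kappa> i h p"
proof -
  obtain D where D: "((\<lambda>x. f (chart_inv \<kappa> x)) has_derivative D) (at (chart_map \<kappa> p))"
    "\<And>i. pd \<kappa> i f p = D (axis i 1)" using cdiff_has_derivative[OF assms(1)] by blast
  obtain E where E: "((\<lambda>x. h (chart_inv \<kappa> x)) has_derivative E) (at (chart_map \<kappa> p))"
    "\<And>i. pd \<kappa> i h p = E (axis i 1)" using cdiff_has_derivative[OF assms(2)] by blast
  show ?thesis using pd_eqI[OF has_derivative_mult[OF D(1) E(1)]] D(2) E(2) assms(3) by simp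
qed

lemma pd_sum:
  assumes "finite I" "\<And>i. i \<in> I \<Longrightarrow> cdiff \<kappa> (f i) p"
  shows "pd \<kappa> k (\<lambda>q. \<Sum>i\<in>I. f i q) p = (\<Sum>i\<in>I. pd \<kappa> k (f i) p)"
  using assms by (induction I rule: finite_induct) (simp_all add: pd_const pd_add cdiff_sum)

lemma pd_compose_real:
  assumes "cdiff \<kappa> f p" "p \<in> chart_dom \<kappa>" "(F has_real_derivative F') (at (f p))"
  shows "pd \<kappa> i (\<lambda>q. F (f q)) p = F' * pd \<kappa> i f p" "cdiff \<kappa> (\<lambda>q. F (f q)) p"
proof -
  obtain D where D: "((\<lambda>x. f (chart_inv \<kappa> x)) has_derivative D) (at (chart_map \<kappa> p))"
    "\<And>i. pd \<kappa> i f p = D (axis i 1)" using cdiff_has_derivative[OF assms(1)] by blast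
  have "(F has_derivative (\<lambda>y. F' * y)) (at (f (chart_inv \<kappa> (chart_map \<kappa> p))))"
    using assms by (simp add: has_field_derivative_def)
  note E = has_derivative_compose[OF D(1) this]
  show "pd \<kappa> i (\<lambda>q. F (f q)) p = F' * pd \<kappa> i f p" using pd_eqI[OF E] D(2) by simp
  show "cdiff \<kappa> (\<lambda>q. F (f q)) p" using E unfolding cdiff_def differentiable_def by blast
qed

lemma pd_cmult:
  assumes "cdiff \<kappa> f p" "p \<in> chart_dom \<kappa>"
  shows "pd \<kappa> i (\<lambda>q. a * f q) p = a * pd \<kappa> i f p"
  using pd_mult[OF cdiff_const assms] by (simp add: pd_const)

lemma csmooth_pd:
  assumes "open V" "V \<subseteq> chart_dom \<kappa>" "csmooth \<kappa> V f"
  shows "csmooth \<kappa> V (pd \<kappa> i f)"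
proof -
  have "smooth_on (chart_map \<kappa> ` V) (\<lambda>x. pd \<kappa> i f (chart_inv \<kappa> x)) \<longleftrightarrow>
    smooth_on (chart_map \<kappa> ` V) (\<lambda>x. frechet_derivative (\<lambda>x. f (chart_inv \<kappa> x)) (at x) (axis i 1))"
    by (rule smooth_on_cong[OF open_map[OF assms(1,2)]]) (use inv_map'[OF assms(2)] in \<open>auto simp: pd_def\<close>)
  then show ?thesis using assms(3) smooth_on_frechet_derivative unfolding csmooth_def by blast
qed

lemma pd_commute:
  assumes "open V" "V \<subseteq> chart_dom \<kappa>" "csmooth \<kappa> V f" "p \<in> V"
  shows "pd \<kappa> i (pd \<kappa> j f) p = pd \<kappa> j (pd \<kappa> i f) p"
proof -
  let ?F = "\<lambda>x. f (chart_inv \<kappa> x)"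
  note o = open_map[OF assms(1,2)]
  have *: "pd \<kappa> i (pd \<kappa> j f) p =
      frechet_derivative (\<lambda>x. frechet_derivative ?F (at x) (axis j 1)) (at (chart_map \<kappa> p)) (axis i 1)" for i j
  proof -
    have "frechet_derivative (\<lambda>x. pd \<kappa> j f (chart_inv \<kappa> x)) (at (chart_map \<kappa> p)) =
        frechet_derivative (\<lambda>x. frechet_derivative ?F (at x) (axis j 1)) (at (chart_map \<kappa> p))"
      by (rule frechet_derivative_cong_on[OF o])
        (use assms inv_map'[OF assms(2)] in \<open>auto simp: pd_def\<close>)
    then show ?thesis by (simp add: pd_def[of \<kappa> i])
  qed
  have "Ck_on 2 (chart_map \<kappa> ` V) ?F" using assms(3) by (simp add: csmooth_def smooth_on_def)
  from frechet_derivative_commute[OF o _ this] show ?thesis unfolding * using assms(4) by blast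
qed

lemma csmooth_coord:
  assumes "open V" "V \<subseteq> chart_dom \<kappa>"
  shows "csmooth \<kappa> V (\<lambda>q. chart_map \<kappa> q $ k)"
proof -
  have "csmooth \<kappa> V (\<lambda>q. chart_map \<kappa> q $ k) \<longleftrightarrow> smooth_on (chart_map \<kappa> ` V) (\<lambda>x. x $ k)"
    unfolding csmooth_def
    by (rule smooth_on_cong[OF open_map[OF assms]]) (use inv_map'[OF assms(2)] in auto)
  then show ?thesis using smooth_on_linear[OF bounded_linear_vec_nth open_map[OF assms]] by blast
qed

lemma pd_coord:
  assumes "p \<in> chart_dom \<kappa>"
  shows "pd \<kappa> i (\<lambda>q. chart_map \<kappa> q $ k) p = (if i = k then 1 else 0)"
proof -
  have "((\<lambda>x. x $ k) has_derivative (\<lambda>x. x $ k)) (at (chart_map \<kappa> p))"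
    by (rule bounded_linear_imp_has_derivative[OF bounded_linear_vec_nth])
  then have "((\<lambda>x. chart_map \<kappa> (chart_inv \<kappa> x) $ k) has_derivative (\<lambda>x. x $ k)) (at (chart_map \<kappa> p))"
    by (rule has_derivative_transform_within_open[OF _ open_codom]) (use assms in auto)
  from pd_eqI[OF this] show ?thesis by (simp add: axis_def)
qed

end

text \<open>Pure index algebra behind Bochner's formula: \<open>dv i k\<close>, \<open>ddv i j k\<close> and \<open>dG m l i j\<close> stand for
  \<open>\<partial>\<^sub>i v\<^sup>k\<close>, \<open>\<partial>\<^sub>i \<partial>\<^sub>j v\<^sup>k\<close> and \<open>\<partial>\<^sub>m \<Gamma>\<^sup>l\<^sub>i\<^sub>j\<close>. The left-hand side is the divergence of \<open>\<nabla>\<^sub>v v\<close>.\<close>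

lemma bochner_algebra:
  fixes v :: "'n::finite \<Rightarrow> real" and dv :: "'n \<Rightarrow> 'n \<Rightarrow> real" and G ddv :: "'n \<Rightarrow> 'n \<Rightarrow> 'n \<Rightarrow> real"
    and dG :: "'n \<Rightarrow> 'n \<Rightarrow> 'n \<Rightarrow> 'n \<Rightarrow> real"
  assumes sym: "\<And>l i j. G l i j = G l j i" and comm: "\<And>i j k. ddv i j k = ddv j i k"
  defines "B \<equiv> \<lambda>i k. dv i k + (\<Sum>m. G k i m * v m)"
  shows "(\<Sum>k j. dv k j * B j k + v j * (ddv k j k + (\<Sum>m. dG k k j m * v m + G k j m * dv k m)))
      + (\<Sum>k l. G l l k * (\<Sum>j. v j * B j k))
    = (\<Sum>k j. B k j * B j k)
      + (\<Sum>j. v j * ((\<Sum>k. ddv j k k) + (\<Sum>k l. dG j l l k * v k + G l l k * dv j k)))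
      + (\<Sum>j k. (\<Sum>i. dG i i j k - dG j i i k + (\<Sum>m. G i i m * G m j k - G i j m * G m i k)) * v j * v k)"
proof -
  have L: "(\<Sum>k j. dv k j * B j k + v j * (ddv k j k + (\<Sum>m. dG k k j m * v m + G k j m * dv k m)))
      = (\<Sum>k j. dv k j * B j k) + (\<Sum>k j. v j * ddv k j k)
        + (\<Sum>k j m. v j * dG k k j m * v m)
        + (\<Sum>k j m. v j * G k j m * dv k m)"
    by (simp add: sum.distrib sum_distrib_left algebra_simps)
  have BB: "(\<Sum>k j. B k j * B j k) =
      (\<Sum>k j. dv k j * B j k) + (\<Sum>k j m. G j k m * v m * dv j k)
      + (\<Sum>k j. \<Sum>m n. G j k m * v m * G k j n * v n)"
    unfolding B_def by (simp add: sum.distrib sum_distrib_left sum_distrib_right algebra_simps)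
  have V: "(\<Sum>j. v j * ((\<Sum>k. ddv j k k) + (\<Sum>k l. dG j l l k * v k + G l l k * dv j k)))
      = (\<Sum>j k. v j * ddv j k k) + (\<Sum>j k l. v j * dG j l l k * v k)
       + (\<Sum>j k l. v j * G l l k * dv j k)"
    by (simp add: sum.distrib sum_distrib_left algebra_simps)
  have R: "(\<Sum>j k. (\<Sum>i. dG i i j k - dG j i i k + (\<Sum>m. G i i m * G m j k - G i j m * G m i k)) * v j * v k)
     = (\<Sum>j k i. v j * dG i i j k * v k) - (\<Sum>j k i. v j * dG j i i k * v k)
       + (\<Sum>j k. \<Sum>i m. G i i m * G m j k * v j * v k)
       - (\<Sum>j k. \<Sum>i m. G i j m * G m i k * v j * v k)"
    by (simp add: sum.distrib sum_subtractf sum_distrib_left sum_distrib_right algebra_simps)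
  have LB: "(\<Sum>k l. G l l k * (\<Sum>j. v j * B j k))
      = (\<Sum>k l j. v j * G l l k * dv j k)
        + (\<Sum>k l. \<Sum>j m. G l l k * G k j m * v j * v m)"
    unfolding B_def by (simp add: sum.distrib sum_distrib_left algebra_simps)
  have rot3: "(\<Sum>a b c. F a b c) = (\<Sum>c a b. F a b c)"
    for F :: "'n \<Rightarrow> 'n \<Rightarrow> 'n \<Rightarrow> real"
  proof -
    have "(\<Sum>a b c. F a b c) = (\<Sum>a c b. F a b c)"
      by (intro sum.cong refl sum.swap)
    also have "\<dots> = (\<Sum>c a b. F a b c)" by (rule sum.swap)
    finally show ?thesis .
  qed
  have rot4: "(\<Sum>a b. \<Sum>c d. F a b c d) = (\<Sum>d a. \<Sum>b c. F a b c d)"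
    for F :: "'n \<Rightarrow> 'n \<Rightarrow> 'n \<Rightarrow> 'n \<Rightarrow> real"
  proof -
    have "(\<Sum>a b. \<Sum>c d. F a b c d) = (\<Sum>a d. \<Sum>b c. F a b c d)"
      by (intro sum.cong refl rot3)
    also have "\<dots> = (\<Sum>d a. \<Sum>b c. F a b c d)" by (rule sum.swap)
    finally show ?thesis .
  qed
  \<comment> \<open>The expanded sides match by renaming indices, with \<open>comm\<close> in e1 and
    symmetry of \<open>G\<close> in e3 and e6. Two cancellations remain on the right: the derivative
    of the trace of \<open>G\<close> against the second curvature term, and the square of
    \<open>G\<close> from \<open>B k j * B j k\<close> against the fourth.\<close>
  have e1: "(\<Sum>k j. v j * ddv k j k) = (\<Sum>j k. v j * ddv j k k)"
    by (subst sum.swap) (simp add: comm)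
  have e2: "(\<Sum>k j m. v j * dG k k j m * v m) = (\<Sum>j k i. v j * dG i i j k * v k)"
    by (rule rot3[symmetric])
  have e3: "(\<Sum>k j m. v j * G k j m * dv k m) = (\<Sum>k j m. G j k m * v m * dv j k)"
  proof -
    have "(\<Sum>k j m. G j k m * v m * dv j k) = (\<Sum>j k m. G j k m * v m * dv j k)"
      by (rule sum.swap)
    also have "\<dots> = (\<Sum>j m k. G j k m * v m * dv j k)"
      by (intro sum.cong refl sum.swap)
    also have "\<dots> = (\<Sum>k j m. v j * G k j m * dv k m)"
      by (intro sum.cong refl) (subst sym, simp)
    finally show ?thesis by simp
  qed
  have e4: "(\<Sum>k l j. v j * G l l k * dv j k) = (\<Sum>j k l. v j * G l l k * dv j k)"
    by (rule rot3)
  have e5: "(\<Sum>k l. \<Sum>j m. G l l k * G k j m * v j * v m)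
      = (\<Sum>j k. \<Sum>i m. G i i m * G m j k * v j * v k)"
  proof -
    have "(\<Sum>j k. \<Sum>i m. G i i m * G m j k * v j * v k)
        = (\<Sum>m j. \<Sum>k i. G i i m * G m j k * v j * v k)" by (rule rot4)
    also have "\<dots> = (\<Sum>m i. \<Sum>j k. G i i m * G m j k * v j * v k)"
      by (intro sum.cong refl rot3)
    finally show ?thesis by simp
  qed
  have e6: "(\<Sum>k j. \<Sum>m n. G j k m * v m * G k j n * v n)
      = (\<Sum>j k. \<Sum>i m. G i j m * G m i k * v j * v k)"
  proof -
    have "(\<Sum>j k. \<Sum>i m. G i j m * G m i k * v j * v k)
        = (\<Sum>m j. \<Sum>k i. G i j m * G m i k * v j * v k)" by (rule rot4)
    also have "\<dots> = (\<Sum>m i. \<Sum>j k. G i j m * G m i k * v j * v k)"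
      by (intro sum.cong refl rot3)
    also have "\<dots> = (\<Sum>k j. \<Sum>m n. G j k m * v m * G k j n * v n)"
      by (intro sum.cong refl) (subst sym, simp)
    finally show ?thesis by simp
  qed
  show ?thesis unfolding L BB V R LB e1 e2 e3 e4 e5 e6 by simp
qed

section \<open>Riemannian geometry in a chart\<close>

text \<open>Jacobi's formula. The product rule in the Leibniz sum replaces one row at a time by its
  derivative. That row is a combination of the rows of \<open>M x\<close> with coefficients given by
  the inverse matrix, and by Cramer's lemma the determinant sees only the coefficient of the
  replaced row.\<close>

lemma det_has_derivative:
  fixes M :: "'a::real_normed_vector \<Rightarrow> real ^ 'n ^ 'n"
  assumes der: "\<And>i j. ((\<lambda>x. M x $ i $ j) has_derivative M' i j) (at x)" and nz: "det (M x) \<noteq> 0"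
  shows "((\<lambda>x. det (M x)) has_derivative
    (\<lambda>v. det (M x) * (\<Sum>i j. matrix_inv (M x) $ j $ i * M' i j v))) (at x)"
proof -
  let ?P = "{p. p permutes (UNIV :: 'n set)}"
  let ?R = "\<lambda>v i. (\<chi> a b. if a = i then M' i b v else M x $ a $ b) :: real ^ 'n ^ 'n"
  have "((\<lambda>x. det (M x)) has_derivative
      (\<lambda>v. \<Sum>p\<in>?P. of_int (sign p) * (\<Sum>i. M' i (p i) v * (\<Prod>j\<in>UNIV - {i}. M x $ j $ p j)))) (at x)"
    unfolding det_def
    by (intro has_derivative_sum has_derivative_mult_right has_derivative_prod der)
  moreover have "(\<Sum>p\<in>?P. of_int (sign p) * (\<Sum>i. M' i (p i) v * (\<Prod>j\<in>UNIV - {i}. M x $ j $ p j)))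
      = (\<Sum>i. det (?R v i))" for v
  proof -
    have "(\<Prod>a\<in>UNIV. ?R v i $ a $ p a) = M' i (p i) v * (\<Prod>j\<in>UNIV - {i}. M x $ j $ p j)" for i p
    proof -
      have "(\<Prod>a\<in>UNIV. ?R v i $ a $ p a) = ?R v i $ i $ p i * (\<Prod>a\<in>UNIV - {i}. ?R v i $ a $ p a)"
        by (rule prod.remove) auto
      also have "(\<Prod>a\<in>UNIV - {i}. ?R v i $ a $ p a) = (\<Prod>j\<in>UNIV - {i}. M x $ j $ p j)"
        by (rule prod.cong) auto
      finally show ?thesis by simp
    qed
    then show ?thesis unfolding det_def by (simp add: sum_distrib_left) (rule sum.swap)
  qed
  moreover have "det (?R v i) = det (M x) * (\<Sum>j. matrix_inv (M x) $ j $ i * M' i j v)" for v i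
  proof -
    let ?r = "\<chi> j. M' i j v"
    let ?c = "?r v* matrix_inv (M x)"
    have inv: "matrix_inv (M x) ** M x = mat 1"
      using nz by (intro matrix_inv_right_left) (simp add: invertible_det_nz)
    have "?c v* M x = ?r"
      by (simp add: vector_matrix_mul_assoc inv)
    moreover have "?c v* M x = (\<Sum>l. ?c $ l *s row l (M x))"
      by (simp add: vec_eq_iff vector_matrix_mult_def row_def mult.commute)
    ultimately have "?R v i = (\<chi> a. if a = i then (\<Sum>l. ?c $ l *s row l (M x)) else row a (M x))"
      by (simp add: vec_eq_iff row_def)
    then have "det (?R v i) = ?c $ i * det (M x)" by (simp only: cramer_lemma_transpose)
    then show ?thesis by (simp add: vector_matrix_mult_def mult.commute)
  qed
  ultimately show ?thesis by (simp add: sum_distrib_left)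
qed

text \<open>Along the segment from the identity to \<open>G\<close> the quadratic form stays
  positive, so the determinant never vanishes there, and it starts at 1.\<close>

lemma posdef_det_pos:
  fixes G :: "real ^ 'n ^ 'n"
  assumes pos: "\<And>v. v \<noteq> 0 \<Longrightarrow> v \<bullet> (G *v v) > 0"
  shows "det G > 0"
proof (rule ccontr)
  assume neg: "\<not> det G > 0"
  define M where "M t = (1 - t) *\<^sub>R mat 1 + t *\<^sub>R G" for t :: real
  have nz: "det (M t) \<noteq> 0" if t: "0 \<le> t" "t \<le> 1" for t
  proof
    assume "det (M t) = 0"
    then have "\<not> invertible (M t)" by (simp add: invertible_det_nz)
    then obtain v where v: "v \<noteq> 0" "M t *v v = 0"
      using matrix_left_invertible_ker invertible_left_inverse by metis
    have "v \<bullet> (M t *v v) = (1 - t) * (v \<bullet> v) + t * (v \<bullet> (G *v v))"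
      by (simp add: M_def matrix_vector_mult_add_rdistrib scaleR_matrix_vector_assoc[symmetric] inner_add_right)
    moreover have "(1 - t) * (v \<bullet> v) + t * (v \<bullet> (G *v v)) > 0"
    proof (cases "t = 0")
      case True
      then show ?thesis using v by simp
    next
      case False
      then show ?thesis using t pos[OF v(1)] by (intro add_nonneg_pos mult_nonneg_nonneg mult_pos_pos) auto
    qed
    ultimately show False using v by simp
  qed
  have "continuous_on {0..1} (\<lambda>t. det (M t))"
    unfolding det_def M_def by (intro continuous_intros)
  moreover have "det (M 0) = 1" "det (M 1) = det G" by (simp_all add: M_def det_I)
  ultimately obtain t where "0 \<le> t" "t \<le> 1" "det (M t) = 0"
    using IVT2'[of "\<lambda>t. det (M t)" 1 0 0] neg by auto
  then show False using nz by blast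
qed

context chart
begin

lemma csmooth_const: "csmooth \<kappa> V (\<lambda>q. a)"
  unfolding csmooth_def by (rule smooth_on_const)

lemma csmooth_add: "open V \<Longrightarrow> V \<subseteq> chart_dom \<kappa> \<Longrightarrow> csmooth \<kappa> V f \<Longrightarrow> csmooth \<kappa> V h \<Longrightarrow> csmooth \<kappa> V (\<lambda>q. f q + h q)"
  unfolding csmooth_def by (intro smooth_intros open_map)

lemma csmooth_diff: "open V \<Longrightarrow> V \<subseteq> chart_dom \<kappa> \<Longrightarrow> csmooth \<kappa> V f \<Longrightarrow> csmooth \<kappa> V h \<Longrightarrow> csmooth \<kappa> V (\<lambda>q. f q - h q)"
  unfolding csmooth_def by (intro smooth_intros open_map)

lemma csmooth_mult: "open V \<Longrightarrow> V \<subseteq> chart_dom \<kappa> \<Longrightarrow> csmooth \<kappa> V f \<Longrightarrow> csmooth \<kappa> V h \<Longrightarrow> csmooth \<kappa> V (\<lambda>q. f q * h q)"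
  unfolding csmooth_def by (intro smooth_intros open_map)

lemma csmooth_sum: "open V \<Longrightarrow> V \<subseteq> chart_dom \<kappa> \<Longrightarrow> (\<And>i. i \<in> I \<Longrightarrow> csmooth \<kappa> V (f i)) \<Longrightarrow> csmooth \<kappa> V (\<lambda>q. \<Sum>i\<in>I. f i q)"
  unfolding csmooth_def by (intro smooth_intros open_map)

lemma csmooth_ln:
  assumes "open V" "V \<subseteq> chart_dom \<kappa>" "\<And>q. q \<in> V \<Longrightarrow> f q > 0" "csmooth \<kappa> V f"
  shows "csmooth \<kappa> V (\<lambda>q. ln (f q))"
  unfolding csmooth_def
  by (rule smooth_on_ln[OF open_map[OF assms(1,2)]])
    (use assms inv_map'[OF assms(2)] in \<open>auto simp: csmooth_def\<close>)

lemmas csmooth_intros = csmooth_const csmooth_add csmooth_diff csmooth_mult csmooth_sum csmooth_pd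

end

section \<open>Gradient, Christoffel symbols and Hessian in one chart\<close>

locale metric_chart = chart \<kappa> for \<kappa> :: "('m::t2_space, 'n::finite) chart" +
  fixes g :: "('m, 'n) tensor2"
  assumes g_transpose: "p \<in> chart_dom \<kappa> \<Longrightarrow> transpose (g \<kappa> p) = g \<kappa> p"
    and g_pos: "p \<in> chart_dom \<kappa> \<Longrightarrow> v \<noteq> 0 \<Longrightarrow> v \<bullet> (g \<kappa> p *v v) > 0"
    and g_smooth: "csmooth \<kappa> (chart_dom \<kappa>) (\<lambda>q. g \<kappa> q $ i $ j)"
begin

abbreviation "cdom \<equiv> chart_dom \<kappa>"
abbreviation "h q i j \<equiv> matrix_inv (g \<kappa> q) $ i $ j"
abbreviation "\<Gamma> \<equiv> christoffel g \<kappa>"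

lemma g_sym: "p \<in> cdom \<Longrightarrow> g \<kappa> p $ i $ j = g \<kappa> p $ j $ i"
  using arg_cong[OF g_transpose[of p], of "\<lambda>M. M $ j $ i"] by (simp add: transpose_def)

lemma det_pos: "p \<in> cdom \<Longrightarrow> det (g \<kappa> p) > 0"
  using posdef_det_pos g_pos by blast

lemma g_inv: "p \<in> cdom \<Longrightarrow> g \<kappa> p ** matrix_inv (g \<kappa> p) = mat 1" "p \<in> cdom \<Longrightarrow> matrix_inv (g \<kappa> p) ** g \<kappa> p = mat 1"
  using matrix_inv_right_left[of "g \<kappa> p"] det_pos[of p] by (auto simp: invertible_det_nz)

lemma h_transpose: "p \<in> cdom \<Longrightarrow> transpose (matrix_inv (g \<kappa> p)) = matrix_inv (g \<kappa> p)"
proof -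
  assume p: "p \<in> cdom"
  let ?H = "matrix_inv (g \<kappa> p)"
  have "transpose ?H ** g \<kappa> p = transpose (g \<kappa> p ** ?H)"
    by (simp add: matrix_transpose_mul g_transpose[OF p])
  then have 1: "transpose ?H ** g \<kappa> p = mat 1" by (simp add: g_inv(1)[OF p])
  have "transpose ?H = transpose ?H ** (g \<kappa> p ** ?H)" by (simp add: g_inv(1)[OF p])
  also have "\<dots> = ?H" unfolding matrix_mul_assoc 1 by simp
  finally show ?thesis .
qed

lemma h_sym: "p \<in> cdom \<Longrightarrow> h p i j = h p j i"
  using arg_cong[OF h_transpose[of p], of "\<lambda>M. M $ j $ i"] by (simp add: transpose_def)

lemma gh: "p \<in> cdom \<Longrightarrow> (\<Sum>j. g \<kappa> p $ i $ j * h p j k) = (if i = k then 1 else 0)"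
  using g_inv(1)[of p] by (simp add: vec_eq_iff matrix_matrix_mult_def mat_def)

lemma hg: "p \<in> cdom \<Longrightarrow> (\<Sum>j. h p i j * g \<kappa> p $ j $ k) = (if i = k then 1 else 0)"
  using g_inv(2)[of p] by (simp add: vec_eq_iff matrix_matrix_mult_def mat_def)

lemma csmooth_g: "V \<subseteq> cdom \<Longrightarrow> csmooth \<kappa> V (\<lambda>q. g \<kappa> q $ i $ j)"
  using csmooth_subset[OF g_smooth] .

lemma csmooth_h:
  assumes "open V" "V \<subseteq> cdom"
  shows "csmooth \<kappa> V (\<lambda>q. h q i j)"
  unfolding csmooth_def
proof (rule smooth_on_matrix_inv[OF open_map[OF assms]])
  show "det (g \<kappa> (chart_inv \<kappa> x)) \<noteq> 0" if "x \<in> chart_map \<kappa> ` V" for x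
  proof -
    obtain q where "q \<in> V" "x = chart_map \<kappa> q" using \<open>x \<in> _\<close> by blast
    then show ?thesis using det_pos[of q] assms(2) inv_map'[OF assms(2)] by auto
  qed
  show "smooth_on (chart_map \<kappa> ` V) (\<lambda>x. g \<kappa> (chart_inv \<kappa> x) $ i $ j)" for i j
    using csmooth_g[OF assms(2)] by (simp add: csmooth_def)
qed

lemma csmooth_cmult: "open V \<Longrightarrow> V \<subseteq> cdom \<Longrightarrow> csmooth \<kappa> V f \<Longrightarrow> csmooth \<kappa> V (\<lambda>q. a * f q)"
  by (intro csmooth_intros)

lemma csmooth_grad:
  assumes "open V" "V \<subseteq> cdom" "csmooth \<kappa> V f"
  shows "csmooth \<kappa> V (\<lambda>q. grad g f \<kappa> q $ i)"
  unfolding grad_def vec_lambda_beta by (intro csmooth_intros csmooth_h assms)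

lemma csmooth_gamma:
  assumes "open V" "V \<subseteq> cdom" "csmooth \<kappa> V a" "csmooth \<kappa> V b"
  shows "csmooth \<kappa> V (chart_gamma g \<kappa> a b)"
  unfolding chart_gamma_def[abs_def] by (intro csmooth_intros csmooth_grad assms)

lemma csmooth_christoffel:
  assumes "open V" "V \<subseteq> cdom"
  shows "csmooth \<kappa> V (\<Gamma> k i j)"
  unfolding christoffel_def[abs_def] divide_inverse
  by (intro csmooth_intros csmooth_h csmooth_g assms)

lemma csmooth_lap:
  assumes "open V" "V \<subseteq> cdom" "csmooth \<kappa> V f"
  shows "csmooth \<kappa> V (chart_lap g \<kappa> f)"
  unfolding chart_lap_def chart_div_def[abs_def]
  by (intro csmooth_intros csmooth_christoffel csmooth_grad assms)

lemma csmooth_hess: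
  assumes "open V" "V \<subseteq> cdom" "csmooth \<kappa> V f"
  shows "csmooth \<kappa> V (\<lambda>q. hess g f \<kappa> q $ i $ j)"
  unfolding hess_def vec_lambda_beta
  by (intro csmooth_intros csmooth_christoffel assms)

lemma christoffel_sym: "p \<in> cdom \<Longrightarrow> \<Gamma> k i j p = \<Gamma> k j i p"
proof -
  assume p: "p \<in> cdom"
  have "pd \<kappa> l (\<lambda>q. g \<kappa> q $ i $ j) p = pd \<kappa> l (\<lambda>q. g \<kappa> q $ j $ i) p" for l
    by (rule pd_cong[OF open_dom subset_refl p g_sym])
  then show ?thesis unfolding christoffel_def by (simp add: algebra_simps)
qed

lemma christoffel_lower:
  assumes p: "p \<in> cdom"
  shows "(\<Sum>k. g \<kappa> p $ m $ k * \<Gamma> k i j p) =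
    (pd \<kappa> i (\<lambda>q. g \<kappa> q $ j $ m) p + pd \<kappa> j (\<lambda>q. g \<kappa> q $ i $ m) p - pd \<kappa> m (\<lambda>q. g \<kappa> q $ i $ j) p) / 2"
proof -
  define c where "c l = (pd \<kappa> i (\<lambda>q. g \<kappa> q $ j $ l) p + pd \<kappa> j (\<lambda>q. g \<kappa> q $ i $ l) p - pd \<kappa> l (\<lambda>q. g \<kappa> q $ i $ j) p) / 2" for l
  have "(\<Sum>k. g \<kappa> p $ m $ k * \<Gamma> k i j p) = (\<Sum>k l. (g \<kappa> p $ m $ k * h p k l) * c l)"
    by (simp add: christoffel_def c_def sum_distrib_left sum_divide_distrib mult.assoc)
  also have "\<dots> = (\<Sum>l. (\<Sum>k. g \<kappa> p $ m $ k * h p k l) * c l)"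
    by (subst sum.swap) (simp add: sum_distrib_right)
  also have "\<dots> = c m" by (simp add: gh[OF p] if_distrib[of "\<lambda>x. x * _"] cong: if_cong)
  finally show ?thesis by (simp add: c_def)
qed

lemma grad_lower:
  assumes p: "p \<in> cdom"
  shows "(\<Sum>j. g \<kappa> p $ m $ j * grad g f \<kappa> p $ j) = pd \<kappa> m f p"
proof -
  have "(\<Sum>j. g \<kappa> p $ m $ j * grad g f \<kappa> p $ j) = (\<Sum>j l. (g \<kappa> p $ m $ j * h p j l) * pd \<kappa> l f p)"
    by (simp add: grad_def sum_distrib_left mult.assoc)
  also have "\<dots> = (\<Sum>l. (\<Sum>j. g \<kappa> p $ m $ j * h p j l) * pd \<kappa> l f p)"
    by (subst sum.swap) (simp add: sum_distrib_right)
  also have "\<dots> = pd \<kappa> m f p" by (simp add: gh[OF p] if_distrib[of "\<lambda>x. x * _"] cong: if_cong)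
  finally show ?thesis .
qed

lemma chart_gamma_sym: "p \<in> cdom \<Longrightarrow> chart_gamma g \<kappa> a b p = chart_gamma g \<kappa> b a p"
  unfolding chart_gamma_def grad_def
  by (simp add: sum_distrib_left) (subst sum.swap, simp add: h_sym[of p] mult_ac)

lemma hess_sym:
  assumes "open V" "V \<subseteq> cdom" "csmooth \<kappa> V f" "p \<in> V"
  shows "hess g f \<kappa> p $ i $ j = hess g f \<kappa> p $ j $ i"
  using pd_commute[OF assms, of i j] christoffel_sym[of p _ i j] assms by (auto simp: hess_def)

text \<open>The covariant derivative of the gradient field, a tensor with one index up. In these
  components the computation for Bochner's formula differentiates vector components and Christoffel
  symbols but never the metric.\<close>

definition nabla_grad :: "('m \<Rightarrow> real) \<Rightarrow> 'm \<Rightarrow> 'n \<Rightarrow> 'n \<Rightarrow> real" where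
  "nabla_grad f p i k = pd \<kappa> i (\<lambda>q. grad g f \<kappa> q $ k) p + (\<Sum>m. \<Gamma> k i m p * grad g f \<kappa> p $ m)"

text \<open>Metric compatibility in components: differentiating \<open>grad_lower\<close> produces a
  derivative of the metric, which is exactly what the Christoffel terms of the two sides supply
  together.\<close>

lemma nabla_grad_lower:
  assumes V: "open V" "V \<subseteq> cdom" and f: "csmooth \<kappa> V f" and p: "p \<in> V"
  shows "(\<Sum>j. g \<kappa> p $ m $ j * nabla_grad f p i j) = hess g f \<kappa> p $ i $ m"
proof -
  have pd: "p \<in> cdom" using p V by blast
  let ?v = "\<lambda>j. grad g f \<kappa> p $ j"
  let ?dg = "\<lambda>i j k. pd \<kappa> i (\<lambda>q. g \<kappa> q $ j $ k) p"
  note dv = csmooth_imp_cdiff[OF csmooth_grad[OF V f] p]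
  note dg = csmooth_imp_cdiff[OF csmooth_g[OF V(2)] p]
  have "pd \<kappa> i (pd \<kappa> m f) p = pd \<kappa> i (\<lambda>q. \<Sum>j. g \<kappa> q $ m $ j * grad g f \<kappa> q $ j) p"
    by (rule pd_cong[OF V p]) (use V grad_lower in auto)
  also have "\<dots> = (\<Sum>j. ?dg i m j * ?v j) + (\<Sum>j. g \<kappa> p $ m $ j * pd \<kappa> i (\<lambda>q. grad g f \<kappa> q $ j) p)"
    by (simp add: pd_sum cdiff_mult dv dg pd_mult pd sum.distrib)
  finally have 1: "(\<Sum>j. g \<kappa> p $ m $ j * pd \<kappa> i (\<lambda>q. grad g f \<kappa> q $ j) p)
      = pd \<kappa> i (pd \<kappa> m f) p - (\<Sum>j. ?dg i m j * ?v j)" by simp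
  have 2: "(\<Sum>j. g \<kappa> p $ m $ j * (\<Sum>k. \<Gamma> j i k p * ?v k))
      = (\<Sum>k. (?dg i k m + ?dg k i m - ?dg m i k) / 2 * ?v k)"
  proof -
    have "(\<Sum>j. g \<kappa> p $ m $ j * (\<Sum>k. \<Gamma> j i k p * ?v k))
        = (\<Sum>k. (\<Sum>j. g \<kappa> p $ m $ j * \<Gamma> j i k p) * ?v k)"
      by (simp add: sum_distrib_left sum_distrib_right) (subst sum.swap, simp add: mult.assoc)
    then show ?thesis by (simp add: christoffel_lower[OF pd])
  qed
  have 3: "(\<Sum>k. \<Gamma> k i m p * pd \<kappa> k f p) = (\<Sum>j. (?dg i m j + ?dg m i j - ?dg j i m) / 2 * ?v j)"
  proof -
    have "(\<Sum>k. \<Gamma> k i m p * pd \<kappa> k f p) = (\<Sum>k j. g \<kappa> p $ j $ k * \<Gamma> k i m p * ?v j)"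
      by (simp add: grad_lower[OF pd, symmetric] sum_distrib_left g_sym[OF pd] mult_ac)
    also have "\<dots> = (\<Sum>j. (\<Sum>k. g \<kappa> p $ j $ k * \<Gamma> k i m p) * ?v j)"
      by (subst sum.swap) (simp add: sum_distrib_right)
    finally show ?thesis by (simp add: christoffel_lower[OF pd])
  qed
  have "?dg i m j = ?dg i j m" for i j m
    by (rule pd_cong[OF V p]) (use V g_sym in auto)
  \<comment> \<open>Of the six derivatives of the metric, four cancel in pairs and the other two are
    equal by symmetry.\<close>
  then have 4: "(\<Sum>j. (?dg i m j + ?dg m i j - ?dg j i m) / 2 * ?v j)
     + (\<Sum>k. (?dg i k m + ?dg k i m - ?dg m i k) / 2 * ?v k) = (\<Sum>j. ?dg i m j * ?v j)"
    by (simp add: sum.distrib[symmetric] distrib_right[symmetric] add_divide_distrib[symmetric])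
  have "(\<Sum>j. g \<kappa> p $ m $ j * nabla_grad f p i j)
      = (\<Sum>j. g \<kappa> p $ m $ j * pd \<kappa> i (\<lambda>q. grad g f \<kappa> q $ j) p)
       + (\<Sum>j. g \<kappa> p $ m $ j * (\<Sum>k. \<Gamma> j i k p * ?v k))"
    by (simp add: nabla_grad_def distrib_left sum.distrib)
  then show ?thesis unfolding 1 2 hess_def vec_lambda_beta 3 using 4 by simp
qed

lemma nabla_grad_eq:
  assumes V: "open V" "V \<subseteq> cdom" and f: "csmooth \<kappa> V f" and p: "p \<in> V"
  shows "nabla_grad f p i k = (\<Sum>m. h p k m * hess g f \<kappa> p $ i $ m)"
proof -
  have pd: "p \<in> cdom" using p V by blast
  have "(\<Sum>m. h p k m * hess g f \<kappa> p $ i $ m) = (\<Sum>m j. h p k m * g \<kappa> p $ m $ j * nabla_grad f p i j)"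
    by (simp add: nabla_grad_lower[OF assms, symmetric] sum_distrib_left mult.assoc)
  also have "\<dots> = (\<Sum>j. (\<Sum>m. h p k m * g \<kappa> p $ m $ j) * nabla_grad f p i j)"
    by (subst sum.swap) (simp add: sum_distrib_right)
  also have "\<dots> = nabla_grad f p i k" by (simp add: hg[OF pd] if_distrib[of "\<lambda>x. x * _"] cong: if_cong)
  finally show ?thesis by simp
qed

lemma chart_lap_eq:
  assumes V: "open V" "V \<subseteq> cdom" and f: "csmooth \<kappa> V f" and p: "p \<in> V"
  shows "chart_lap g \<kappa> f p = (\<Sum>i. nabla_grad f p i i)"
    and "chart_lap g \<kappa> f p = (\<Sum>i j. h p i j * hess g f \<kappa> p $ i $ j)"
proof -
  have pd: "p \<in> cdom" using p V by blast
  show 1: "chart_lap g \<kappa> f p = (\<Sum>i. nabla_grad f p i i)"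
    unfolding chart_lap_def chart_div_def nabla_grad_def sum.distrib
    by (subst (2) sum.swap) simp
  show "chart_lap g \<kappa> f p = (\<Sum>i j. h p i j * hess g f \<kappa> p $ i $ j)"
    unfolding 1 by (simp add: nabla_grad_eq[OF assms])
qed

text \<open>Leibniz rule for the Levi-Civita connection. The Christoffel term split off from the
  Hessian of \<open>a\<close> is the one needed to complete the derivative of the gradient of
  \<open>b\<close>, so the two corrections cancel.\<close>

lemma pd_gamma:
  assumes V: "open V" "V \<subseteq> cdom" and ab: "csmooth \<kappa> V a" "csmooth \<kappa> V b" and p: "p \<in> V"
  shows "pd \<kappa> i (chart_gamma g \<kappa> a b) p =
    (\<Sum>m. hess g a \<kappa> p $ i $ m * grad g b \<kappa> p $ m) + (\<Sum>m. hess g b \<kappa> p $ i $ m * grad g a \<kappa> p $ m)"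
proof -
  have pd: "p \<in> cdom" using p V by blast
  note da = csmooth_imp_cdiff[OF csmooth_pd[OF V ab(1)] p]
  note db = csmooth_imp_cdiff[OF csmooth_grad[OF V ab(2)] p]
  have "pd \<kappa> i (chart_gamma g \<kappa> a b) p =
      (\<Sum>j. pd \<kappa> i (pd \<kappa> j a) p * grad g b \<kappa> p $ j) + (\<Sum>j. pd \<kappa> j a p * pd \<kappa> i (\<lambda>q. grad g b \<kappa> q $ j) p)"
    unfolding chart_gamma_def[abs_def] by (simp add: pd_sum cdiff_mult da db pd_mult pd sum.distrib)
  also have "(\<Sum>j. pd \<kappa> i (pd \<kappa> j a) p * grad g b \<kappa> p $ j) =
      (\<Sum>m. hess g a \<kappa> p $ i $ m * grad g b \<kappa> p $ m) + (\<Sum>m. (\<Sum>k. \<Gamma> k i m p * pd \<kappa> k a p) * grad g b \<kappa> p $ m)"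
    by (simp add: hess_def sum.distrib[symmetric] distrib_right[symmetric])
  also have "(\<Sum>m. (\<Sum>k. \<Gamma> k i m p * pd \<kappa> k a p) * grad g b \<kappa> p $ m)
      = (\<Sum>k. pd \<kappa> k a p * (\<Sum>m. \<Gamma> k i m p * grad g b \<kappa> p $ m))"
    by (simp add: sum_distrib_left sum_distrib_right) (subst sum.swap, simp add: mult_ac)
  also have "(\<Sum>j. pd \<kappa> j a p * pd \<kappa> i (\<lambda>q. grad g b \<kappa> q $ j) p)
     = (\<Sum>k. pd \<kappa> k a p * nabla_grad b p i k) - (\<Sum>k. pd \<kappa> k a p * (\<Sum>m. \<Gamma> k i m p * grad g b \<kappa> p $ m))"
    by (simp add: nabla_grad_def sum_subtractf[symmetric] right_diff_distrib[symmetric])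
  also have "(\<Sum>k. pd \<kappa> k a p * nabla_grad b p i k) = (\<Sum>m. hess g b \<kappa> p $ i $ m * grad g a \<kappa> p $ m)"
  proof -
    have "(\<Sum>k. pd \<kappa> k a p * nabla_grad b p i k) = (\<Sum>k m. grad g a \<kappa> p $ m * (g \<kappa> p $ m $ k * nabla_grad b p i k))"
      by (simp add: grad_lower[OF pd, symmetric] sum_distrib_right g_sym[OF pd, of _ "_ :: 'n"] mult.assoc)
        (simp add: sum_distrib_left g_sym[OF pd] mult_ac)
    also have "\<dots> = (\<Sum>m. grad g a \<kappa> p $ m * (\<Sum>k. g \<kappa> p $ m $ k * nabla_grad b p i k))"
      by (subst sum.swap) (simp add: sum_distrib_left)
    finally show ?thesis unfolding nabla_grad_lower[OF V ab(2) p] by (simp add: mult.commute)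
  qed
  finally show ?thesis by simp
qed

end

section \<open>Bochner's formula and change of charts\<close>

definition bform :: "real ^ 'n ^ 'n \<Rightarrow> real ^ 'n \<Rightarrow> real ^ 'n \<Rightarrow> real" where
  "bform H x y = (\<Sum>i m. H $ i $ m * x $ i * y $ m)"

context metric_chart
begin

lemma chart_gamma_gamma:
  assumes V: "open V" "V \<subseteq> cdom" and ab: "csmooth \<kappa> V a" "csmooth \<kappa> V b" and p: "p \<in> V"
  shows "chart_gamma g \<kappa> (chart_gamma g \<kappa> a b) f p =
    bform (hess g a \<kappa> p) (grad g f \<kappa> p) (grad g b \<kappa> p) + bform (hess g b \<kappa> p) (grad g f \<kappa> p) (grad g a \<kappa> p)"
  unfolding chart_gamma_def[of g \<kappa> "chart_gamma g \<kappa> a b"] pd_gamma[OF assms] bform_def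
    distrib_right sum.distrib sum_distrib_right
  by (simp add: mult_ac)

lemma bform_hess_sym:
  assumes "open V" "V \<subseteq> cdom" "csmooth \<kappa> V f" "p \<in> V"
  shows "bform (hess g f \<kappa> p) x y = bform (hess g f \<kappa> p) y x"
  unfolding bform_def by (subst sum.swap) (simp add: hess_sym[OF assms] mult_ac)

text \<open>This expresses the Hessian through iterated \<open>\<Gamma>(a, b) = \<langle>\<nabla>a, \<nabla>b\<rangle>\<close> only, which gives its transformation
  law without transforming Christoffel symbols.\<close>

lemma bform_hess_gamma:
  assumes V: "open V" "V \<subseteq> cdom" and s: "csmooth \<kappa> V f" "csmooth \<kappa> V a" "csmooth \<kappa> V b" and p: "p \<in> V"
  shows "2 * bform (hess g f \<kappa> p) (grad g a \<kappa> p) (grad g b \<kappa> p) =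
    chart_gamma g \<kappa> (chart_gamma g \<kappa> f b) a p + chart_gamma g \<kappa> (chart_gamma g \<kappa> f a) b p
    - chart_gamma g \<kappa> (chart_gamma g \<kappa> a b) f p"
  using bform_hess_sym[OF V s(1) p, of "grad g a \<kappa> p" "grad g b \<kappa> p"]
    bform_hess_sym[OF V s(2) p, of "grad g f \<kappa> p" "grad g b \<kappa> p"]
    bform_hess_sym[OF V s(3) p, of "grad g f \<kappa> p" "grad g a \<kappa> p"]
  by (simp add: chart_gamma_gamma[OF V s(1) s(3) p] chart_gamma_gamma[OF V s(1) s(2) p]
      chart_gamma_gamma[OF V s(2) s(3) p])

text \<open>The right-hand side is the field \<open>\<nabla>\<^sub>v v\<close> for
  \<open>v = \<nabla>f\<close>; symmetry of the Hessian is what identifies it with a gradient. Its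
  divergence is the left-hand side of \<open>bochner_algebra\<close>.\<close>

lemma grad_half_gamma:
  assumes V: "open V" "V \<subseteq> cdom" and f: "csmooth \<kappa> V f" and p: "p \<in> V"
  shows "grad g (\<lambda>q. 1 / 2 * chart_gamma g \<kappa> f f q) \<kappa> p $ k = (\<Sum>j. grad g f \<kappa> p $ j * nabla_grad f p j k)"
proof -
  have pd: "p \<in> cdom" using p V by blast
  have "pd \<kappa> i (\<lambda>q. 1 / 2 * chart_gamma g \<kappa> f f q) p = (\<Sum>m. hess g f \<kappa> p $ i $ m * grad g f \<kappa> p $ m)" for i
    using pd_cmult[OF csmooth_imp_cdiff[OF csmooth_gamma[OF V f f] p] pd, of i "1/2"] pd_gamma[OF V f f p, of i]
    by simp
  then have "grad g (\<lambda>q. 1 / 2 * chart_gamma g \<kappa> f f q) \<kappa> p $ k =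
      (\<Sum>i m. grad g f \<kappa> p $ m * (h p k i * hess g f \<kappa> p $ m $ i))"
    by (simp add: grad_def[of _ "\<lambda>q. _ q"] sum_distrib_left hess_sym[OF V f p] mult_ac)
  also have "\<dots> = (\<Sum>m i. grad g f \<kappa> p $ m * (h p k i * hess g f \<kappa> p $ m $ i))"
    by (rule sum.swap)
  finally show ?thesis by (simp add: nabla_grad_eq[OF V f p] sum_distrib_left)
qed

text \<open>The Ricci term comes from commuting covariant derivatives in
  \<open>\<nabla>\<^sub>k \<nabla>\<^sub>j v\<^sup>k\<close>, contracted over \<open>k\<close>.
  After both Laplacians are expanded in \<open>v\<close> and the Christoffel symbols, only index
  algebra is left, and the contraction in \<open>ricci\<close> appears with its own sign
  convention.\<close>

theorem bochner:
  assumes V: "open V" "V \<subseteq> cdom" and f: "csmooth \<kappa> V f" and p: "p \<in> V"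
  shows "chart_lap g \<kappa> (\<lambda>q. 1 / 2 * chart_gamma g \<kappa> f f q) p =
    (\<Sum>k j. nabla_grad f p k j * nabla_grad f p j k) + chart_gamma g \<kappa> (chart_lap g \<kappa> f) f p
    + bform (ricci g \<kappa> p) (grad g f \<kappa> p) (grad g f \<kappa> p)"
proof -
  have pd: "p \<in> cdom" using p V by blast
  define v where "v k q = grad g f \<kappa> q $ k" for k q
  have sv: "csmooth \<kappa> V (v k)" for k unfolding v_def[abs_def] by (rule csmooth_grad[OF V f])
  have dv: "cdiff \<kappa> (v k) p" "cdiff \<kappa> (pd \<kappa> i (v k)) p" "cdiff \<kappa> (\<Gamma> l i j) p" for i j k l
    by (auto intro!: csmooth_imp_cdiff[OF _ p] sv csmooth_pd V csmooth_christoffel)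
  have ng: "nabla_grad f q i k = pd \<kappa> i (v k) q + (\<Sum>m. \<Gamma> k i m q * v m q)" for q i k
    by (simp add: nabla_grad_def v_def[abs_def])
  have dng: "cdiff \<kappa> (\<lambda>q. nabla_grad f q j k) p" for j k
    unfolding ng by (intro cdiff_add cdiff_sum cdiff_mult dv finite)
  have pd_ng: "pd \<kappa> i (\<lambda>q. nabla_grad f q j k) p = pd \<kappa> i (pd \<kappa> j (v k)) p
      + (\<Sum>m. pd \<kappa> i (\<Gamma> k j m) p * v m p + \<Gamma> k j m p * pd \<kappa> i (v m) p)" for i j k
    unfolding ng by (simp add: pd_add pd_sum cdiff_sum cdiff_mult dv pd_mult pd)
  have L1: "pd \<kappa> k (\<lambda>q. grad g (\<lambda>q. 1 / 2 * chart_gamma g \<kappa> f f q) \<kappa> q $ k) p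
      = (\<Sum>j. pd \<kappa> k (v j) p * nabla_grad f p j k + v j p * (pd \<kappa> k (pd \<kappa> j (v k)) p
         + (\<Sum>m. pd \<kappa> k (\<Gamma> k j m) p * v m p + \<Gamma> k j m p * pd \<kappa> k (v m) p)))" for k
  proof -
    have "pd \<kappa> k (\<lambda>q. grad g (\<lambda>q. 1 / 2 * chart_gamma g \<kappa> f f q) \<kappa> q $ k) p
        = pd \<kappa> k (\<lambda>q. \<Sum>j. v j q * nabla_grad f q j k) p"
      by (rule pd_cong[OF V p]) (simp only: grad_half_gamma[OF V f] v_def)
    also have "\<dots> = (\<Sum>j. pd \<kappa> k (v j) p * nabla_grad f p j k + v j p * pd \<kappa> k (\<lambda>q. nabla_grad f q j k) p)"
      by (simp add: pd_sum cdiff_mult dv dng pd_mult pd)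
    finally show ?thesis unfolding pd_ng .
  qed
  have lap: "chart_lap g \<kappa> f q = (\<Sum>k. pd \<kappa> k (v k) q) + (\<Sum>k l. \<Gamma> l l k q * v k q)" for q
    by (simp add: chart_lap_def chart_div_def v_def[abs_def])
  have pd_lap: "pd \<kappa> j (chart_lap g \<kappa> f) p = (\<Sum>k. pd \<kappa> j (pd \<kappa> k (v k)) p)
      + (\<Sum>k l. pd \<kappa> j (\<Gamma> l l k) p * v k p + \<Gamma> l l k p * pd \<kappa> j (v k) p)" for j
    unfolding lap[abs_def]
    by (simp add: pd_add pd_sum cdiff_sum cdiff_mult cdiff_add dv pd_mult pd)
  have "chart_lap g \<kappa> (\<lambda>q. 1 / 2 * chart_gamma g \<kappa> f f q) p =
      (\<Sum>k j. pd \<kappa> k (v j) p * nabla_grad f p j k + v j p * (pd \<kappa> k (pd \<kappa> j (v k)) p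
         + (\<Sum>m. pd \<kappa> k (\<Gamma> k j m) p * v m p + \<Gamma> k j m p * pd \<kappa> k (v m) p)))
      + (\<Sum>k l. \<Gamma> l l k p * (\<Sum>j. v j p * nabla_grad f p j k))"
    unfolding chart_lap_def[of g \<kappa> "\<lambda>q. 1 / 2 * _ q"] chart_div_def L1 grad_half_gamma[OF V f p] v_def[symmetric] ..
  also have "\<dots> = (\<Sum>k j. nabla_grad f p k j * nabla_grad f p j k)
      + (\<Sum>j. v j p * ((\<Sum>k. pd \<kappa> j (pd \<kappa> k (v k)) p)
         + (\<Sum>k l. pd \<kappa> j (\<Gamma> l l k) p * v k p + \<Gamma> l l k p * pd \<kappa> j (v k) p)))
      + (\<Sum>j k. (\<Sum>i. pd \<kappa> i (\<Gamma> i j k) p - pd \<kappa> j (\<Gamma> i i k) p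
          + (\<Sum>m. \<Gamma> i i m p * \<Gamma> m j k p - \<Gamma> i j m p * \<Gamma> m i k p)) * v j p * v k p)"
    unfolding ng
    by (rule bochner_algebra) (auto intro: christoffel_sym pd pd_commute[OF V sv p])
  finally show ?thesis
    unfolding bform_def ricci_def riemann_def chart_gamma_def[of g \<kappa> "chart_lap g \<kappa> f"] pd_lap v_def
    by (simp add: mult.commute)
qed

text \<open>By Jacobi's formula the logarithmic derivative of the density is half of
  \<open>g\<^sup>l\<^sup>m \<partial>\<^sub>i g\<^sub>l\<^sub>m\<close>, and this is the contracted
  Christoffel symbol.\<close>

lemma pd_sqrt_det:
  assumes p: "p \<in> cdom"
  shows "pd \<kappa> i (\<lambda>q. sqrt (det (g \<kappa> q))) p = sqrt (det (g \<kappa> p)) * (\<Sum>l. \<Gamma> l l i p)"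
    and "cdiff \<kappa> (\<lambda>q. sqrt (det (g \<kappa> q))) p"
proof -
  let ?d = "\<lambda>i a b. pd \<kappa> i (\<lambda>q. g \<kappa> q $ a $ b) p"
  have "\<exists>D. ((\<lambda>x. g \<kappa> (chart_inv \<kappa> x) $ a $ b) has_derivative D) (at (chart_map \<kappa> p))" for a b
    using csmooth_imp_cdiff[OF g_smooth p] by (simp add: cdiff_def differentiable_def)
  then obtain D where D: "\<And>a b. ((\<lambda>x. g \<kappa> (chart_inv \<kappa> x) $ a $ b) has_derivative D a b) (at (chart_map \<kappa> p))"
    by metis
  have dp: "det (g \<kappa> p) > 0" by (rule det_pos[OF p])
  note E = det_has_derivative[of "\<lambda>x. g \<kappa> (chart_inv \<kappa> x)", OF D]
  have E: "((\<lambda>x. det (g \<kappa> (chart_inv \<kappa> x))) has_derivative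
      (\<lambda>v. det (g \<kappa> p) * (\<Sum>a b. h p b a * D a b v))) (at (chart_map \<kappa> p))"
    using E p dp by simp
  then have cd: "cdiff \<kappa> (\<lambda>q. det (g \<kappa> q)) p" unfolding cdiff_def differentiable_def by blast
  have 1: "pd \<kappa> i (\<lambda>q. det (g \<kappa> q)) p = det (g \<kappa> p) * (\<Sum>a b. h p b a * ?d i a b)" for i
    using pd_eqI[OF E, of i] pd_eqI[OF D] by simp
  have sq: "(sqrt has_real_derivative inverse (sqrt (det (g \<kappa> p))) / 2) (at (det (g \<kappa> p)))"
    using DERIV_real_sqrt[OF dp] by simp
  show "cdiff \<kappa> (\<lambda>q. sqrt (det (g \<kappa> q))) p" by (rule pd_compose_real(2)[OF cd p sq])
  have sym: "?d i a b = ?d i b a" for i a b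
    by (rule pd_cong[OF open_dom subset_refl p g_sym])
  \<comment> \<open>Contracted with the symmetric inverse metric, the first and third derivative in
    the Christoffel symbol cancel.\<close>
  have "(\<Sum>l. \<Gamma> l l i p) = (\<Sum>l m. h p l m * ?d i l m) / 2"
  proof -
    have "(\<Sum>l m. h p l m * ?d l i m) = (\<Sum>l m. h p l m * ?d m l i)"
      by (subst sum.swap) (simp add: h_sym[OF p] sym)
    then show ?thesis
      by (simp add: christoffel_def sum_divide_distrib[symmetric] distrib_left right_diff_distrib sum.distrib sum_subtractf)
  qed
  moreover have "(\<Sum>a b. h p b a * ?d i a b) = (\<Sum>l m. h p l m * ?d i l m)"
    by (simp add: h_sym[OF p])
  moreover have "pd \<kappa> i (\<lambda>q. sqrt (det (g \<kappa> q))) p = inverse (sqrt (det (g \<kappa> p))) / 2 * (det (g \<kappa> p) * (\<Sum>a b. h p b a * ?d i a b))"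
    using pd_compose_real(1)[OF cd p sq] 1 by simp
  moreover have "inverse (sqrt (det (g \<kappa> p))) * det (g \<kappa> p) = sqrt (det (g \<kappa> p))"
    using dp by (simp add: field_simps)
  ultimately show "pd \<kappa> i (\<lambda>q. sqrt (det (g \<kappa> q))) p = sqrt (det (g \<kappa> p)) * (\<Sum>l. \<Gamma> l l i p)"
    by (metis (no_types, lifting) mult.assoc mult.commute times_divide_eq_right)
qed

text \<open>Reconciles \<open>divergence\<close>, where the volume density is differentiated, with
  \<open>chart_div\<close>. The factor left over is the density of the volume measure in the chart,
  as integration by parts requires.\<close>

lemma pd_density_eq_chart_div:
  assumes p: "p \<in> cdom" and X: "\<And>i. cdiff \<kappa> (\<lambda>q. X q $ i) p"
  shows "(\<Sum>i. pd \<kappa> i (\<lambda>q. sqrt (det (g \<kappa> q)) * X q $ i) p) = sqrt (det (g \<kappa> p)) * chart_div g \<kappa> X p"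
  unfolding pd_mult[OF pd_sqrt_det(2)[OF p] X p] pd_sqrt_det(1)[OF p] chart_div_def sum.distrib
    distrib_left sum_distrib_left sum_distrib_right
  by (simp add: mult_ac)

lemma chart_div_scale_grad:
  assumes V: "open V" "V \<subseteq> cdom" and a: "cdiff \<kappa> a p" and b: "csmooth \<kappa> V b" and p: "p \<in> V"
  shows "chart_div g \<kappa> (\<lambda>q. a q *\<^sub>R grad g b \<kappa> q) p = chart_gamma g \<kappa> a b p + a p * chart_lap g \<kappa> b p"
proof -
  have pd: "p \<in> cdom" using p V by blast
  show ?thesis
    by (simp add: chart_div_def chart_lap_def chart_gamma_def pd_mult[OF a csmooth_imp_cdiff[OF csmooth_grad[OF V b] p] pd]
      sum.distrib distrib_left sum_distrib_left mult_ac)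
qed

end

section \<open>Transformation laws under a change of charts\<close>

lemma Ck_on_bounded_linear_compose:
  assumes "bounded_linear L" "open S"
  shows "Ck_on k S f \<Longrightarrow> Ck_on k S (\<lambda>x. L (f x))"
proof (induction k arbitrary: f)
  case 0
  then show ?case using assms by (simp add: bounded_linear.continuous_on)
next
  case (Suc k)
  obtain f' where f': "\<And>x. x \<in> S \<Longrightarrow> (f has_derivative f' x) (at x)" "\<And>v. Ck_on k S (\<lambda>x. f' x v)"
    using Suc.prems by (rule Ck_on_SucE) blast
  show ?case
    by (rule Ck_on_Suc_I[OF assms(2), where f' = "\<lambda>x v. L (f' x v)"])
      (auto intro!: Suc.IH f' bounded_linear.has_derivative[OF assms(1)])
qed

locale chart_pair = c: metric_chart \<kappa> g + c': metric_chart \<kappa>' g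
  for \<kappa> \<kappa>' :: "('m::t2_space, 'n::finite) chart" and g +
  assumes trans: "smooth_on (chart_map \<kappa> ` (chart_dom \<kappa> \<inter> chart_dom \<kappa>')) (\<lambda>x. chart_map \<kappa>' (chart_inv \<kappa> x))"
    and g_law: "p \<in> chart_dom \<kappa> \<inter> chart_dom \<kappa>' \<Longrightarrow> g \<kappa> p $ i $ j =
          (\<Sum>k l. g \<kappa>' p $ k $ l *
             pd \<kappa> i (\<lambda>q. chart_map \<kappa>' q $ k) p * pd \<kappa> j (\<lambda>q. chart_map \<kappa>' q $ l) p)"
begin

abbreviation "ov \<equiv> chart_dom \<kappa> \<inter> chart_dom \<kappa>'"
abbreviation "y k q \<equiv> chart_map \<kappa>' q $ k"

text \<open>The transpose of the usual Jacobian matrix of the transition map, so that covector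
  components transform by \<open>J p\<close> itself.\<close>

definition J :: "'m \<Rightarrow> real ^ 'n ^ 'n" where "J p = (\<chi> i k. pd \<kappa> i (y k) p)"

lemma open_ov: "open ov" using c.open_dom c'.open_dom by blast

lemma ov_sub: "ov \<subseteq> chart_dom \<kappa>" "ov \<subseteq> chart_dom \<kappa>'" by auto

lemma csmooth_y: "csmooth \<kappa> ov (y k)" "csmooth \<kappa>' ov (y k)"
proof -
  show "csmooth \<kappa> ov (y k)"
    using trans Ck_on_bounded_linear_compose[OF bounded_linear_vec_nth c.open_map[OF open_ov ov_sub(1)]]
    unfolding csmooth_def smooth_on_def by blast
  show "csmooth \<kappa>' ov (y k)" by (rule c'.csmooth_coord[OF open_ov ov_sub(2)])
qed

lemma chain_rule:
  assumes p: "p \<in> ov" and f: "cdiff \<kappa>' f p"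
  shows "pd \<kappa> i f p = (\<Sum>k. J p $ i $ k * pd \<kappa>' k f p)" and "cdiff \<kappa> f p"
proof -
  let ?t = "\<lambda>x. chart_map \<kappa>' (chart_inv \<kappa> x)"
  have "?t differentiable at (chart_map \<kappa> p)"
    by (rule smooth_on_imp_differentiable[OF trans]) (use p in auto)
  then obtain T where T: "(?t has_derivative T) (at (chart_map \<kappa> p))" unfolding differentiable_def by blast
  obtain D where D: "((\<lambda>x. f (chart_inv \<kappa>' x)) has_derivative D) (at (chart_map \<kappa>' p))"
    "\<And>i. pd \<kappa>' i f p = D (axis i 1)" using cdiff_has_derivative[OF f] by blast
  have inv: "chart_inv \<kappa> (chart_map \<kappa> p) = p" using p by simp
  have "((\<lambda>x. f (chart_inv \<kappa>' (?t x))) has_derivative (\<lambda>v. D (T v))) (at (chart_map \<kappa> p))"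
    using has_derivative_compose[OF T, of "\<lambda>x. f (chart_inv \<kappa>' x)" D] D(1) inv by simp
  then have *: "((\<lambda>x. f (chart_inv \<kappa> x)) has_derivative (\<lambda>v. D (T v))) (at (chart_map \<kappa> p))"
    by (rule has_derivative_transform_within_open[OF _ c.open_map[OF open_ov ov_sub(1)]])
      (use p in \<open>auto simp: c.inv_map\<close>)
  then show "cdiff \<kappa> f p" unfolding cdiff_def differentiable_def by blast
  have Ty: "J p $ i $ k = T (axis i 1) $ k" for k
    using pd_eqI[OF bounded_linear.has_derivative[OF bounded_linear_vec_nth T], of i] by (simp add: J_def)
  have lin: "linear D" using D(1) by (rule has_derivative_linear)
  have "D (T (axis i 1)) = D (\<Sum>k. T (axis i 1) $ k *\<^sub>R axis k 1)"
    by (simp add: basis_expansion flip: scalar_mult_eq_scaleR)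
  also have "\<dots> = (\<Sum>k. J p $ i $ k * pd \<kappa>' k f p)"
    by (simp add: linear_sum[OF lin] linear_cmul[OF lin] Ty D(2))
  finally show "pd \<kappa> i f p = (\<Sum>k. J p $ i $ k * pd \<kappa>' k f p)" using pd_eqI[OF *] by simp
qed

lemma g_law_matrix: "p \<in> ov \<Longrightarrow> g \<kappa> p = J p ** g \<kappa>' p ** transpose (J p)"
  by (simp add: vec_eq_iff g_law matrix_matrix_mult_def transpose_def J_def sum_distrib_left sum_distrib_right)
    (subst sum.swap, simp add: mult_ac)

lemma h_law_matrix:
  assumes p: "p \<in> ov"
  shows "matrix_inv (g \<kappa>' p) = transpose (J p) ** matrix_inv (g \<kappa> p) ** J p"
proof -
  let ?H = "matrix_inv (g \<kappa> p)" and ?H' = "matrix_inv (g \<kappa>' p)"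
  have "J p ** (g \<kappa>' p ** transpose (J p) ** ?H) = mat 1"
    using c.g_inv(1)[of p] p unfolding g_law_matrix[OF p] by (simp add: matrix_mul_assoc)
  \<comment> \<open>For square matrices a right inverse is a left inverse; this moves
    \<open>J p\<close> to the other end without a separate proof that it is invertible.\<close>
  then have "(g \<kappa>' p ** transpose (J p) ** ?H) ** J p = mat 1" by (simp add: matrix_left_right_inverse)
  then have 1: "g \<kappa>' p ** (transpose (J p) ** ?H ** J p) = mat 1" by (simp add: matrix_mul_assoc)
  have "?H' = ?H' ** (g \<kappa>' p ** (transpose (J p) ** ?H ** J p))" unfolding 1 by simp
  also have "\<dots> = (?H' ** g \<kappa>' p) ** (transpose (J p) ** ?H ** J p)" by (simp add: matrix_mul_assoc)
  also have "?H' ** g \<kappa>' p = mat 1" using c'.g_inv(2) p by blast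
  finally show ?thesis by simp
qed

definition ovsmooth :: "('m \<Rightarrow> real) \<Rightarrow> bool" where
  "ovsmooth f \<longleftrightarrow> csmooth \<kappa> ov f \<and> csmooth \<kappa>' ov f"

lemma pd_vec: "p \<in> ov \<Longrightarrow> cdiff \<kappa>' f p \<Longrightarrow> (\<chi> i. pd \<kappa> i f p) = J p *v (\<chi> i. pd \<kappa>' i f p)"
  by (simp add: vec_eq_iff matrix_vector_mult_def chain_rule(1))

lemma gamma_vec: "chart_gamma g \<kappa>0 a b p = (\<chi> i. pd \<kappa>0 i a p) \<bullet> (matrix_inv (g \<kappa>0 p) *v (\<chi> i. pd \<kappa>0 i b p))"
  by (simp add: chart_gamma_def grad_def inner_vec_def matrix_vector_mult_def)

lemma gamma_invariant:
  assumes p: "p \<in> ov" and ab: "cdiff \<kappa>' a p" "cdiff \<kappa>' b p"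
  shows "chart_gamma g \<kappa> a b p = chart_gamma g \<kappa>' a b p"
proof -
  let ?H = "matrix_inv (g \<kappa> p)" and ?a = "\<chi> i. pd \<kappa>' i a p" and ?b = "\<chi> i. pd \<kappa>' i b p"
  have "(J p *v ?a) \<bullet> (?H *v (J p *v ?b)) = ?a \<bullet> (transpose (J p) *v (?H *v (J p *v ?b)))"
    by (metis inner_commute dot_lmul_matrix transpose_matrix_vector)
  then show ?thesis
    unfolding gamma_vec pd_vec[OF p ab(1)] pd_vec[OF p ab(2)] h_law_matrix[OF p]
    by (simp add: matrix_vector_mul_assoc matrix_mul_assoc)
qed

lemma ovsmooth_gamma:
  assumes "ovsmooth a" "ovsmooth b"
  shows "ovsmooth (chart_gamma g \<kappa> a b)"
proof -
  have "csmooth \<kappa>' ov (chart_gamma g \<kappa>' a b)"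
    using assms by (intro c'.csmooth_gamma open_ov ov_sub) (auto simp: ovsmooth_def)
  moreover have "csmooth \<kappa>' ov (chart_gamma g \<kappa> a b) \<longleftrightarrow> csmooth \<kappa>' ov (chart_gamma g \<kappa>' a b)"
    using assms c'.csmooth_imp_cdiff
    by (intro c'.csmooth_cong open_ov ov_sub gamma_invariant) (auto simp: ovsmooth_def)
  moreover have "csmooth \<kappa> ov (chart_gamma g \<kappa> a b)"
    using assms by (intro c.csmooth_gamma open_ov ov_sub) (auto simp: ovsmooth_def)
  ultimately show ?thesis by (simp add: ovsmooth_def)
qed

lemma ovsmooth_gamma_gamma:
  assumes "ovsmooth a" "ovsmooth b" "ovsmooth f" and p: "p \<in> ov"
  shows "chart_gamma g \<kappa> (chart_gamma g \<kappa> a b) f p = chart_gamma g \<kappa>' (chart_gamma g \<kappa>' a b) f p"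
proof -
  have cd: "cdiff \<kappa>' e q" if "ovsmooth e" "q \<in> ov" for e q
    using that c'.csmooth_imp_cdiff unfolding ovsmooth_def by blast
  have "chart_gamma g \<kappa> (chart_gamma g \<kappa> a b) f p = chart_gamma g \<kappa>' (chart_gamma g \<kappa> a b) f p"
    by (intro gamma_invariant p cd ovsmooth_gamma assms)
  \<comment> \<open>The inner products agree on the whole open overlap and not only at
    \<open>p\<close>, so their derivatives agree too.\<close>
  also have "\<dots> = chart_gamma g \<kappa>' (chart_gamma g \<kappa>' a b) f p"
    unfolding chart_gamma_def[of g \<kappa>' "chart_gamma g _ a b"]
    by (intro sum.cong refl arg_cong2[where f = "(*)"] c'.pd_cong[OF open_ov ov_sub(2) p] gamma_invariant cd assms)
  finally show ?thesis .
qed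

lemma bform_hess_invariant:
  assumes "ovsmooth f" "ovsmooth a" "ovsmooth b" and p: "p \<in> ov"
  shows "bform (hess g f \<kappa> p) (grad g a \<kappa> p) (grad g b \<kappa> p) = bform (hess g f \<kappa>' p) (grad g a \<kappa>' p) (grad g b \<kappa>' p)"
  using c.bform_hess_gamma[OF open_ov ov_sub(1) _ _ _ p, of f a b] c'.bform_hess_gamma[OF open_ov ov_sub(2) _ _ _ p, of f a b]
    ovsmooth_gamma_gamma[OF assms(1,3,2) p] ovsmooth_gamma_gamma[OF assms(1,2,3) p] ovsmooth_gamma_gamma[OF assms(2,3,1) p]
    assms by (simp add: ovsmooth_def)

lemma bform_matrix: "bform H v w = v \<bullet> (H *v w)"
  by (simp add: bform_def inner_vec_def matrix_vector_mult_def sum_distrib_left mult_ac)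

text \<open>The invariant form is tested on the gradients of the coordinates of
  \<open>\<kappa>'\<close>. These are the columns of the inverse metric in \<open>\<kappa>'\<close>
  and the columns of the inverse metric times \<open>J p\<close> in \<open>\<kappa>\<close>, so the
  law appears for the Hessian with both indices raised.\<close>

lemma hess_law_matrix:
  assumes f: "ovsmooth f" and p: "p \<in> ov"
  shows "matrix_inv (g \<kappa>' p) ** hess g f \<kappa>' p ** matrix_inv (g \<kappa>' p) =
    transpose (J p) ** matrix_inv (g \<kappa> p) ** hess g f \<kappa> p ** matrix_inv (g \<kappa> p) ** J p"
proof -
  let ?H = "matrix_inv (g \<kappa> p)" and ?H' = "matrix_inv (g \<kappa>' p)"
  have y: "ovsmooth (y k)" for k using csmooth_y by (simp add: ovsmooth_def)
  have grad: "grad g (y k) \<kappa> p = (?H ** J p) *v axis k 1" for k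
    by (simp add: grad_def J_def vec_eq_iff matrix_vector_mult_basis column_def matrix_matrix_mult_def)
  have grad': "grad g (y k) \<kappa>' p = ?H' *v axis k 1" for k
  proof -
    have "p \<in> chart_dom \<kappa>'" using p by blast
    then show ?thesis
      by (simp add: grad_def vec_eq_iff matrix_vector_mult_basis column_def c'.pd_coord if_distrib[of "(*) _"] cong: if_cong)
  qed
  have entry: "(transpose P ** S ** P) $ k $ l = (P *v axis k 1) \<bullet> (S *v (P *v axis l 1))" for P S :: "real ^ 'n ^ 'n" and k l
  proof -
    have "(transpose P ** S ** P) $ k $ l = (transpose P ** (S ** P)) $ k $ l" by (simp add: matrix_mul_assoc)
    also have "\<dots> = column k P \<bullet> column l (S ** P)"
      unfolding matrix_matrix_mult_def[of "transpose P"] by (simp add: transpose_def inner_vec_def column_def)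
    also have "column l (S ** P) = S *v (P *v axis l 1)"
      by (simp add: matrix_vector_mul_assoc flip: matrix_vector_mult_basis)
    finally show ?thesis by (simp add: matrix_vector_mult_basis)
  qed
  have "transpose (?H ** J p) ** hess g f \<kappa> p ** (?H ** J p) = transpose ?H' ** hess g f \<kappa>' p ** ?H'"
    using bform_hess_invariant[OF f y y p]
    by (simp add: vec_eq_iff entry grad grad' bform_matrix)
  then show ?thesis using p
    by (simp add: matrix_transpose_mul c.h_transpose c'.h_transpose matrix_mul_assoc)
qed

text \<open>Under the trace the factors can be rotated until each \<open>J p\<close> meets the
  metric of \<open>\<kappa>'\<close> and a transposed \<open>J p\<close>; that product is the metric
  of \<open>\<kappa>\<close>.\<close>

lemma trace_hess_invariant:
  assumes f: "ovsmooth f" and p: "p \<in> ov"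
  shows "trace (matrix_inv (g \<kappa> p) ** hess g f \<kappa> p) = trace (matrix_inv (g \<kappa>' p) ** hess g f \<kappa>' p)" (is ?T1)
    and "trace (matrix_inv (g \<kappa> p) ** hess g f \<kappa> p ** (matrix_inv (g \<kappa> p) ** hess g f \<kappa> p)) =
      trace (matrix_inv (g \<kappa>' p) ** hess g f \<kappa>' p ** (matrix_inv (g \<kappa>' p) ** hess g f \<kappa>' p))" (is ?T2)
proof -
  let ?H = "matrix_inv (g \<kappa> p)" and ?H' = "matrix_inv (g \<kappa>' p)"
  let ?S = "hess g f \<kappa> p" and ?S' = "hess g f \<kappa>' p" and ?J = "J p" and ?G' = "g \<kappa>' p"
  have ps: "p \<in> chart_dom \<kappa>" "p \<in> chart_dom \<kappa>'" using p by auto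
  let ?K = "?H ** ?S ** ?H"
  let ?Q = "transpose ?J ** ?K ** ?J"
  have HG: "?H' ** ?S' = ?Q ** ?G'"
  proof -
    have "?H' ** ?S' = ?H' ** ?S' ** (?H' ** ?G')" by (simp add: c'.g_inv(2)[OF ps(2)])
    also have "\<dots> = ?H' ** ?S' ** ?H' ** ?G'" by (simp add: matrix_mul_assoc)
    also have "\<dots> = ?Q ** ?G'" unfolding hess_law_matrix[OF f p] by (simp add: matrix_mul_assoc)
    finally show ?thesis .
  qed
  have KG: "?K ** (?J ** ?G' ** transpose ?J) = ?H ** ?S"
  proof -
    have "?K ** (?J ** ?G' ** transpose ?J) = ?H ** ?S ** (?H ** g \<kappa> p)"
      unfolding g_law_matrix[OF p, symmetric] by (simp add: matrix_mul_assoc)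
    then show ?thesis by (simp add: c.g_inv(2)[OF ps(1)])
  qed
  have "trace (?Q ** ?G') = trace (transpose ?J ** (?K ** ?J ** ?G'))" by (simp add: matrix_mul_assoc)
  also have "\<dots> = trace (?K ** (?J ** ?G' ** transpose ?J))"
    by (subst trace_mul_sym) (simp add: matrix_mul_assoc)
  finally show ?T1 unfolding HG KG ..
  have "trace (?Q ** ?G' ** (?Q ** ?G')) = trace (transpose ?J ** (?K ** (?J ** ?G' ** transpose ?J) ** ?K ** ?J ** ?G'))"
    by (simp add: matrix_mul_assoc)
  also have "\<dots> = trace (?K ** (?J ** ?G' ** transpose ?J) ** (?K ** (?J ** ?G' ** transpose ?J)))"
    by (subst trace_mul_sym) (simp add: matrix_mul_assoc)
  finally show ?T2 unfolding HG KG ..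
qed

end

section \<open>Gradient product and Laplacian on the manifold\<close>

lemma trace_mul_sum: "trace (P ** Q) = (\<Sum>i j. P $ i $ j * Q $ j $ i)"
  by (simp add: trace_def matrix_matrix_mult_def)

context metric_chart
begin

lemma chart_lap_trace:
  assumes "open V" "V \<subseteq> cdom" "csmooth \<kappa> V f" "p \<in> V"
  shows "chart_lap g \<kappa> f p = trace (matrix_inv (g \<kappa> p) ** hess g f \<kappa> p)"
  unfolding chart_lap_eq(2)[OF assms] trace_mul_sum by (simp add: hess_sym[OF assms])

lemma nabla_grad_trace:
  assumes V: "open V" "V \<subseteq> cdom" "csmooth \<kappa> V f" "p \<in> V"
  shows "(\<Sum>k j. nabla_grad f p k j * nabla_grad f p j k) =
    trace (matrix_inv (g \<kappa> p) ** hess g f \<kappa> p ** (matrix_inv (g \<kappa> p) ** hess g f \<kappa> p))"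
proof -
  have p: "p \<in> cdom" using V by blast
  let ?H = "matrix_inv (g \<kappa> p)" and ?S = "hess g f \<kappa> p"
  have "nabla_grad f p i k = (?S ** ?H) $ i $ k" for i k
    by (simp add: nabla_grad_eq[OF V] matrix_matrix_mult_def h_sym[OF p, of k] mult.commute)
  then have "(\<Sum>k j. nabla_grad f p k j * nabla_grad f p j k) = trace ((?S ** ?H) ** (?S ** ?H))"
    by (simp add: trace_mul_sum)
  also have "\<dots> = trace (?S ** (?H ** ?S ** ?H))" by (simp add: matrix_mul_assoc)
  also have "\<dots> = trace (?H ** ?S ** ?H ** ?S)" by (rule trace_mul_sym)
  finally show ?thesis by (simp add: matrix_mul_assoc)
qed

text \<open>For symmetric \<open>S\<close> the squared norm is the trace of the square of the
  endomorphism obtained by raising one index, a form in which cyclicity of the trace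
  applies.\<close>

lemma tensor_norm_trace:
  assumes p: "p \<in> cdom" and S: "\<And>i j. S $ i $ j = S $ j $ i"
  shows "(\<Sum>i j. \<Sum>k l. h p i k * h p j l * S $ i $ j * S $ k $ l) =
    trace (matrix_inv (g \<kappa> p) ** S ** (matrix_inv (g \<kappa> p) ** S))"
proof -
  have "trace (matrix_inv (g \<kappa> p) ** S ** (matrix_inv (g \<kappa> p) ** S)) =
      (\<Sum>i j. \<Sum>k l. h p i k * h p j l * S $ l $ i * S $ k $ j)"
    unfolding trace_mul_sum unfolding matrix_matrix_mult_def vec_lambda_beta sum_product by (simp add: mult_ac)
  also have "\<dots> = (\<Sum>i l. \<Sum>j k. h p i k * h p j l * S $ l $ i * S $ k $ j)"
  proof (rule sum.cong[OF refl])
    fix i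
    have "(\<Sum>j k l. h p i k * h p j l * S $ l $ i * S $ k $ j)
       = (\<Sum>j l k. h p i k * h p j l * S $ l $ i * S $ k $ j)"
      by (intro sum.cong refl sum.swap)
    also have "\<dots> = (\<Sum>l j k. h p i k * h p j l * S $ l $ i * S $ k $ j)"
      by (rule sum.swap)
    finally show "(\<Sum>j k l. h p i k * h p j l * S $ l $ i * S $ k $ j)
       = (\<Sum>l j k. h p i k * h p j l * S $ l $ i * S $ k $ j)" .
  qed
  also have "\<dots> = (\<Sum>i j. \<Sum>k l. h p i k * h p j l * S $ i $ j * S $ k $ l)"
  proof (rule sum.cong[OF refl], rule sum.cong[OF refl])
    fix i l
    have "(\<Sum>j k. h p i k * h p j l * S $ l $ i * S $ k $ j)
        = (\<Sum>k j. h p i k * h p j l * S $ l $ i * S $ k $ j)" by (rule sum.swap)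
    then show "(\<Sum>j k. h p i k * h p j l * S $ l $ i * S $ k $ j)
        = (\<Sum>k j. h p i k * h p l j * S $ i $ l * S $ k $ j)"
      by (simp add: h_sym[OF p, of _ l] S[of l i])
  qed
  finally show ?thesis by simp
qed

text \<open>Raising an index of the metric gives the identity, so the subtraction shifts the
  endomorphism by \<open>a\<close> times the identity; the trace of the identity supplies the
  dimension.\<close>

lemma trace_hess_shift:
  assumes p: "p \<in> cdom"
  defines "H \<equiv> matrix_inv (g \<kappa> p)"
  shows "trace (H ** (S - a *\<^sub>R g \<kappa> p) ** (H ** (S - a *\<^sub>R g \<kappa> p))) =
    trace (H ** S ** (H ** S)) - 2 * a * trace (H ** S) + a\<^sup>2 * real CARD('n)"
proof -
  have "H ** (S - a *\<^sub>R g \<kappa> p) = H ** S - a *\<^sub>R (H ** g \<kappa> p)"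
    by (simp add: vec_eq_iff matrix_matrix_mult_def sum_subtractf right_diff_distrib sum_distrib_left mult.left_commute)
  then have "H ** (S - a *\<^sub>R g \<kappa> p) = H ** S - a *\<^sub>R mat 1"
    using g_inv(2)[OF p] by (simp add: H_def)
  then have "trace (H ** (S - a *\<^sub>R g \<kappa> p) ** (H ** (S - a *\<^sub>R g \<kappa> p)))
      = (\<Sum>i j. ((H ** S) $ i $ j - a * (if i = j then 1 else 0)) * ((H ** S) $ j $ i - a * (if j = i then 1 else 0)))"
    by (simp add: trace_mul_sum mat_def)
  also have "\<dots> = (\<Sum>i j. (H ** S) $ i $ j * (H ** S) $ j $ i
       + (if i = j then a\<^sup>2 - 2 * a * (H ** S) $ i $ i else 0))"
    by (intro sum.cong refl) (auto simp: algebra_simps power2_eq_square)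
  also have "\<dots> = trace (H ** S ** (H ** S)) - 2 * a * trace (H ** S) + a\<^sup>2 * real CARD('n)"
    unfolding trace_mul_sum[of "H ** S" "H ** S"] trace_def[of "H ** S"]
    by (simp add: sum.distrib sum_subtractf sum_distrib_left)
  finally show ?thesis .
qed

end

section \<open>Chart-independent operators on functions\<close>

locale riem =
  fixes A :: "('m::t2_space, 'n::finite) chart set" and g :: "('m, 'n) tensor2"
  assumes atlas: "smooth_atlas A" and metric: "riemannian_metric A g"
begin

lemma metric_chartI:
  assumes k: "\<kappa> \<in> A" shows "metric_chart \<kappa> g"
proof
  show "open (chart_dom \<kappa>)" "open (chart_codom \<kappa>)"
    "homeomorphism (chart_dom \<kappa>) (chart_codom \<kappa>) (chart_map \<kappa>) (chart_inv \<kappa>)"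
    using atlas k unfolding smooth_atlas_def by blast+
  show "transpose (g \<kappa> p) = g \<kappa> p" if "p \<in> chart_dom \<kappa>" for p
    using metric k that unfolding riemannian_metric_def by blast
  show "v \<bullet> (g \<kappa> p *v v) > 0" if "p \<in> chart_dom \<kappa>" "v \<noteq> 0" for p v
    using metric k that unfolding riemannian_metric_def by blast
  show "csmooth \<kappa> (chart_dom \<kappa>) (\<lambda>q. g \<kappa> q $ i $ j)" for i j
    using metric k unfolding riemannian_metric_def csmooth_def by blast
qed

lemma chart_pairI:
  assumes k: "\<kappa> \<in> A" "\<kappa>' \<in> A" shows "chart_pair \<kappa> \<kappa>' g"
proof -
  interpret c: metric_chart \<kappa> g by (rule metric_chartI[OF k(1)])
  interpret c': metric_chart \<kappa>' g by (rule metric_chartI[OF k(2)])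
  show ?thesis
  proof
    show "smooth_on (chart_map \<kappa> ` (chart_dom \<kappa> \<inter> chart_dom \<kappa>')) (\<lambda>x. chart_map \<kappa>' (chart_inv \<kappa> x))"
      using atlas k unfolding smooth_atlas_def by blast
    show "g \<kappa> p $ i $ j = (\<Sum>k l. g \<kappa>' p $ k $ l *
        pd \<kappa> i (\<lambda>q. chart_map \<kappa>' q $ k) p * pd \<kappa> j (\<lambda>q. chart_map \<kappa>' q $ l) p)"
      if "p \<in> chart_dom \<kappa> \<inter> chart_dom \<kappa>'" for p i j
      using metric k that unfolding riemannian_metric_def by blast
  qed
qed

lemma chartI: "\<kappa> \<in> A \<Longrightarrow> chart \<kappa>"
  using metric_chartI[of \<kappa>] unfolding metric_chart_def by blast

lemma chart_at: "chart_at A p \<in> A" "p \<in> chart_dom (chart_at A p)"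
proof -
  have "\<exists>\<kappa>. \<kappa> \<in> A \<and> p \<in> chart_dom \<kappa>" using atlas unfolding smooth_atlas_def by blast
  then show "chart_at A p \<in> A" "p \<in> chart_dom (chart_at A p)"
    unfolding chart_at_def by (metis (mono_tags, lifting) someI_ex)+
qed

definition smoothM :: "('m \<Rightarrow> real) \<Rightarrow> bool" where
  "smoothM f \<longleftrightarrow> (\<forall>\<kappa>\<in>A. csmooth \<kappa> (chart_dom \<kappa>) f)"

definition cdiffM :: "('m \<Rightarrow> real) \<Rightarrow> bool" where
  "cdiffM f \<longleftrightarrow> (\<forall>\<kappa>\<in>A. \<forall>p\<in>chart_dom \<kappa>. cdiff \<kappa> f p)"

definition gamma :: "('m \<Rightarrow> real) \<Rightarrow> ('m \<Rightarrow> real) \<Rightarrow> 'm \<Rightarrow> real" where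
  "gamma a b p = chart_gamma g (chart_at A p) a b p"

definition lap :: "('m \<Rightarrow> real) \<Rightarrow> 'm \<Rightarrow> real" where
  "lap f p = chart_lap g (chart_at A p) f p"

definition hess_sq :: "('m, 'n) chart \<Rightarrow> ('m \<Rightarrow> real) \<Rightarrow> 'm \<Rightarrow> real" where
  "hess_sq \<kappa> f p = trace (matrix_inv (g \<kappa> p) ** hess g f \<kappa> p ** (matrix_inv (g \<kappa> p) ** hess g f \<kappa> p))"

definition hess_norm :: "('m \<Rightarrow> real) \<Rightarrow> 'm \<Rightarrow> real" where
  "hess_norm f p = hess_sq (chart_at A p) f p"

lemma smoothM_csmooth: "smoothM f \<Longrightarrow> \<kappa> \<in> A \<Longrightarrow> V \<subseteq> chart_dom \<kappa> \<Longrightarrow> csmooth \<kappa> V f"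
  unfolding smoothM_def using chart.csmooth_subset[OF chartI] by blast

lemma smoothM_cdiffM: "smoothM f \<Longrightarrow> cdiffM f"
  unfolding smoothM_def cdiffM_def using chart.csmooth_imp_cdiff[OF chartI] by blast

lemma smoothM_cdiff: "smoothM f \<Longrightarrow> \<kappa> \<in> A \<Longrightarrow> p \<in> chart_dom \<kappa> \<Longrightarrow> cdiff \<kappa> f p"
  using smoothM_cdiffM unfolding cdiffM_def by blast

lemma gamma_eq:
  assumes "\<kappa> \<in> A" "p \<in> chart_dom \<kappa>" "cdiff \<kappa> a p" "cdiff \<kappa> b p"
  shows "gamma a b p = chart_gamma g \<kappa> a b p"
  unfolding gamma_def
  by (rule chart_pair.gamma_invariant[OF chart_pairI]) (use assms chart_at in auto)

lemma gamma_eq_smooth: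
  assumes "smoothM a" "smoothM b" "\<kappa> \<in> A" "p \<in> chart_dom \<kappa>"
  shows "gamma a b p = chart_gamma g \<kappa> a b p"
  by (intro gamma_eq smoothM_cdiff assms)

lemma ovsmooth: "smoothM f \<Longrightarrow> \<kappa> \<in> A \<Longrightarrow> \<kappa>' \<in> A \<Longrightarrow> chart_pair.ovsmooth \<kappa> \<kappa>' f"
  unfolding chart_pair.ovsmooth_def[OF chart_pairI] by (auto intro: smoothM_csmooth)

lemma lap_eq:
  assumes "smoothM f" "\<kappa> \<in> A" "p \<in> chart_dom \<kappa>"
  shows "lap f p = chart_lap g \<kappa> f p"
proof -
  have "chart_lap g \<kappa> f p = trace (matrix_inv (g \<kappa> p) ** hess g f \<kappa> p)" if "\<kappa> \<in> A" "p \<in> chart_dom \<kappa>" for \<kappa>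
    using metric_chart.chart_lap_trace[OF metric_chartI[OF that(1)] chart.open_dom[OF chartI[OF that(1)]] subset_refl]
      smoothM_csmooth[OF assms(1) that(1)] that by blast
  then show ?thesis unfolding lap_def
    using chart_at[of p] assms chart_pair.trace_hess_invariant(1)[OF chart_pairI ovsmooth, of "chart_at A p" \<kappa> f p] by auto
qed

lemma hess_norm_eq:
  assumes "smoothM f" "\<kappa> \<in> A" "p \<in> chart_dom \<kappa>"
  shows "hess_norm f p = hess_sq \<kappa> f p"
  unfolding hess_norm_def hess_sq_def
  using chart_at[of p] assms chart_pair.trace_hess_invariant(2)[OF chart_pairI ovsmooth, of "chart_at A p" \<kappa> f p] by auto

text \<open>The chart picked by \<open>chart_at\<close> may jump from point to point, so the
  definitions alone give no smoothness. By invariance a fixed chart computes the same function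
  throughout its domain, and smoothness is read off there.\<close>

lemma smoothM_cong_chart:
  assumes "\<And>\<kappa>. \<kappa> \<in> A \<Longrightarrow> csmooth \<kappa> (chart_dom \<kappa>) (F \<kappa>)"
    "\<And>\<kappa> p. \<kappa> \<in> A \<Longrightarrow> p \<in> chart_dom \<kappa> \<Longrightarrow> f p = F \<kappa> p"
  shows "smoothM f"
  unfolding smoothM_def
  using assms chart.csmooth_cong[OF chartI chart.open_dom[OF chartI] subset_refl] by blast

lemma smoothM_const: "smoothM (\<lambda>p. a)"
  and smoothM_add: "smoothM e \<Longrightarrow> smoothM f \<Longrightarrow> smoothM (\<lambda>p. e p + f p)"
  and smoothM_mult: "smoothM e \<Longrightarrow> smoothM f \<Longrightarrow> smoothM (\<lambda>p. e p * f p)"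
  and smoothM_ln: "(\<And>p. f p > 0) \<Longrightarrow> smoothM f \<Longrightarrow> smoothM (\<lambda>p. ln (f p))"
  unfolding smoothM_def
  by (auto intro!: chart.csmooth_const chart.csmooth_add chart.csmooth_mult chart.csmooth_ln chartI
      chart.open_dom[OF chartI])

lemma smoothM_gamma:
  assumes "smoothM a" "smoothM b" shows "smoothM (gamma a b)"
proof (rule smoothM_cong_chart[where F = "\<lambda>\<kappa>. chart_gamma g \<kappa> a b"])
  show "csmooth \<kappa> (chart_dom \<kappa>) (chart_gamma g \<kappa> a b)" if k: "\<kappa> \<in> A" for \<kappa>
    by (rule metric_chart.csmooth_gamma[OF metric_chartI[OF k] chart.open_dom[OF chartI[OF k]] subset_refl])
      (rule smoothM_csmooth[OF _ k subset_refl], rule assms)+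
qed (rule gamma_eq_smooth[OF assms])

lemma smoothM_lap:
  assumes "smoothM f" shows "smoothM (lap f)"
proof (rule smoothM_cong_chart[where F = "\<lambda>\<kappa>. chart_lap g \<kappa> f"])
  show "csmooth \<kappa> (chart_dom \<kappa>) (chart_lap g \<kappa> f)" if k: "\<kappa> \<in> A" for \<kappa>
    by (rule metric_chart.csmooth_lap[OF metric_chartI[OF k] chart.open_dom[OF chartI[OF k]] subset_refl])
      (rule smoothM_csmooth[OF assms k subset_refl])
qed (rule lap_eq[OF assms])

lemma smoothM_hess_norm:
  assumes f: "smoothM f" shows "smoothM (hess_norm f)"
proof (rule smoothM_cong_chart[where F = "\<lambda>\<kappa>. hess_sq \<kappa> f"])
  show "hess_norm f p = hess_sq \<kappa> f p" if "\<kappa> \<in> A" "p \<in> chart_dom \<kappa>" for \<kappa> p by (rule hess_norm_eq[OF f that])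
  show "csmooth \<kappa> (chart_dom \<kappa>) (hess_sq \<kappa> f)" if k: "\<kappa> \<in> A" for \<kappa>
  proof -
    interpret metric_chart \<kappa> g by (rule metric_chartI[OF k])
    note s = smoothM_csmooth[OF f k subset_refl]
    show ?thesis unfolding hess_sq_def[abs_def] trace_mul_sum unfolding matrix_matrix_mult_def vec_lambda_beta
      by (intro csmooth_intros csmooth_h csmooth_hess open_dom subset_refl s)
  qed
qed

lemma continuous_from_charts:
  assumes "\<And>\<kappa>. \<kappa> \<in> A \<Longrightarrow> continuous_on (chart_codom \<kappa>) (\<lambda>x. f (chart_inv \<kappa> x))"
  shows "continuous_on UNIV f"
proof -
  have "continuous_on (\<Union>\<kappa>\<in>A. chart_dom \<kappa>) f"
  proof (rule continuous_on_open_UN)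
    show "open (chart_dom \<kappa>)" if "\<kappa> \<in> A" for \<kappa> by (rule chart.open_dom[OF chartI[OF that]])
    show "continuous_on (chart_dom \<kappa>) f" if k: "\<kappa> \<in> A" for \<kappa>
    proof -
      interpret chart \<kappa> by (rule chartI[OF k])
      have "continuous_on (chart_dom \<kappa>) (chart_map \<kappa>)" using homeo by (simp add: homeomorphism_def)
      with assms[OF k] have "continuous_on (chart_dom \<kappa>) (\<lambda>p. f (chart_inv \<kappa> (chart_map \<kappa> p)))"
        by (rule continuous_on_compose2) auto
      then show ?thesis by (simp cong: continuous_on_cong)
    qed
  qed
  moreover have "(\<Union>\<kappa>\<in>A. chart_dom \<kappa>) = UNIV" using atlas by (simp add: smooth_atlas_def)
  ultimately show ?thesis by simp
qed

lemma smoothM_continuous: "smoothM f \<Longrightarrow> continuous_on UNIV f"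
  using continuous_from_charts smooth_on_imp_continuous_on unfolding smoothM_def csmooth_def by blast

lemma gamma_sym: "gamma a b p = gamma b a p"
  unfolding gamma_def by (rule metric_chart.chart_gamma_sym[OF metric_chartI]) (rule chart_at)+

lemma gamma_mult:
  assumes "cdiffM a" "cdiffM b"
  shows "gamma (\<lambda>q. a q * b q) f p = a p * gamma b f p + b p * gamma a f p"
proof -
  interpret chart "chart_at A p" by (rule chartI[OF chart_at(1)])
  have "cdiff (chart_at A p) a p" "cdiff (chart_at A p) b p" using assms chart_at unfolding cdiffM_def by blast+
  then show ?thesis unfolding gamma_def chart_gamma_def
    by (simp add: pd_mult chart_at sum.distrib sum_distrib_left distrib_right) (simp add: mult_ac)
qed

lemma gamma_add:
  assumes "cdiffM a" "cdiffM b"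
  shows "gamma (\<lambda>q. a q + b q) f p = gamma a f p + gamma b f p"
proof -
  interpret chart "chart_at A p" by (rule chartI[OF chart_at(1)])
  have "cdiff (chart_at A p) a p" "cdiff (chart_at A p) b p" using assms chart_at unfolding cdiffM_def by blast+
  then show ?thesis unfolding gamma_def chart_gamma_def
    by (simp add: pd_add sum.distrib distrib_right)
qed

lemma gamma_const: "gamma (\<lambda>q. a) f p = 0"
  using chart.pd_const[OF chartI[OF chart_at(1)]] by (simp add: gamma_def chart_gamma_def)

lemma gamma_cmult: "cdiffM b \<Longrightarrow> gamma (\<lambda>q. a * b q) f p = a * gamma b f p"
  using gamma_mult[of "\<lambda>q. a" b f p] smoothM_cdiffM[OF smoothM_const] by (simp add: gamma_const)

lemma gamma_ln:
  assumes "cdiffM a" "a p > 0"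
  shows "gamma (\<lambda>q. ln (a q)) f p = gamma a f p / a p"
proof -
  interpret chart "chart_at A p" by (rule chartI[OF chart_at(1)])
  have "cdiff (chart_at A p) a p" using assms chart_at unfolding cdiffM_def by blast
  from pd_compose_real(1)[OF this chart_at(2) DERIV_ln[OF assms(2)]]
  have "pd (chart_at A p) i (\<lambda>q. ln (a q)) p = pd (chart_at A p) i a p / a p" for i
    by (simp add: divide_inverse mult.commute)
  then show ?thesis unfolding gamma_def chart_gamma_def by (simp add: sum_divide_distrib)
qed

lemma grad_sq_eq: "grad_sq A g f p = gamma f f p"
  unfolding grad_sq_def vinner_def Let_def gamma_def chart_gamma_def
    metric_chart.grad_lower[OF metric_chartI[OF chart_at(1)] chart_at(2), symmetric]
  by (simp add: sum_distrib_right sum_distrib_left) (simp add: mult_ac)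

lemma divergence_eq:
  assumes "smoothM a" "smoothM f"
  shows "divergence A g (\<lambda>\<kappa> q. a q *\<^sub>R grad g f \<kappa> q) p = gamma a f p + a p * lap f p"
proof -
  let ?k = "chart_at A p"
  interpret metric_chart ?k g by (rule metric_chartI[OF chart_at(1)])
  note a = smoothM_csmooth[OF assms(1) chart_at(1) subset_refl] and f = smoothM_csmooth[OF assms(2) chart_at(1) subset_refl]
  note cd = csmooth_imp_cdiff[OF a chart_at(2)] csmooth_imp_cdiff[OF csmooth_grad[OF open_dom subset_refl f] chart_at(2)]
  have "cdiff ?k (\<lambda>q. (a q *\<^sub>R grad g f ?k q) $ i) p" for i
    using cdiff_mult[OF cd, of i] by simp
  from pd_density_eq_chart_div[of p "\<lambda>q. a q *\<^sub>R grad g f ?k q", OF chart_at(2) this]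
  have "divergence A g (\<lambda>\<kappa> q. a q *\<^sub>R grad g f \<kappa> q) p = chart_div g ?k (\<lambda>q. a q *\<^sub>R grad g f ?k q) p"
    using det_pos[OF chart_at(2)] by (simp add: divergence_def Let_def)
  also have "\<dots> = gamma a f p + a p * lap f p"
    using chart_div_scale_grad[OF open_dom subset_refl cd(1) f chart_at(2)] by (simp add: gamma_def lap_def)
  finally show ?thesis .
qed

text \<open>The outer operators use the chart chosen at \<open>p\<close>, but the inner functions at
  \<open>q\<close> use the chart chosen at \<open>q\<close>. Before differentiating, the inner ones
  are rewritten on the whole domain of the chart at \<open>p\<close>, where the local formula
  holds.\<close>

lemma bochnerM:
  assumes f: "smoothM f"
  shows "lap (\<lambda>q. 1 / 2 * gamma f f q) p = hess_norm f p + gamma (lap f) f p + vinner A (ricci g) (grad g f) (grad g f) p"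
proof -
  let ?k = "chart_at A p"
  interpret metric_chart ?k g by (rule metric_chartI[OF chart_at(1)])
  note fs = smoothM_csmooth[OF f chart_at(1) subset_refl]
  note V = open_dom subset_refl
  have h: "csmooth ?k cdom (\<lambda>q. 1 / 2 * chart_gamma g ?k f f q)"
    by (intro csmooth_cmult csmooth_gamma V fs)
  have h': "csmooth ?k cdom (\<lambda>q. 1 / 2 * gamma f f q)"
    by (intro smoothM_csmooth smoothM_mult smoothM_const smoothM_gamma f chart_at(1) subset_refl)
  have eq: "1 / 2 * gamma f f q = 1 / 2 * chart_gamma g ?k f f q" if "q \<in> cdom" for q
    using gamma_eq_smooth[OF f f chart_at(1) that] by simp
  have pd: "pd ?k i (\<lambda>q. 1 / 2 * gamma f f q) q = pd ?k i (\<lambda>q. 1 / 2 * chart_gamma g ?k f f q) q" if "q \<in> cdom" for q i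
    by (rule pd_cong[OF V that eq])
  have gr: "grad g (\<lambda>q. 1 / 2 * gamma f f q) ?k q = grad g (\<lambda>q. 1 / 2 * chart_gamma g ?k f f q) ?k q" if "q \<in> cdom" for q
    unfolding grad_def by (simp only: pd[OF that])
  have pg: "pd ?k i (\<lambda>q. grad g (\<lambda>q. 1 / 2 * gamma f f q) ?k q $ j) p = pd ?k i (\<lambda>q. grad g (\<lambda>q. 1 / 2 * chart_gamma g ?k f f q) ?k q $ j) p" for i j
    by (rule pd_cong[OF V chart_at(2)]) (simp only: gr)
  have "lap (\<lambda>q. 1 / 2 * gamma f f q) p = chart_lap g ?k (\<lambda>q. 1 / 2 * chart_gamma g ?k f f q) p"
    unfolding lap_def chart_lap_def chart_div_def by (simp only: pg gr[OF chart_at(2)])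
  moreover have "gamma (lap f) f p = chart_gamma g ?k (chart_lap g ?k f) f p"
    unfolding gamma_def chart_gamma_def
    by (intro sum.cong refl arg_cong2[where f = "(*)"] pd_cong[OF V chart_at(2)] lap_eq[OF f chart_at(1)])
  moreover have "bform (ricci g ?k p) (grad g f ?k p) (grad g f ?k p) = vinner A (ricci g) (grad g f) (grad g f) p"
    by (simp add: bform_def vinner_def Let_def)
  ultimately show ?thesis
    using bochner[OF V fs chart_at(2)] nabla_grad_trace[OF V fs chart_at(2)] by (simp add: hess_norm_def hess_sq_def)
qed

lemma tensor_norm_sq_eq:
  assumes f: "smoothM f"
  shows "tensor_norm_sq A g (\<lambda>\<kappa> q. hess g f \<kappa> q - a *\<^sub>R g \<kappa> q) p = hess_norm f p - 2 * a * lap f p + a\<^sup>2 * real CARD('n)"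
proof -
  let ?k = "chart_at A p"
  interpret metric_chart ?k g by (rule metric_chartI[OF chart_at(1)])
  note fs = smoothM_csmooth[OF f chart_at(1) subset_refl]
  note V = open_dom subset_refl
  have S: "(hess g f ?k p - a *\<^sub>R g ?k p) $ i $ j = (hess g f ?k p - a *\<^sub>R g ?k p) $ j $ i" for i j
    using hess_sym[OF V fs chart_at(2), of i j] g_sym[OF chart_at(2), of i j] by simp
  show ?thesis
    unfolding tensor_norm_sq_def Let_def tensor_norm_trace[OF chart_at(2) S] trace_hess_shift[OF chart_at(2)]
    by (simp add: hess_norm_def hess_sq_def lap_def chart_lap_trace[OF V fs chart_at(2)])
qed

end

section \<open>Bump functions\<close>

text \<open>Each difference quotient of \<open>F\<close> in direction \<open>v\<close> has integral
  zero. By the mean value theorem all quotients share the bound of the derivative, and they live on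
  one ball, so dominated convergence passes to the limit.\<close>

lemma integral_directional_derivative_zero:
  fixes F :: "'a::euclidean_space \<Rightarrow> real"
  assumes C: "Ck_on 1 UNIV F" and K: "compact K" and supp: "\<And>x. x \<notin> K \<Longrightarrow> F x = 0"
  shows "integrable lborel (\<lambda>x. frechet_derivative F (at x) v)"
    and "(\<integral>x. frechet_derivative F (at x) v \<partial>lborel) = 0"
proof -
  define G where "G x = frechet_derivative F (at x) v" for x
  have d: "F differentiable at x" for x using C by simp
  have cG: "continuous_on UNIV G" using C by (simp add: G_def[abs_def])
  have cF: "continuous_on UNIV F" using Ck_on_imp_continuous_on[OF C] .
  have G0: "G x = 0" if "x \<notin> K" for x
  proof -
    have "frechet_derivative F (at x) = frechet_derivative (\<lambda>x. 0) (at x)"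
      by (rule frechet_derivative_cong_on[of "- K"]) (use that supp K in \<open>auto intro: compact_imp_closed\<close>)
    then show ?thesis by (simp add: G_def)
  qed
  have int: "integrable lborel f" if "continuous_on UNIV f" "\<And>x. x \<notin> K \<Longrightarrow> f x = 0" for f :: "'a \<Rightarrow> real"
  proof -
    have "(\<lambda>x. indicator K x *\<^sub>R f x) = f" by (rule ext) (metis that(2) indicator_simps scaleR_one scaleR_zero_left)
    then show ?thesis
      using borel_integrable_compact[OF K continuous_on_subset[OF that(1)]] by simp
  qed
  show "integrable lborel (\<lambda>x. frechet_derivative F (at x) v)" using int[OF cG G0] by (simp add: G_def[abs_def])
  have intF: "integrable lborel F" by (rule int[OF cF supp])
  obtain M where M: "\<And>x. \<bar>G x\<bar> \<le> M"
  proof -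
    have "bounded (G ` K)"
      by (intro compact_imp_bounded compact_continuous_image continuous_on_subset[OF cG] K) simp
    then obtain M where "\<forall>y\<in>G ` K. norm y \<le> M" unfolding bounded_iff by blast
    then have "\<bar>G x\<bar> \<le> max 0 M" for x using G0[of x] by (cases "x \<in> K") (auto simp: max.coboundedI2)
    then show ?thesis using that by blast
  qed
  obtain R where R: "\<And>x. x \<in> K \<Longrightarrow> norm x \<le> R"
    using compact_imp_bounded[OF K] unfolding bounded_iff by blast
  \<comment> \<open>\<open>K\<close> has radius at most \<open>R\<close> and no translation is
    longer than \<open>v\<close>, so all difference quotients vanish outside this ball.\<close>
  let ?K = "cball 0 (R + norm v) :: 'a set"
  define c :: "nat \<Rightarrow> real" where "c n = inverse (real (Suc n))" for n
  have c: "0 < c n" "c n \<le> 1" for n by (simp_all add: c_def divide_simps)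
  define s where "s n x = (F (x + c n *\<^sub>R v) - F x) / c n" for n x
  have s0: "s n x = 0" if "x \<notin> ?K" for n x
  proof -
    have "norm (c n *\<^sub>R v) \<le> norm v" using c[of n] by (simp add: mult_left_le_one_le)
    moreover have "norm x \<le> norm (x + c n *\<^sub>R v) + norm (c n *\<^sub>R v)"
      using norm_triangle_ineq4[of "x + c n *\<^sub>R v" "c n *\<^sub>R v"] by simp
    moreover have "norm x > R + norm v" using that by simp
    ultimately have "norm (x + c n *\<^sub>R v) > R" "norm x > R" using norm_ge_zero[of v] by linarith+
    then have "x \<notin> K" "x + c n *\<^sub>R v \<notin> K" using R[of x] R[of "x + c n *\<^sub>R v"] by (meson not_le)+
    then show ?thesis by (simp add: s_def supp)
  qed
  have sM: "\<bar>s n x\<bar> \<le> M" for n x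
  proof -
    have "\<exists>z>0. z < c n \<and> F (x + c n *\<^sub>R v) - F (x + 0 *\<^sub>R v) = (c n - 0) * G (x + z *\<^sub>R v)"
      unfolding G_def by (rule MVT2[OF c(1)]) (rule frechet_derivative_line[OF d])
    then obtain z where "F (x + c n *\<^sub>R v) - F x = c n * G (x + z *\<^sub>R v)" by auto
    then have "s n x = G (x + z *\<^sub>R v)" using c(1)[of n] by (simp add: s_def)
    then show ?thesis using M by simp
  qed
  have int_s: "integral\<^sup>L lborel (s n) = 0" for n
  proof -
    let ?a = "c n *\<^sub>R v"
    have meas: "(+) ?a \<in> measurable lborel borel" by simp
    have i1: "integrable lborel (\<lambda>x. F (?a + x))"
      using integrable_distr[OF meas, of F] intF by (simp add: lborel_distr_plus)
    have "(\<integral>x. F (?a + x) \<partial>lborel) = integral\<^sup>L (distr lborel borel ((+) ?a)) F"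
      by (rule integral_distr[symmetric, OF meas]) (use borel_measurable_integrable[OF intF] in simp)
    also have "\<dots> = integral\<^sup>L lborel F" by (simp add: lborel_distr_plus)
    finally show ?thesis using i1 intF by (simp add: s_def[abs_def] add.commute)
  qed
  have "(\<lambda>n. integral\<^sup>L lborel (s n)) \<longlonglongrightarrow> integral\<^sup>L lborel G"
  proof (rule integral_dominated_convergence[where w = "\<lambda>x. indicator ?K x *\<^sub>R M"])
    show "G \<in> borel_measurable lborel" using borel_measurable_continuous_onI[OF cG] by simp
    show "s n \<in> borel_measurable lborel" for n
    proof -
      have "continuous_on UNIV (s n)" unfolding s_def[abs_def]
        by (intro continuous_intros continuous_on_compose2[OF cF] cF) (use c(1)[of n] in auto)
      then show ?thesis using borel_measurable_continuous_onI by simp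
    qed
    show "integrable lborel (\<lambda>x. indicator ?K x *\<^sub>R M)" by (rule borel_integrable_compact) auto
    show "AE x in lborel. norm (s n x) \<le> indicator ?K x *\<^sub>R M" for n
      using s0[of _ n] sM[of n] by (intro always_eventually allI) (auto simp: indicator_def)
    show "AE x in lborel. (\<lambda>n. s n x) \<longlonglongrightarrow> G x"
    proof (intro always_eventually allI)
      fix x
      have "((\<lambda>t. F (x + t *\<^sub>R v)) has_real_derivative G x) (at 0)"
        using frechet_derivative_line[of F x 0 v] d by (simp add: G_def)
      then have "((\<lambda>h. (F (x + h *\<^sub>R v) - F x) / h) \<longlongrightarrow> G x) (at 0)"
        by (simp add: DERIV_def)
      moreover have "filterlim c (at 0) sequentially"
        unfolding filterlim_at c_def using LIMSEQ_inverse_real_of_nat by auto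
      ultimately show "(\<lambda>n. s n x) \<longlonglongrightarrow> G x" unfolding s_def by (rule filterlim_compose)
    qed
  qed
  then have "(\<lambda>n. 0 :: real) \<longlonglongrightarrow> integral\<^sup>L lborel G" unfolding int_s .
  then have "integral\<^sup>L lborel G = 0" using LIMSEQ_unique tendsto_const by blast
  then show "(\<integral>x. frechet_derivative F (at x) v \<partial>lborel) = 0" by (simp add: G_def[abs_def])
qed

section \<open>Cut-off functions of class C^1\<close>

lemma Ck_on_Un:
  assumes "open S" "open T"
  shows "Ck_on k S f \<Longrightarrow> Ck_on k T f \<Longrightarrow> Ck_on k (S \<union> T) f"
  by (induction k arbitrary: f) (auto intro: continuous_on_open_Un[OF assms])

lemma Ck_on_sum:
  "open S \<Longrightarrow> (\<And>i. i \<in> I \<Longrightarrow> Ck_on k S (f i)) \<Longrightarrow> Ck_on k S (\<lambda>x. \<Sum>i\<in>I. f i x)"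
  by (induction I rule: infinite_finite_induct) (auto intro: Ck_on_add Ck_on_const)

lemma Ck_on_sqrt:
  fixes f :: "'a::real_normed_vector \<Rightarrow> real"
  assumes "open S" "\<And>x. x \<in> S \<Longrightarrow> f x > 0" "Ck_on k S f"
  shows "Ck_on k S (\<lambda>x. sqrt (f x))"
  using assms(3)
proof (induction k)
  case 0
  then show ?case by (auto intro: continuous_intros)
next
  case (Suc k)
  have "Ck_on k S (\<lambda>x. sqrt (f x))" by (rule Suc.IH[OF Ck_on_SucD[OF Suc.prems]])
  then have 1: "Ck_on k S (\<lambda>x. inverse (sqrt (f x)) * (1 / 2))"
    using assms(2) by (intro Ck_on_mult Ck_on_inverse Ck_on_const assms(1)) force+
  show ?case
    by (rule Ck_on_compose_real[where h' = "\<lambda>y. inverse (sqrt y) * (1 / 2)", OF assms(1) _ Suc.prems 1])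
      (use assms(2) DERIV_real_sqrt in auto)
qed

text \<open>Squaring removes the kink at 0: there the difference quotient is at most
  \<open>\<bar>h\<bar>\<close>. The derivative is continuous, which is all the regularity asked of
  the bumps.\<close>

lemma pos_part_square_derivative:
  "((\<lambda>u::real. (max 0 u)\<^sup>2) has_real_derivative 2 * max 0 u) (at u)"
proof -
  consider "u > 0" | "u < 0" | "u = 0" by linarith
  then show ?thesis
  proof cases
    case 1
    have "((\<lambda>u::real. u\<^sup>2) has_real_derivative 2 * u) (at u)" by (auto intro!: derivative_eq_intros)
    then have "((\<lambda>u::real. (max 0 u)\<^sup>2) has_real_derivative 2 * u) (at u)"
      by (rule has_field_derivative_transform_within_open[of _ _ _ "{0<..}"]) (use 1 in auto)
    then show ?thesis using 1 by simp
  next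
    case 2
    have "((\<lambda>u::real. 0) has_real_derivative 0) (at u)" by simp
    then have "((\<lambda>u::real. (max 0 u)\<^sup>2) has_real_derivative 0) (at u)"
      by (rule has_field_derivative_transform_within_open[of _ _ _ "{..<0}"]) (use 2 in auto)
    then show ?thesis using 2 by simp
  next
    case 3
    have "((\<lambda>h::real. ((max 0 h)\<^sup>2) / h) \<longlongrightarrow> 0) (at 0)"
    proof (rule Lim_null_comparison)
      show "\<forall>\<^sub>F h in at 0. norm ((max 0 h)\<^sup>2 / h) \<le> \<bar>h\<bar>"
        by (intro always_eventually allI) (auto simp: max_def power2_eq_square)
      show "((\<lambda>h::real. \<bar>h\<bar>) \<longlongrightarrow> 0) (at 0)" using tendsto_rabs_zero[OF tendsto_ident_at] by simp
    qed
    then show ?thesis using 3 by (simp add: DERIV_def)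
  qed
qed

lemma Ck_on_pos_part_square:
  fixes f :: "'a::real_normed_vector \<Rightarrow> real"
  assumes "open S" "Ck_on 1 S f"
  shows "Ck_on 1 S (\<lambda>x. (max 0 (f x))\<^sup>2)"
proof -
  have "continuous_on S f" using Ck_on_imp_continuous_on[OF assms(2)] .
  then have "Ck_on 0 S (\<lambda>x. 2 * max 0 (f x))" by (auto intro!: continuous_intros)
  then show ?thesis
    using Ck_on_compose_real[where h = "\<lambda>u. (max 0 u)\<^sup>2" and h' = "\<lambda>u. 2 * max 0 u" and f = f and k = 0,
        OF assms(1) pos_part_square_derivative] assms(2) by simp
qed

context riem
begin

definition C1M :: "('m \<Rightarrow> real) \<Rightarrow> bool" where
  "C1M h \<longleftrightarrow> (\<forall>\<kappa>\<in>A. Ck_on 1 (chart_codom \<kappa>) (\<lambda>x. h (chart_inv \<kappa> x)))"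

lemma smoothM_C1M: "smoothM f \<Longrightarrow> C1M f"
  unfolding smoothM_def C1M_def csmooth_def smooth_on_def by blast

lemma C1M_cdiff: "C1M f \<Longrightarrow> \<kappa> \<in> A \<Longrightarrow> p \<in> chart_dom \<kappa> \<Longrightarrow> cdiff \<kappa> f p"
  unfolding C1M_def cdiff_def by auto

lemma C1M_cdiffM: "C1M f \<Longrightarrow> cdiffM f"
  using C1M_cdiff unfolding cdiffM_def by blast

lemma C1M_mult: "C1M e \<Longrightarrow> C1M f \<Longrightarrow> C1M (\<lambda>p. e p * f p)"
  unfolding C1M_def by (intro ballI Ck_on_mult chart.open_codom[OF chartI]) blast+

lemma C1M_sum: "(\<And>i. i \<in> I \<Longrightarrow> C1M (f i)) \<Longrightarrow> C1M (\<lambda>p. \<Sum>i\<in>I. f i p)"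
  unfolding C1M_def by (intro ballI Ck_on_sum chart.open_codom[OF chartI]) blast+

lemma C1M_inverse: "(\<And>p. f p \<noteq> 0) \<Longrightarrow> C1M f \<Longrightarrow> C1M (\<lambda>p. inverse (f p))"
  unfolding C1M_def by (intro ballI Ck_on_inverse chart.open_codom[OF chartI]) blast+

lemma C1M_continuous: "C1M f \<Longrightarrow> continuous_on UNIV f"
  unfolding C1M_def using continuous_from_charts Ck_on_imp_continuous_on by blast

lemma gamma_C1_continuous:
  assumes h: "C1M h" and f: "smoothM f"
  shows "continuous_on UNIV (gamma h f)"
proof (rule continuous_from_charts)
  fix \<kappa> assume k: "\<kappa> \<in> A"
  interpret metric_chart \<kappa> g by (rule metric_chartI[OF k])
  have "continuous_on (chart_codom \<kappa>) (\<lambda>x. frechet_derivative (\<lambda>x. h (chart_inv \<kappa> x)) (at x) (axis i 1))" for i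
    using h k by (simp add: C1M_def)
  moreover have "continuous_on (chart_codom \<kappa>) (\<lambda>x. grad g f \<kappa> (chart_inv \<kappa> x) $ i)" for i
    using smooth_on_imp_continuous_on[OF csmooth_grad[OF open_dom subset_refl smoothM_csmooth[OF f k subset_refl], unfolded csmooth_def]] .
  ultimately have "continuous_on (chart_codom \<kappa>)
      (\<lambda>x. \<Sum>i. frechet_derivative (\<lambda>x. h (chart_inv \<kappa> x)) (at x) (axis i 1) * grad g f \<kappa> (chart_inv \<kappa> x) $ i)"
    by (intro continuous_on_sum continuous_on_mult)
  moreover have "gamma h f (chart_inv \<kappa> x) = (\<Sum>i. frechet_derivative (\<lambda>x. h (chart_inv \<kappa> x)) (at x) (axis i 1) * grad g f \<kappa> (chart_inv \<kappa> x) $ i)"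
    if x: "x \<in> chart_codom \<kappa>" for x
  proof -
    obtain p where p: "p \<in> chart_dom \<kappa>" "x = chart_map \<kappa> p" using x by blast
    show ?thesis using gamma_eq[OF k p(1) C1M_cdiff[OF h k p(1)] smoothM_cdiff[OF f k p(1)]] p
      by (simp add: chart_gamma_def pd_def)
  qed
  ultimately show "continuous_on (chart_codom \<kappa>) (\<lambda>x. gamma h f (chart_inv \<kappa> x))"
    by (simp cong: continuous_on_cong)
qed

text \<open>The squared coordinate distance is spelled out as a sum of products so that, seen from
  any other chart, it is visibly smooth by the closure rules.\<close>

definition bump :: "('m, 'n) chart \<Rightarrow> 'm \<Rightarrow> real \<Rightarrow> 'm \<Rightarrow> real" where
  "bump \<kappa> p r q = (if q \<in> chart_dom \<kappa> then (max 0 (r\<^sup>2 -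
     (\<Sum>k. (chart_map \<kappa> q $ k - chart_map \<kappa> p $ k) * (chart_map \<kappa> q $ k - chart_map \<kappa> p $ k))))\<^sup>2 else 0)"

lemma bump_dist: "bump \<kappa> p r q = (if q \<in> chart_dom \<kappa> then (max 0 (r\<^sup>2 - (dist (chart_map \<kappa> q) (chart_map \<kappa> p))\<^sup>2))\<^sup>2 else 0)"
proof -
  have "(dist x y)\<^sup>2 = (\<Sum>k. (x $ k - y $ k) * (x $ k - y $ k))" for x y :: "real ^ 'n"
    by (simp add: dist_norm power2_norm_eq_inner inner_vec_def)
  then show ?thesis by (simp add: bump_def)
qed

lemma bump_nonneg: "bump \<kappa> p r q \<ge> 0"
  by (simp add: bump_def)

lemma bump_pos: "r > 0 \<Longrightarrow> q \<in> chart_dom \<kappa> \<Longrightarrow> chart_map \<kappa> q \<in> ball (chart_map \<kappa> p) r \<Longrightarrow> bump \<kappa> p r q > 0"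
  by (simp add: bump_dist dist_commute max_def power2_le_iff_abs_le abs_of_pos not_le[symmetric])

definition bump_supp :: "('m, 'n) chart \<Rightarrow> 'm \<Rightarrow> real \<Rightarrow> 'm set" where
  "bump_supp \<kappa> p r = chart_inv \<kappa> ` cball (chart_map \<kappa> p) r"

lemma bump_supp:
  assumes k: "\<kappa> \<in> A" and r: "r > 0" "cball (chart_map \<kappa> p) r \<subseteq> chart_codom \<kappa>"
  shows "compact (bump_supp \<kappa> p r)" "bump_supp \<kappa> p r \<subseteq> chart_dom \<kappa>"
    "q \<notin> bump_supp \<kappa> p r \<Longrightarrow> bump \<kappa> p r q = 0"
proof -
  interpret chart \<kappa> by (rule chartI[OF k])
  have "continuous_on (chart_codom \<kappa>) (chart_inv \<kappa>)" using homeo by (simp add: homeomorphism_def)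
  then show "compact (bump_supp \<kappa> p r)" unfolding bump_supp_def
    by (intro compact_continuous_image continuous_on_subset[OF _ r(2)]) auto
  show "bump_supp \<kappa> p r \<subseteq> chart_dom \<kappa>"
  proof
    fix q assume "q \<in> bump_supp \<kappa> p r"
    then obtain x where "x \<in> cball (chart_map \<kappa> p) r" "q = chart_inv \<kappa> x" unfolding bump_supp_def by blast
    then show "q \<in> chart_dom \<kappa>" using r(2) inv_into_into[of x "chart_map \<kappa>" "chart_dom \<kappa>"] by blast
  qed
  show "bump \<kappa> p r q = 0" if q: "q \<notin> bump_supp \<kappa> p r"
  proof (cases "q \<in> chart_dom \<kappa>")
    case True
    then have "chart_map \<kappa> q \<notin> cball (chart_map \<kappa> p) r"
      using q inv_map[OF True] imageI[of "chart_map \<kappa> q" _ "chart_inv \<kappa>"] unfolding bump_supp_def by fastforce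
    then have "r \<le> dist (chart_map \<kappa> q) (chart_map \<kappa> p)" by (simp add: dist_commute)
    then have "r\<^sup>2 \<le> (dist (chart_map \<kappa> q) (chart_map \<kappa> p))\<^sup>2" using r(1) by (intro power_mono) auto
    then show ?thesis by (simp add: bump_dist)
  qed (simp add: bump_def)
qed

text \<open>In another chart the bump is pulled back by the transition map on the overlap and is
  zero off its support. The support is compact, hence closed because the manifold is Hausdorff, so
  these two regions are open and C^1 regularity can be glued.\<close>

lemma C1M_bump:
  assumes k: "\<kappa> \<in> A" and r: "r > 0" "cball (chart_map \<kappa> p) r \<subseteq> chart_codom \<kappa>"
  shows "C1M (bump \<kappa> p r)"
  unfolding C1M_def
proof
  fix \<kappa>' assume k': "\<kappa>' \<in> A"
  interpret chart_pair \<kappa>' \<kappa> g by (rule chart_pairI[OF k' k])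
  let ?K = "bump_supp \<kappa> p r"
  let ?b = "\<lambda>x. bump \<kappa> p r (chart_inv \<kappa>' x)"
  let ?S = "chart_map \<kappa>' ` ov" and ?T = "chart_map \<kappa>' ` (chart_dom \<kappa>' - ?K)"
  have T: "open (chart_dom \<kappa>' - ?K)"
    using compact_imp_closed[OF bump_supp(1)[OF k r]] c.open_dom by blast
  have oS: "open ?S" and oT: "open ?T" by (intro c.open_map open_ov ov_sub T Diff_subset)+
  have un: "chart_codom \<kappa>' = ?S \<union> ?T" using bump_supp(2)[OF k r] by blast
  have "Ck_on 1 ?S (\<lambda>x. r\<^sup>2 - (\<Sum>k. (y k (chart_inv \<kappa>' x) - chart_map \<kappa> p $ k) * (y k (chart_inv \<kappa>' x) - chart_map \<kappa> p $ k)))"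
  proof -
    have "smooth_on ?S (\<lambda>x. y k (chart_inv \<kappa>' x))" for k using csmooth_y(1) by (simp add: csmooth_def)
    then have "smooth_on ?S (\<lambda>x. r\<^sup>2 - (\<Sum>k. (y k (chart_inv \<kappa>' x) - chart_map \<kappa> p $ k) * (y k (chart_inv \<kappa>' x) - chart_map \<kappa> p $ k)))"
      by (intro smooth_intros oS)
    then show ?thesis unfolding smooth_on_def by blast
  qed
  from Ck_on_pos_part_square[OF oS this]
  have "Ck_on 1 ?S ?b"
    by (rule iffD1[OF Ck_on_cong[OF oS], rotated]) (auto simp: bump_def)
  moreover have "Ck_on 1 ?T ?b"
    by (rule iffD1[OF Ck_on_cong[OF oT] Ck_on_const[of 1 _ 0]]) (auto simp: bump_supp(3)[OF k r])
  ultimately show "Ck_on 1 (chart_codom \<kappa>') ?b" unfolding un by (rule Ck_on_Un[OF oS oT])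
qed

end

section \<open>Integration by parts\<close>

locale riem_measure = riem A g for A :: "('m::t2_space, 'n::finite) chart set" and g +
  fixes \<nu> :: "'m measure"
  assumes compactM: "compact (UNIV :: 'm set)" and vol: "riemannian_volume A g \<nu>"
begin

lemma sets_nu [simp]: "sets \<nu> = sets borel"
  using vol by (simp add: riemannian_volume_def)

lemma space_nu [simp]: "space \<nu> = UNIV"
  using sets_eq_imp_space_eq[OF sets_nu] by simp

lemma measurable_nu: "measurable \<nu> borel = measurable borel borel"
  by (rule measurable_cong_sets) simp_all

lemma borel_continuous: "continuous_on UNIV f \<Longrightarrow> f \<in> borel_measurable \<nu>" for f :: "'m \<Rightarrow> real"
  unfolding measurable_nu by (rule borel_measurable_continuous_onI)

text \<open>The indicator makes this a Borel function on the whole space, so that integrals over the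
  chart become plain integrals over \<open>lborel\<close>.\<close>

definition dens :: "('m, 'n) chart \<Rightarrow> real ^ 'n \<Rightarrow> real" where
  "dens \<kappa> x = indicator (chart_codom \<kappa>) x * sqrt (det (g \<kappa> (chart_inv \<kappa> x)))"

lemma continuous_dens: "\<kappa> \<in> A \<Longrightarrow> continuous_on (chart_codom \<kappa>) (\<lambda>x. sqrt (det (g \<kappa> (chart_inv \<kappa> x))))"
proof -
  assume k: "\<kappa> \<in> A"
  interpret metric_chart \<kappa> g by (rule metric_chartI[OF k])
  have "smooth_on (chart_codom \<kappa>) (\<lambda>x. g \<kappa> (chart_inv \<kappa> x) $ i $ j)" for i j
    using g_smooth by (simp add: csmooth_def)
  then have "continuous_on (chart_codom \<kappa>) (\<lambda>x. det (g \<kappa> (chart_inv \<kappa> x)))"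
    by (intro smooth_on_imp_continuous_on smooth_on_det open_codom)
  then show ?thesis by (rule continuous_on_real_sqrt)
qed

lemma dens_nonneg: "\<kappa> \<in> A \<Longrightarrow> dens \<kappa> x \<ge> 0"
  using metric_chart.det_pos[OF metric_chartI, of \<kappa> "chart_inv \<kappa> x"] inv_into_into[of x "chart_map \<kappa>" "chart_dom \<kappa>"]
  by (auto simp: dens_def indicator_def less_imp_le)

lemma measurable_dens: "\<kappa> \<in> A \<Longrightarrow> dens \<kappa> \<in> borel_measurable borel"
  using borel_measurable_continuous_on_indicator[OF borel_open[OF chart.open_codom[OF chartI]] continuous_dens]
  by (simp add: dens_def[abs_def])

lemma emeasure_chart:
  assumes k: "\<kappa> \<in> A" and B: "B \<in> sets borel" "B \<subseteq> chart_dom \<kappa>"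
  shows "emeasure \<nu> B = (\<integral>\<^sup>+x. ennreal (dens \<kappa> x) * indicator (chart_map \<kappa> ` B) x \<partial>lborel)"
proof -
  have "emeasure \<nu> B = (\<integral>\<^sup>+x \<in> chart_map \<kappa> ` B. ennreal (sqrt (det (g \<kappa> (chart_inv \<kappa> x)))) \<partial>lborel)"
    using vol k B by (simp add: riemannian_volume_def)
  also have "\<dots> = (\<integral>\<^sup>+x. ennreal (dens \<kappa> x) * indicator (chart_map \<kappa> ` B) x \<partial>lborel)"
    by (rule nn_integral_cong) (use B in \<open>auto simp: dens_def indicator_def\<close>)
  finally show ?thesis .
qed

lemma chart_ball:
  obtains r where "r > 0" "cball (chart_map (chart_at A p) p) r \<subseteq> chart_codom (chart_at A p)"
proof -
  have "chart_map (chart_at A p) p \<in> chart_codom (chart_at A p)" by (rule imageI[OF chart_at(2)])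
  with chart.open_codom[OF chartI[OF chart_at(1)]] show ?thesis
    unfolding open_contains_cball by (meson that)
qed

definition chart_nbhd :: "('m, 'n) chart \<Rightarrow> 'm \<Rightarrow> real \<Rightarrow> 'm set" where
  "chart_nbhd \<kappa> p r = {q \<in> chart_dom \<kappa>. chart_map \<kappa> q \<in> ball (chart_map \<kappa> p) r}"

lemma open_chart_nbhd:
  assumes "\<kappa> \<in> A" shows "open (chart_nbhd \<kappa> p r)"
proof -
  interpret chart \<kappa> by (rule chartI[OF assms])
  have "continuous_on (chart_dom \<kappa>) (chart_map \<kappa>)" using homeo by (simp add: homeomorphism_def)
  from continuous_open_preimage[OF this open_dom open_ball]
  show ?thesis by (simp add: chart_nbhd_def vimage_def Collect_conj_eq)
qed

text \<open>The open coordinate balls cover, while the closed ones still lie inside their charts;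
  the bumps built on them thus have compact support within a single chart.\<close>

lemma finite_chart_cover:
  obtains P r where "finite P" "\<And>p. r p > 0"
    "\<And>p. cball (chart_map (chart_at A p) p) (r p) \<subseteq> chart_codom (chart_at A p)"
    "(\<Union>p\<in>P. chart_nbhd (chart_at A p) p (r p)) = UNIV"
proof -
  have "\<exists>r. r > 0 \<and> cball (chart_map (chart_at A p) p) r \<subseteq> chart_codom (chart_at A p)" for p
    by (rule chart_ball[of p]) blast
  then obtain r where r: "\<And>p. r p > 0" "\<And>p. cball (chart_map (chart_at A p) p) (r p) \<subseteq> chart_codom (chart_at A p)"
    by metis
  have "p \<in> chart_nbhd (chart_at A p) p (r p)" for p using r(1) chart_at(2) by (simp add: chart_nbhd_def)
  then have "UNIV \<subseteq> (\<Union>p\<in>UNIV. chart_nbhd (chart_at A p) p (r p))" by blast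
  then obtain P where P: "P \<subseteq> UNIV" "finite P" "UNIV \<subseteq> (\<Union>p\<in>P. chart_nbhd (chart_at A p) p (r p))"
    by (rule compactE_image[OF compactM open_chart_nbhd[OF chart_at(1)]])
  have "(\<Union>p\<in>P. chart_nbhd (chart_at A p) p (r p)) = UNIV" by (rule subset_antisym[OF subset_UNIV P(3)])
  from that[OF P(2) r this] show ?thesis .
qed

text \<open>The volume is prescribed only on subsets of charts. Finiteness comes from finitely many
  coordinate balls, on whose closures the continuous density is bounded.\<close>

lemma finite_nu: "emeasure \<nu> UNIV < \<infinity>"
proof -
  obtain P r where P: "finite P" "\<And>p. r p > 0"
    "\<And>p. cball (chart_map (chart_at A p) p) (r p) \<subseteq> chart_codom (chart_at A p)"
    "(\<Union>p\<in>P. chart_nbhd (chart_at A p) p (r p)) = UNIV" by (rule finite_chart_cover) blast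
  have fin: "emeasure \<nu> (chart_nbhd (chart_at A p) p (r p)) < \<infinity>" for p
  proof -
    let ?k = "chart_at A p" and ?N = "chart_nbhd (chart_at A p) p (r p)" and ?C = "cball (chart_map (chart_at A p) p) (r p)"
    have "bounded ((\<lambda>x. sqrt (det (g ?k (chart_inv ?k x)))) ` ?C)"
      by (intro compact_imp_bounded compact_continuous_image continuous_on_subset[OF continuous_dens[OF chart_at(1)] P(3)]) simp
    then obtain M where M: "\<forall>y\<in>(\<lambda>x. sqrt (det (g ?k (chart_inv ?k x)))) ` ?C. norm y \<le> M" unfolding bounded_iff by blast
    have "dens ?k x \<le> M" if "x \<in> ?C" for x using M that P(3)[of p] by (force simp: dens_def indicator_def)
    moreover have "chart_map ?k ` ?N \<subseteq> ?C" by (auto simp: chart_nbhd_def)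
    ultimately have le: "ennreal (dens ?k x) * indicator (chart_map ?k ` ?N) x \<le> ennreal M * indicator ?C x" for x
      by (auto simp: indicator_def intro!: ennreal_leI)
    have "emeasure \<nu> ?N = (\<integral>\<^sup>+x. ennreal (dens ?k x) * indicator (chart_map ?k ` ?N) x \<partial>lborel)"
    proof (rule emeasure_chart[OF chart_at(1)])
      show "?N \<in> sets borel" by (rule borel_open[OF open_chart_nbhd[OF chart_at(1)]])
    qed (simp add: chart_nbhd_def subset_eq)
    also have "\<dots> \<le> (\<integral>\<^sup>+x. ennreal M * indicator ?C x \<partial>lborel)" by (rule nn_integral_mono) (rule le)
    also have "\<dots> = ennreal M * emeasure lborel ?C" by (rule nn_integral_cmult_indicator) simp
    also have "\<dots> < \<infinity>" using emeasure_lborel_cball_finite[of "chart_map ?k p" "r p"] by (simp add: ennreal_mult_less_top)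
    finally show ?thesis .
  qed
  have "emeasure \<nu> UNIV \<le> (\<Sum>p\<in>P. emeasure \<nu> (chart_nbhd (chart_at A p) p (r p)))"
    unfolding P(4)[symmetric]
    by (rule emeasure_subadditive_finite[OF P(1)]) (auto intro!: borel_open open_chart_nbhd chart_at(1))
  also have "\<dots> < \<infinity>" using fin by (simp add: P(1))
  finally show ?thesis .
qed

lemma finite_measure_nu: "finite_measure \<nu>"
  using finite_nu by (intro finite_measureI) simp

lemma bounded_continuous: "continuous_on UNIV f \<Longrightarrow> \<exists>M. \<forall>p. \<bar>f p\<bar> \<le> M" for f :: "'m \<Rightarrow> real"
proof -
  assume "continuous_on UNIV f"
  then have "bounded (range f)" by (intro compact_imp_bounded compact_continuous_image compactM)
  then show ?thesis unfolding bounded_iff by auto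
qed

lemma integrable_continuous:
  fixes f :: "'m \<Rightarrow> real"
  assumes "continuous_on UNIV f" shows "integrable \<nu> f"
proof -
  obtain M where "\<forall>p. \<bar>f p\<bar> \<le> M" using bounded_continuous[OF assms] by blast
  then show ?thesis
    by (intro finite_measure.integrable_const_bound[OF finite_measure_nu, of _ M] borel_continuous assms always_eventually) simp
qed

text \<open>The measure \<open>\<nu>\<close> restricted to the chart domain is the image of the
  density on Euclidean space under the inverse chart. The prescribed values on Borel sets say
  exactly this, and the integral formula follows by change of variables.\<close>

lemma integral_chart:
  fixes f :: "'m \<Rightarrow> real"
  assumes k: "\<kappa> \<in> A" and f: "f \<in> borel_measurable borel" and supp: "\<And>p. p \<notin> chart_dom \<kappa> \<Longrightarrow> f p = 0"
  shows "(\<integral>p. f p \<partial>\<nu>) = (\<integral>x. dens \<kappa> x * f (chart_inv \<kappa> x) \<partial>lborel)"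
proof -
  interpret chart \<kappa> by (rule chartI[OF k])
  let ?U = "chart_codom \<kappa>"
  \<comment> \<open>Outside the image of the chart the inverse is uncontrolled; a constant there
    makes \<open>T\<close> Borel measurable, and the density vanishes there.\<close>
  define T where "T x = (if x \<in> ?U then chart_inv \<kappa> x else undefined)" for x
  have cinv: "continuous_on ?U (chart_inv \<kappa>)" using homeo by (simp add: homeomorphism_def)
  have T: "T \<in> measurable borel borel"
  proof (rule borel_measurableI)
    fix B :: "'m set" assume "open B"
    then have "open (?U \<inter> chart_inv \<kappa> -` B)" by (rule continuous_open_preimage[OF cinv open_codom])
    moreover have "T -` B \<inter> space borel = (?U \<inter> chart_inv \<kappa> -` B) \<union> (if undefined \<in> B then - ?U else {})"
      by (auto simp: T_def split: if_splits)
    ultimately show "T -` B \<inter> space borel \<in> sets borel" using open_codom by auto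
  qed
  have Td: "T \<in> measurable (density lborel (\<lambda>x. ennreal (dens \<kappa> x))) borel" using T by simp
  note md = measurable_dens[OF k]
  have md': "(\<lambda>x. ennreal (dens \<kappa> x)) \<in> borel_measurable lborel" using md by simp
  have dm: "chart_dom \<kappa> \<in> sets borel" using open_dom by simp
  have eq: "density \<nu> (\<lambda>p. ennreal (indicator (chart_dom \<kappa>) p)) = distr (density lborel (\<lambda>x. ennreal (dens \<kappa> x))) borel T"
  proof (rule measure_eqI)
    fix B assume "B \<in> sets (density \<nu> (\<lambda>p. ennreal (indicator (chart_dom \<kappa>) p)))"
    then have B: "B \<in> sets borel" by simp
    have "emeasure (density \<nu> (\<lambda>p. ennreal (indicator (chart_dom \<kappa>) p))) B
        = (\<integral>\<^sup>+p. indicator (B \<inter> chart_dom \<kappa>) p \<partial>\<nu>)"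
    proof (subst emeasure_density)
      show "(\<lambda>p. ennreal (indicator (chart_dom \<kappa>) p)) \<in> borel_measurable \<nu>"
        using dm by (simp add: measurable_nu)
      show "(\<integral>\<^sup>+p. ennreal (indicator (chart_dom \<kappa>) p) * indicator B p \<partial>\<nu>) = (\<integral>\<^sup>+p. indicator (B \<inter> chart_dom \<kappa>) p \<partial>\<nu>)"
        by (rule nn_integral_cong) (simp split: split_indicator)
    qed (simp add: B)
    also have "\<dots> = emeasure \<nu> (B \<inter> chart_dom \<kappa>)" using B dm by simp
    also have "\<dots> = (\<integral>\<^sup>+x. ennreal (dens \<kappa> x) * indicator (chart_map \<kappa> ` (B \<inter> chart_dom \<kappa>)) x \<partial>lborel)"
      using B dm by (intro emeasure_chart[OF k]) auto
    also have "\<dots> = (\<integral>\<^sup>+x. ennreal (dens \<kappa> x) * indicator (T -` B) x \<partial>lborel)"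
    proof (rule nn_integral_cong)
      fix x
      have "x \<in> chart_map \<kappa> ` (B \<inter> chart_dom \<kappa>) \<longleftrightarrow> x \<in> T -` B" if "x \<in> ?U"
        using that by (auto simp: T_def intro!: image_eqI)
      then show "ennreal (dens \<kappa> x) * indicator (chart_map \<kappa> ` (B \<inter> chart_dom \<kappa>)) x = ennreal (dens \<kappa> x) * indicator (T -` B) x"
        by (cases "x \<in> ?U") (auto simp: dens_def indicator_def)
    qed
    also have "\<dots> = emeasure (density lborel (\<lambda>x. ennreal (dens \<kappa> x))) (T -` B)"
      using measurable_sets[OF T B] by (intro emeasure_density[symmetric, OF md']) simp
    also have "\<dots> = emeasure (distr (density lborel (\<lambda>x. ennreal (dens \<kappa> x))) borel T) B"
      by (subst emeasure_distr[OF Td B]) simp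
    finally show "emeasure (density \<nu> (\<lambda>p. ennreal (indicator (chart_dom \<kappa>) p))) B =
        emeasure (distr (density lborel (\<lambda>x. ennreal (dens \<kappa> x))) borel T) B" .
  qed simp
  have "(\<integral>p. f p \<partial>\<nu>) = (\<integral>p. indicator (chart_dom \<kappa>) p *\<^sub>R f p \<partial>\<nu>)"
    by (rule Bochner_Integration.integral_cong) (auto simp: indicator_def supp)
  also have "\<dots> = (\<integral>p. f p \<partial>density \<nu> (\<lambda>p. ennreal (indicator (chart_dom \<kappa>) p)))"
    by (rule integral_density[symmetric]) (use f dm in \<open>auto simp: measurable_nu\<close>)
  also have "\<dots> = (\<integral>x. f (T x) \<partial>density lborel (\<lambda>x. ennreal (dens \<kappa> x)))"
    unfolding eq by (rule integral_distr[OF Td f])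
  also have "\<dots> = (\<integral>x. dens \<kappa> x *\<^sub>R f (T x) \<partial>lborel)"
    by (rule integral_density) (use md measurable_compose[OF T f] dens_nonneg[OF k] in auto)
  also have "\<dots> = (\<integral>x. dens \<kappa> x * f (chart_inv \<kappa> x) \<partial>lborel)"
    by (rule Bochner_Integration.integral_cong) (auto simp: T_def dens_def)
  finally show ?thesis .
qed

lemma gamma_zero_outside:
  assumes "closed K" "p \<notin> K" "\<And>q. q \<notin> K \<Longrightarrow> h q = 0"
  shows "gamma h f p = 0"
proof -
  let ?k = "chart_at A p" and ?V = "chart_dom (chart_at A p) - K"
  interpret chart ?k by (rule chartI[OF chart_at(1)])
  have "pd ?k i h p = pd ?k i (\<lambda>q. 0) p" for i
    by (rule pd_cong[of ?V]) (use assms open_dom chart_at(2)[of p] in auto)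
  then show ?thesis by (simp add: gamma_def chart_gamma_def pd_const)
qed

lemma ibp_chart:
  assumes k: "\<kappa> \<in> A" and K: "compact K" "K \<subseteq> chart_dom \<kappa>" and h: "C1M h" and supp: "\<And>q. q \<notin> K \<Longrightarrow> h q = 0"
    and f: "smoothM f"
  shows "(\<integral>p. h p * lap f p + gamma h f p \<partial>\<nu>) = 0"
proof -
  interpret metric_chart \<kappa> g by (rule metric_chartI[OF k])
  let ?U = "chart_codom \<kappa>" and ?K = "chart_map \<kappa> ` K"
  have cmap: "continuous_on (chart_dom \<kappa>) (chart_map \<kappa>)" using homeo by (simp add: homeomorphism_def)
  have K': "compact ?K" by (rule compact_continuous_image[OF continuous_on_subset[OF cmap K(2)] K(1)])
  have oK: "open (- ?K)" by (rule open_Compl[OF compact_imp_closed[OF K']])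
  have KU: "?K \<subseteq> ?U" using K(2) by blast
  define w where "w i q = sqrt (det (g \<kappa> q)) * (h q * grad g f \<kappa> q $ i)" for i q
  \<comment> \<open>The density-weighted components of \<open>h\<close> times the gradient, extended
    by zero. The extension is C^1 since the support is compact inside the open image, and the
    partial derivatives of the components sum to the density times the divergence.\<close>
  define F where "F i x = (if x \<in> ?U then w i (chart_inv \<kappa> x) else 0)" for i x
  have w0: "w i (chart_inv \<kappa> x) = 0" if "x \<in> ?U" "x \<notin> ?K" for i x
  proof -
    obtain q where q: "q \<in> cdom" "x = chart_map \<kappa> q" using \<open>x \<in> ?U\<close> by blast
    then have "chart_inv \<kappa> x \<notin> K" using that(2) by auto
    then show ?thesis by (simp add: w_def supp)
  qed
  have F0: "F i x = 0" if "x \<notin> ?K" for i x using w0 that by (simp add: F_def)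
  have sg: "smooth_on ?U (\<lambda>x. g \<kappa> (chart_inv \<kappa> x) $ i $ j)" for i j using g_smooth by (simp add: csmooth_def)
  have "Ck_on 1 ?U (\<lambda>x. sqrt (det (g \<kappa> (chart_inv \<kappa> x))))"
  proof (rule Ck_on_sqrt[OF open_codom])
    show "det (g \<kappa> (chart_inv \<kappa> x)) > 0" if "x \<in> ?U" for x using that det_pos by auto
    show "Ck_on 1 ?U (\<lambda>x. det (g \<kappa> (chart_inv \<kappa> x)))"
      using smooth_on_det[OF open_codom sg] unfolding smooth_on_def by blast
  qed
  moreover have "Ck_on 1 ?U (\<lambda>x. h (chart_inv \<kappa> x))" using h k unfolding C1M_def by blast
  moreover have sgr: "csmooth \<kappa> cdom (\<lambda>q. grad g f \<kappa> q $ i)" for i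
    by (rule csmooth_grad[OF open_dom subset_refl smoothM_csmooth[OF f k subset_refl]])
  then have "Ck_on 1 ?U (\<lambda>x. grad g f \<kappa> (chart_inv \<kappa> x) $ i)" for i
    unfolding csmooth_def smooth_on_def by blast
  ultimately have Cw: "Ck_on 1 ?U (\<lambda>x. w i (chart_inv \<kappa> x))" for i
    unfolding w_def by (intro Ck_on_mult open_codom)
  have CF: "Ck_on 1 UNIV (F i)" for i
  proof -
    have "Ck_on 1 ?U (F i)"
      by (rule iffD1[OF Ck_on_cong[OF open_codom] Cw[of i]]) (simp add: F_def)
    moreover have "Ck_on 1 (- ?K) (F i)"
      by (rule iffD1[OF Ck_on_cong[OF oK] Ck_on_const[of 1 _ 0]]) (simp add: F0)
    ultimately have "Ck_on 1 (?U \<union> - ?K) (F i)" by (rule Ck_on_Un[OF open_codom oK])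
    moreover have "?U \<union> - ?K = UNIV" using KU by blast
    ultimately show ?thesis by simp
  qed
  have pw: "(\<Sum>i. frechet_derivative (F i) (at x) (axis i 1)) =
      dens \<kappa> x * (h (chart_inv \<kappa> x) * lap f (chart_inv \<kappa> x) + gamma h f (chart_inv \<kappa> x))" for x
  proof (cases "x \<in> ?U")
    case True
    then obtain p where p: "p \<in> cdom" "x = chart_map \<kappa> p" by blast
    have inv: "chart_inv \<kappa> x = p" using p by simp
    note ch = C1M_cdiff[OF h k p(1)] and cg = csmooth_imp_cdiff[OF sgr p(1)]
    have "frechet_derivative (F i) (at x) = frechet_derivative (\<lambda>x. w i (chart_inv \<kappa> x)) (at x)" for i
      by (rule frechet_derivative_cong_on[OF open_codom True]) (simp add: F_def)
    then have "(\<Sum>i. frechet_derivative (F i) (at x) (axis i 1)) = (\<Sum>i. pd \<kappa> i (w i) p)"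
      by (simp add: pd_def p(2))
    also have "\<dots> = sqrt (det (g \<kappa> p)) * chart_div g \<kappa> (\<lambda>q. h q *\<^sub>R grad g f \<kappa> q) p"
      using pd_density_eq_chart_div[OF p(1), of "\<lambda>q. h q *\<^sub>R grad g f \<kappa> q"] cdiff_mult[OF ch cg]
      by (simp add: w_def[abs_def])
    also have "chart_div g \<kappa> (\<lambda>q. h q *\<^sub>R grad g f \<kappa> q) p = gamma h f p + h p * lap f p"
      unfolding chart_div_scale_grad[OF open_dom subset_refl ch smoothM_csmooth[OF f k subset_refl] p(1)]
      using gamma_eq[OF k p(1) ch smoothM_cdiff[OF f k p(1)]] lap_eq[OF f k p(1)] by simp
    finally show ?thesis using True inv by (simp add: dens_def)
  next
    case False
    then have "x \<in> - ?K" using KU by blast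
    have "frechet_derivative (F i) (at x) = frechet_derivative (\<lambda>x. 0) (at x)" for i
      by (rule frechet_derivative_cong_on[OF oK \<open>x \<in> - ?K\<close>]) (simp add: F0)
    then show ?thesis using False by (simp add: dens_def)
  qed
  have cont: "continuous_on UNIV (\<lambda>p. h p * lap f p + gamma h f p)"
    by (intro continuous_on_add continuous_on_mult C1M_continuous[OF h] smoothM_continuous smoothM_lap f gamma_C1_continuous h)
  have z: "h p * lap f p + gamma h f p = 0" if "p \<notin> chart_dom \<kappa>" for p
  proof -
    have p: "p \<notin> K" using K(2) that by blast
    show ?thesis using gamma_zero_outside[where h = h, OF compact_imp_closed[OF K(1)] p supp] supp[OF p] by simp
  qed
  have "(\<integral>p. h p * lap f p + gamma h f p \<partial>\<nu>) =
      (\<integral>x. dens \<kappa> x * (h (chart_inv \<kappa> x) * lap f (chart_inv \<kappa> x) + gamma h f (chart_inv \<kappa> x)) \<partial>lborel)"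
    by (rule integral_chart[OF k borel_measurable_continuous_onI[OF cont] z])
  also have "\<dots> = (\<integral>x. (\<Sum>i. frechet_derivative (F i) (at x) (axis i 1)) \<partial>lborel)" by (simp only: pw)
  also have "\<dots> = (\<Sum>i. (\<integral>x. frechet_derivative (F i) (at x) (axis i 1) \<partial>lborel))"
    by (rule Bochner_Integration.integral_sum) (rule integral_directional_derivative_zero(1)[OF CF K' F0])
  also have "\<dots> = 0" by (intro sum.neutral ballI integral_directional_derivative_zero(2)[OF CF K' F0])
  finally show ?thesis .
qed

lemma gamma_sum:
  assumes "finite I" "\<And>i. i \<in> I \<Longrightarrow> cdiffM (h i)"
  shows "gamma (\<lambda>q. \<Sum>i\<in>I. h i q) f p = (\<Sum>i\<in>I. gamma (h i) f p)"
proof -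
  interpret chart "chart_at A p" by (rule chartI[OF chart_at(1)])
  have "cdiff (chart_at A p) (h i) p" if "i \<in> I" for i using assms(2)[OF that] chart_at unfolding cdiffM_def by blast
  then show ?thesis unfolding gamma_def chart_gamma_def
    by (simp add: pd_sum assms(1) sum_distrib_right) (rule sum.swap)
qed

theorem ibp:
  assumes h: "C1M h" and f: "smoothM f"
  shows "(\<integral>p. h p * lap f p \<partial>\<nu>) = - (\<integral>p. gamma h f p \<partial>\<nu>)"
proof -
  obtain P r where P: "finite P" "\<And>p. r p > 0"
    "\<And>p. cball (chart_map (chart_at A p) p) (r p) \<subseteq> chart_codom (chart_at A p)"
    "(\<Union>p\<in>P. chart_nbhd (chart_at A p) p (r p)) = UNIV" by (rule finite_chart_cover) blast
  define b where "b p = bump (chart_at A p) p (r p)" for p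
  define S where "S q = (\<Sum>p\<in>P. b p q)" for q
  have Cb: "C1M (b p)" for p unfolding b_def by (rule C1M_bump[OF chart_at(1) P(2,3)])
  have Spos: "S q > 0" for q
  proof -
    obtain p where p: "p \<in> P" "q \<in> chart_nbhd (chart_at A p) p (r p)" using P(4) by blast
    then have "b p q > 0" unfolding b_def chart_nbhd_def by (intro bump_pos P(2)) auto
    then show ?thesis unfolding S_def
      by (intro sum_pos2[OF P(1) p(1)]) (simp_all add: b_def bump_nonneg)
  qed
  have CS: "C1M S" unfolding S_def[abs_def] by (rule C1M_sum[OF Cb])
  \<comment> \<open>Dividing by \<open>S\<close> normalises the bumps to a C^1 partition of unity;
    \<open>e p\<close> is the piece of \<open>h\<close> supported in the chart chosen at
    \<open>p\<close>.\<close>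
  define e where "e p q = b p q * (h q * inverse (S q))" for p q
  have "S q \<noteq> 0" for q using Spos[of q] by simp
  then have Ce: "C1M (e p)" for p unfolding e_def[abs_def] by (intro C1M_mult Cb h C1M_inverse CS)
  have he: "h = (\<lambda>q. \<Sum>p\<in>P. e p q)"
  proof
    fix q
    have "(\<Sum>p\<in>P. e p q) = S q * (h q * inverse (S q))" by (simp add: e_def S_def sum_distrib_right)
    then show "h q = (\<Sum>p\<in>P. e p q)" using Spos[of q] by simp
  qed
  have cont: "continuous_on UNIV (\<lambda>q. h q * lap f q + gamma h f q)" if "C1M h" for h
    by (intro continuous_on_add continuous_on_mult C1M_continuous that smoothM_continuous smoothM_lap f gamma_C1_continuous)
  have "(\<integral>q. h q * lap f q + gamma h f q \<partial>\<nu>) = (\<integral>q. (\<Sum>p\<in>P. e p q * lap f q + gamma (e p) f q) \<partial>\<nu>)"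
    unfolding he by (simp add: gamma_sum[OF P(1) C1M_cdiffM[OF Ce]] sum_distrib_right sum.distrib)
  also have "\<dots> = (\<Sum>p\<in>P. (\<integral>q. e p q * lap f q + gamma (e p) f q \<partial>\<nu>))"
    by (intro Bochner_Integration.integral_sum integrable_continuous cont Ce)
  also have "\<dots> = 0"
  proof (intro sum.neutral ballI)
    fix p
    show "(\<integral>q. e p q * lap f q + gamma (e p) f q \<partial>\<nu>) = 0"
      by (rule ibp_chart[OF chart_at(1)[of p] bump_supp(1,2)[OF chart_at(1)[of p] P(2)[of p] P(3)[of p]] Ce _ f])
        (simp add: e_def b_def bump_supp(3)[OF chart_at(1) P(2,3)])
  qed
  finally have 0: "(\<integral>q. h q * lap f q + gamma h f q \<partial>\<nu>) = 0" .
  have "integrable \<nu> (\<lambda>q. h q * lap f q)" "integrable \<nu> (gamma h f)"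
    by (intro integrable_continuous continuous_on_mult C1M_continuous h smoothM_continuous smoothM_lap f gamma_C1_continuous)+
  then show ?thesis using 0 by simp
qed

end

section \<open>Smooth evolutions\<close>

text \<open>The mean value theorem bounds all difference quotients by \<open>M\<close>, and
  constants are integrable for a finite measure, so dominated convergence applies along every
  sequence.\<close>

lemma has_real_derivative_integral_bounded:
  fixes f f' :: "real \<Rightarrow> 'x \<Rightarrow> real"
  assumes fin: "finite_measure N" and \<delta>: "\<delta> > 0"
    and int: "\<And>s. \<bar>s - t\<bar> < \<delta> \<Longrightarrow> integrable N (f s)"
    and der: "\<And>s p. \<bar>s - t\<bar> < \<delta> \<Longrightarrow> ((\<lambda>s. f s p) has_real_derivative f' s p) (at s)"
    and bd: "\<And>s p. \<bar>s - t\<bar> < \<delta> \<Longrightarrow> \<bar>f' s p\<bar> \<le> M"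
    and meas: "f' t \<in> borel_measurable N"
  shows "((\<lambda>s. \<integral>p. f s p \<partial>N) has_real_derivative (\<integral>p. f' t p \<partial>N)) (at t)"
proof -
  let ?S = "{-\<delta><..<\<delta>}"
  \<comment> \<open>The window leaves the limit unchanged, but puts every term of a test sequence,
    not just its tail, where the hypotheses hold.\<close>
  have at0: "at 0 within ?S = at (0::real)" by (rule at_within_open) (use \<delta> in auto)
  have "((\<lambda>h. ((\<integral>p. f (t + h) p \<partial>N) - (\<integral>p. f t p \<partial>N)) / h) \<longlongrightarrow> (\<integral>p. f' t p \<partial>N)) (at 0 within ?S)"
    unfolding tendsto_at_iff_sequentially comp_def
  proof (intro allI impI)
    fix X :: "nat \<Rightarrow> real"
    assume X: "\<forall>i. X i \<in> ?S - {0}" "X \<longlonglongrightarrow> 0"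
    have t: "\<bar>t - t\<bar> < \<delta>" using \<delta> by simp
    have Xi: "\<bar>(t + X i) - t\<bar> < \<delta>" "X i \<noteq> 0" for i using X(1) by (auto simp: abs_less_iff minus_less_iff)
    have "((\<integral>p. f (t + X i) p \<partial>N) - (\<integral>p. f t p \<partial>N)) / X i = (\<integral>p. (f (t + X i) p - f t p) / X i \<partial>N)" for i
      using int[OF Xi(1)[of i]] int[OF t] by simp
    moreover have "(\<lambda>i. \<integral>p. (f (t + X i) p - f t p) / X i \<partial>N) \<longlonglongrightarrow> (\<integral>p. f' t p \<partial>N)"
    proof (rule integral_dominated_convergence[where w = "\<lambda>p. M"])
      show "f' t \<in> borel_measurable N" by (rule meas)
      show "(\<lambda>p. (f (t + X i) p - f t p) / X i) \<in> borel_measurable N" for i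
        using int[OF Xi(1)[of i]] int[OF t] by measurable
      show "integrable N (\<lambda>p. M)" using fin by (simp add: finite_measure.integrable_const)
      show "AE p in N. (\<lambda>i. (f (t + X i) p - f t p) / X i) \<longlonglongrightarrow> f' t p"
      proof (intro always_eventually allI)
        fix p
        have "((\<lambda>h. (f (t + h) p - f t p) / h) \<longlongrightarrow> f' t p) (at 0)" using der[OF t] by (simp add: DERIV_def)
        moreover have "filterlim X (at 0) sequentially" using X(2) Xi(2) by (auto simp: filterlim_at)
        ultimately show "(\<lambda>i. (f (t + X i) p - f t p) / X i) \<longlonglongrightarrow> f' t p" by (rule filterlim_compose)
      qed
      show "AE p in N. norm ((f (t + X i) p - f t p) / X i) \<le> M" for i
      proof (intro always_eventually allI)
        fix p
        have *: "z \<in> ball t \<delta> \<longleftrightarrow> \<bar>z - t\<bar> < \<delta>" for z by (simp add: dist_real_def abs_minus_commute)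
        have "norm (f (t + X i) p - f t p) \<le> M * norm (t + X i - t)"
        proof (rule field_differentiable_bound[where S = "ball t \<delta>" and f' = "\<lambda>s. f' s p"])
          show "((\<lambda>s. f s p) has_field_derivative f' z p) (at z within ball t \<delta>)" if "z \<in> ball t \<delta>" for z
            by (rule has_field_derivative_at_within[OF der]) (use that * in blast)
          show "norm (f' z p) \<le> M" if "z \<in> ball t \<delta>" for z using bd that unfolding * by simp
          show "t + X i \<in> ball t \<delta>" "t \<in> ball t \<delta>" using Xi(1) t unfolding * by blast+
        qed simp
        then show "norm ((f (t + X i) p - f t p) / X i) \<le> M"
          using Xi(2)[of i] by (simp add: divide_le_eq)
      qed
    qed
    ultimately show "(\<lambda>i. ((\<integral>p. f (t + X i) p \<partial>N) - (\<integral>p. f t p \<partial>N)) / X i) \<longlonglongrightarrow> (\<integral>p. f' t p \<partial>N)" by (simp only:)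
  qed
  then show ?thesis unfolding at0 by (simp add: DERIV_def)
qed

section \<open>Space and time derivatives in a chart\<close>

definition levol :: "('m, 'n::finite) chart \<Rightarrow> real set \<Rightarrow> (real \<Rightarrow> 'm \<Rightarrow> real) \<Rightarrow> bool" where
  "levol \<kappa> J F \<longleftrightarrow> smooth_on (chart_codom \<kappa> \<times> J) (\<lambda>z. F (snd z) (chart_inv \<kappa> (fst z)))"

abbreviation (input) tderiv :: "(real \<Rightarrow> 'm \<Rightarrow> real) \<Rightarrow> real \<Rightarrow> 'm \<Rightarrow> real" where
  "tderiv F t p \<equiv> deriv (\<lambda>s. F s p) t"

context chart
begin

context
  fixes J :: "real set" assumes J: "open J"
begin

lemma open_UJ: "open (chart_codom \<kappa> \<times> J)"
  by (rule open_Times[OF open_codom J])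

lemma levol_cong:
  assumes "\<And>t p. t \<in> J \<Longrightarrow> p \<in> chart_dom \<kappa> \<Longrightarrow> F t p = G t p"
  shows "levol \<kappa> J F \<longleftrightarrow> levol \<kappa> J G"
  unfolding levol_def by (rule smooth_on_cong[OF open_UJ]) (use assms in auto)

lemma levol_const: "csmooth \<kappa> (chart_dom \<kappa>) f \<Longrightarrow> levol \<kappa> J (\<lambda>t. f)"
  unfolding csmooth_def levol_def by (rule smooth_on_fst[OF open_codom J])

lemma levol_mult: "levol \<kappa> J F \<Longrightarrow> levol \<kappa> J G \<Longrightarrow> levol \<kappa> J (\<lambda>t p. F t p * G t p)"
  unfolding levol_def by (rule smooth_on_mult[OF open_UJ])

lemma levol_sum: "(\<And>i. i \<in> I \<Longrightarrow> levol \<kappa> J (F i)) \<Longrightarrow> levol \<kappa> J (\<lambda>t p. \<Sum>i\<in>I. F i t p)"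
  unfolding levol_def by (rule smooth_on_sum[OF open_UJ])

lemma levol_ln:
  assumes "\<And>t p. t \<in> J \<Longrightarrow> F t p > 0" "levol \<kappa> J F"
  shows "levol \<kappa> J (\<lambda>t p. ln (F t p))"
  using assms unfolding levol_def by (intro smooth_on_ln[OF open_UJ]) auto

lemma levol_pd_eq:
  assumes F: "levol \<kappa> J F" and t: "t \<in> J" and p: "p \<in> chart_dom \<kappa>"
  shows "pd \<kappa> i (F t) p = frechet_derivative (\<lambda>z. F (snd z) (chart_inv \<kappa> (fst z))) (at (chart_map \<kappa> p, t)) (axis i 1, 0)"
    and "((\<lambda>s. F s p) has_real_derivative
      frechet_derivative (\<lambda>z. F (snd z) (chart_inv \<kappa> (fst z))) (at (chart_map \<kappa> p, t)) (0, 1)) (at t)"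
proof -
  have d: "(\<lambda>z. F (snd z) (chart_inv \<kappa> (fst z))) differentiable at (chart_map \<kappa> p, t)"
    using F t p unfolding levol_def by (intro smooth_on_imp_differentiable) auto
  show "pd \<kappa> i (F t) p = frechet_derivative (\<lambda>z. F (snd z) (chart_inv \<kappa> (fst z))) (at (chart_map \<kappa> p, t)) (axis i 1, 0)"
    unfolding pd_def using frechet_derivative_slice(2)[OF d] by simp
  show "((\<lambda>s. F s p) has_real_derivative
      frechet_derivative (\<lambda>z. F (snd z) (chart_inv \<kappa> (fst z))) (at (chart_map \<kappa> p, t)) (0, 1)) (at t)"
    using frechet_derivative_slice(3)[OF d] p by simp
qed

lemma levol_csmooth: "levol \<kappa> J F \<Longrightarrow> t \<in> J \<Longrightarrow> csmooth \<kappa> (chart_dom \<kappa>) (F t)"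
  using smooth_on_slice[OF open_codom, of t J "\<lambda>z. F (snd z) (chart_inv \<kappa> (fst z))"] by (simp add: csmooth_def levol_def)

lemma levol_has_derivative:
  assumes "levol \<kappa> J F" "t \<in> J" "p \<in> chart_dom \<kappa>"
  shows "((\<lambda>s. F s p) has_real_derivative tderiv F t p) (at t)"
  using levol_pd_eq(2)[OF assms] DERIV_imp_deriv[OF levol_pd_eq(2)[OF assms]] by simp

lemma levol_pd:
  assumes F: "levol \<kappa> J F" shows "levol \<kappa> J (\<lambda>t. pd \<kappa> i (F t))"
  unfolding levol_def
proof (subst smooth_on_cong[OF open_UJ])
  show "smooth_on (chart_codom \<kappa> \<times> J)
      (\<lambda>z. frechet_derivative (\<lambda>z. F (snd z) (chart_inv \<kappa> (fst z))) (at z) (axis i 1, 0))"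
    by (rule smooth_on_frechet_derivative[OF F[unfolded levol_def]])
  show "pd \<kappa> i (F (snd z)) (chart_inv \<kappa> (fst z)) =
      frechet_derivative (\<lambda>z. F (snd z) (chart_inv \<kappa> (fst z))) (at z) (axis i 1, 0)"
    if "z \<in> chart_codom \<kappa> \<times> J" for z
    using levol_pd_eq(1)[OF F, of "snd z" "chart_inv \<kappa> (fst z)"] that by auto
qed

lemma levol_tderiv:
  assumes F: "levol \<kappa> J F" shows "levol \<kappa> J (tderiv F)"
  unfolding levol_def
proof (subst smooth_on_cong[OF open_UJ])
  show "smooth_on (chart_codom \<kappa> \<times> J)
      (\<lambda>z. frechet_derivative (\<lambda>z. F (snd z) (chart_inv \<kappa> (fst z))) (at z) (0, 1))"
    by (rule smooth_on_frechet_derivative[OF F[unfolded levol_def]])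
  show "tderiv F (snd z) (chart_inv \<kappa> (fst z)) =
      frechet_derivative (\<lambda>z. F (snd z) (chart_inv \<kappa> (fst z))) (at z) (0, 1)"
    if "z \<in> chart_codom \<kappa> \<times> J" for z
    using DERIV_imp_deriv[OF levol_pd_eq(2)[OF F, of "snd z" "chart_inv \<kappa> (fst z)"]] that by auto
qed

text \<open>Schwarz's theorem on the product of the chart image and \<open>J\<close>, for the
  directions \<open>(axis i 1, 0)\<close> and \<open>(0, 1)\<close>.\<close>

lemma pd_tderiv_commute:
  assumes F: "levol \<kappa> J F" and t: "t \<in> J" and p: "p \<in> chart_dom \<kappa>"
  shows "pd \<kappa> i (tderiv F t) p = tderiv (\<lambda>t. pd \<kappa> i (F t)) t p"
proof -
  let ?P = "\<lambda>z. F (snd z) (chart_inv \<kappa> (fst z))"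
  have z: "(chart_map \<kappa> p, t) \<in> chart_codom \<kappa> \<times> J" using t p by simp
  have 1: "tderiv F (snd z) (chart_inv \<kappa> (fst z)) = frechet_derivative ?P (at z) (0, 1)"
    if "z \<in> chart_codom \<kappa> \<times> J" for z
    using DERIV_imp_deriv[OF levol_pd_eq(2)[OF F, of "snd z" "chart_inv \<kappa> (fst z)"]] that by auto
  have 2: "pd \<kappa> i (F (snd z)) (chart_inv \<kappa> (fst z)) = frechet_derivative ?P (at z) (axis i 1, 0)"
    if "z \<in> chart_codom \<kappa> \<times> J" for z
    using levol_pd_eq(1)[OF F, of "snd z" "chart_inv \<kappa> (fst z)"] that by auto
  have "Ck_on 2 (chart_codom \<kappa> \<times> J) ?P" using F unfolding levol_def smooth_on_def by blast
  note comm = frechet_derivative_commute[OF open_UJ z this]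
  have d1: "frechet_derivative (\<lambda>z. tderiv F (snd z) (chart_inv \<kappa> (fst z))) (at (chart_map \<kappa> p, t)) =
      frechet_derivative (\<lambda>z. frechet_derivative ?P (at z) (0, 1)) (at (chart_map \<kappa> p, t))"
    by (rule frechet_derivative_cong_on[OF open_UJ z]) (rule 1)
  have d2: "frechet_derivative (\<lambda>z. pd \<kappa> i (F (snd z)) (chart_inv \<kappa> (fst z))) (at (chart_map \<kappa> p, t)) =
      frechet_derivative (\<lambda>z. frechet_derivative ?P (at z) (axis i 1, 0)) (at (chart_map \<kappa> p, t))"
    by (rule frechet_derivative_cong_on[OF open_UJ z]) (rule 2)
  have "pd \<kappa> i (tderiv F t) p = frechet_derivative (\<lambda>z. frechet_derivative ?P (at z) (0, 1)) (at (chart_map \<kappa> p, t)) (axis i 1, 0)"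
    by (rule trans[OF levol_pd_eq(1)[OF levol_tderiv[OF F] t p] fun_cong[OF d1]])
  also have "\<dots> = frechet_derivative (\<lambda>z. pd \<kappa> i (F (snd z)) (chart_inv \<kappa> (fst z))) (at (chart_map \<kappa> p, t)) (0, 1)"
    by (rule trans[OF comm fun_cong[OF d2, symmetric]])
  also have "\<dots> = tderiv (\<lambda>t. pd \<kappa> i (F t)) t p"
    by (rule DERIV_imp_deriv[OF levol_pd_eq(2)[OF levol_pd[OF F] t p], symmetric])
  finally show ?thesis .
qed

end

end

section \<open>Evolutions on the compact manifold\<close>

locale riem_evolution = riem_measure A g \<nu> for A :: "('m::t2_space, 'n::finite) chart set" and g \<nu> +
  fixes J :: "real set"
  assumes J: "open J"
begin

definition evol :: "(real \<Rightarrow> 'm \<Rightarrow> real) \<Rightarrow> bool" where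
  "evol F \<longleftrightarrow> (\<forall>\<kappa>\<in>A. levol \<kappa> J F)"

lemma evol_smooth_evolution: "smooth_evolution A J F \<longleftrightarrow> evol F"
  by (simp add: smooth_evolution_def evol_def levol_def case_prod_unfold)

lemma evol_levol: "evol F \<Longrightarrow> \<kappa> \<in> A \<Longrightarrow> levol \<kappa> J F"
  by (simp add: evol_def)

lemma evol_smoothM: "evol F \<Longrightarrow> t \<in> J \<Longrightarrow> smoothM (F t)"
  unfolding smoothM_def by (rule ballI) (rule chart.levol_csmooth[OF chartI J evol_levol])

lemma evol_mult: "evol F \<Longrightarrow> evol G \<Longrightarrow> evol (\<lambda>t p. F t p * G t p)"
  unfolding evol_def[of "\<lambda>t p. F t p * G t p"]
  by (rule ballI) (rule chart.levol_mult[OF chartI J evol_levol evol_levol])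

lemma evol_ln: "evol F \<Longrightarrow> (\<And>t p. t \<in> J \<Longrightarrow> F t p > 0) \<Longrightarrow> evol (\<lambda>t p. ln (F t p))"
  unfolding evol_def[of "\<lambda>t p. ln (F t p)"]
  by (rule ballI) (rule chart.levol_ln[OF chartI J _ evol_levol])

lemma evol_tderiv: "evol F \<Longrightarrow> evol (tderiv F)"
  unfolding evol_def[of "tderiv F"] by (rule ballI) (rule chart.levol_tderiv[OF chartI J evol_levol])

lemma evol_has_derivative:
  "evol F \<Longrightarrow> t \<in> J \<Longrightarrow> ((\<lambda>s. F s p) has_real_derivative tderiv F t p) (at t)"
  by (rule chart.levol_has_derivative[OF chartI[OF chart_at(1)[of p]] J evol_levol[OF _ chart_at(1)] _ chart_at(2)])

lemma evol_gamma:
  assumes a: "evol a" and b: "evol b" shows "evol (\<lambda>t. gamma (a t) (b t))"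
  unfolding evol_def
proof
  fix \<kappa> assume k: "\<kappa> \<in> A"
  interpret metric_chart \<kappa> g by (rule metric_chartI[OF k])
  note ka = evol_levol[OF a k] and kb = evol_levol[OF b k]
  have "gamma (a t) (b t) p = (\<Sum>i. pd \<kappa> i (a t) p * (\<Sum>j. h p i j * pd \<kappa> j (b t) p))"
    if "t \<in> J" "p \<in> cdom" for t p
    using gamma_eq_smooth[OF evol_smoothM[OF a that(1)] evol_smoothM[OF b that(1)] k that(2)]
    by (simp add: chart_gamma_def grad_def)
  moreover have "levol \<kappa> J (\<lambda>t p. \<Sum>i. pd \<kappa> i (a t) p * (\<Sum>j. h p i j * pd \<kappa> j (b t) p))"
    by (intro levol_sum[OF J] levol_mult[OF J] levol_pd[OF J] levol_const[OF J] csmooth_h open_dom subset_refl ka kb)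
  ultimately show "levol \<kappa> J (\<lambda>t. gamma (a t) (b t))"
    by (rule iffD2[OF levol_cong[OF J]])
qed

text \<open>The metric does not move in time, so the product rule meets only the two functions, and
  time derivatives pass through coordinate derivatives.\<close>

lemma tderiv_gamma:
  assumes a: "evol a" and b: "evol b" and t: "t \<in> J"
  shows "tderiv (\<lambda>t. gamma (a t) (b t)) t p = gamma (tderiv a t) (b t) p + gamma (a t) (tderiv b t) p"
proof -
  let ?k = "chart_at A p"
  interpret metric_chart ?k g by (rule metric_chartI[OF chart_at(1)])
  note ka = evol_levol[OF a chart_at(1)[of p]] and kb = evol_levol[OF b chart_at(1)[of p]]
  have d: "((\<lambda>s. pd ?k i (F s) p) has_real_derivative pd ?k i (tderiv F t) p) (at t)" if "levol ?k J F" for F i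
    unfolding pd_tderiv_commute[OF J that t chart_at(2)]
    by (rule levol_has_derivative[OF J levol_pd[OF J that] t chart_at(2)])
  have "((\<lambda>s. \<Sum>i. pd ?k i (a s) p * (\<Sum>j. h p i j * pd ?k j (b s) p)) has_real_derivative
    (\<Sum>i. pd ?k i (a t) p * (\<Sum>j. h p i j * pd ?k j (tderiv b t) p)
       + pd ?k i (tderiv a t) p * (\<Sum>j. h p i j * pd ?k j (b t) p))) (at t)"
    by (intro DERIV_sum DERIV_mult' DERIV_cmult d ka kb)
  then show ?thesis
    unfolding gamma_def chart_gamma_def grad_def vec_lambda_beta sum.distrib[symmetric]
    by (rule DERIV_imp_deriv[THEN trans]) (simp add: add.commute)
qed

lemma evol_continuous:
  assumes F: "evol F" shows "continuous_on (UNIV \<times> J) (\<lambda>z. F (snd z) (fst z))"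
proof -
  have "continuous_on (\<Union>\<kappa>\<in>A. chart_dom \<kappa> \<times> J) (\<lambda>z. F (snd z) (fst z))"
  proof (rule continuous_on_open_UN)
    fix \<kappa> assume k: "\<kappa> \<in> A"
    interpret chart \<kappa> by (rule chartI[OF k])
    show "open (chart_dom \<kappa> \<times> J)" by (rule open_Times[OF open_dom J])
    have "continuous_on (chart_dom \<kappa>) (chart_map \<kappa>)" using homeo by (simp add: homeomorphism_def)
    moreover have "continuous_on (chart_dom \<kappa> \<times> J) fst" by (intro continuous_intros)
    ultimately have "continuous_on (chart_dom \<kappa> \<times> J) (\<lambda>z. chart_map \<kappa> (fst z))"
      by (rule continuous_on_compose2) auto
    then have "continuous_on (chart_dom \<kappa> \<times> J) (\<lambda>z. (chart_map \<kappa> (fst z), snd z))"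
      by (rule continuous_on_Pair) (intro continuous_intros)
    with smooth_on_imp_continuous_on[OF evol_levol[OF F k, unfolded levol_def]]
    have "continuous_on (chart_dom \<kappa> \<times> J) (\<lambda>z. F (snd (chart_map \<kappa> (fst z), snd z)) (chart_inv \<kappa> (fst (chart_map \<kappa> (fst z), snd z))))"
      by (rule continuous_on_compose2) (use mem_Times_iff in force)
    then show "continuous_on (chart_dom \<kappa> \<times> J) (\<lambda>z. F (snd z) (fst z))"
      by (rule continuous_on_eq) (simp add: mem_Times_iff)
  qed
  moreover have "(\<Union>\<kappa>\<in>A. chart_dom \<kappa> \<times> J) = UNIV \<times> J" using atlas by (auto simp: smooth_atlas_def)
  ultimately show ?thesis by simp
qed

text \<open>The uniform bound on the time derivative comes from compactness of the manifold times a
  closed interval around \<open>t\<close>.\<close>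

lemma integral_has_derivative:
  assumes F: "evol F" and t: "t \<in> J"
  shows "((\<lambda>s. \<integral>p. F s p \<partial>\<nu>) has_real_derivative (\<integral>p. tderiv F t p \<partial>\<nu>)) (at t)"
proof -
  obtain \<delta> where \<delta>: "\<delta> > 0" "cball t \<delta> \<subseteq> J" using J t open_contains_cball by blast
  have sJ: "s \<in> J" if "\<bar>s - t\<bar> < \<delta>" for s using \<delta>(2) that by (auto simp: dist_real_def abs_minus_commute subset_iff)
  have "bounded ((\<lambda>z. tderiv F (snd z) (fst z)) ` (UNIV \<times> cball t \<delta>))"
    by (intro compact_imp_bounded compact_continuous_image compact_Times compactM compact_cball
        continuous_on_subset[OF evol_continuous[OF evol_tderiv[OF F]]]) (use \<delta>(2) in auto)
  then obtain M where "\<forall>z\<in>UNIV \<times> cball t \<delta>. \<bar>tderiv F (snd z) (fst z)\<bar> \<le> M"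
    unfolding bounded_iff by auto
  then have M: "\<bar>tderiv F s p\<bar> \<le> M" if "s \<in> cball t \<delta>" for s p using that by fastforce
  show ?thesis
  proof (rule has_real_derivative_integral_bounded[OF finite_measure_nu \<delta>(1)])
    show "integrable \<nu> (F s)" if "\<bar>s - t\<bar> < \<delta>" for s
      by (intro integrable_continuous smoothM_continuous evol_smoothM F sJ that)
    show "((\<lambda>s. F s p) has_real_derivative tderiv F s p) (at s)" if "\<bar>s - t\<bar> < \<delta>" for s p
      by (intro evol_has_derivative F sJ that)
    show "\<bar>tderiv F s p\<bar> \<le> M" if "\<bar>s - t\<bar> < \<delta>" for s p
      using that by (intro M) (simp add: dist_real_def abs_minus_commute)
    show "tderiv F t \<in> borel_measurable \<nu>"
      by (intro borel_continuous smoothM_continuous evol_smoothM evol_tderiv F t)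
  qed
qed

end

section \<open>Entropy along the flow\<close>

text \<open>\<open>H\<close> is stripped of rank-one pieces by symmetric Gaussian elimination, and
  each piece contributes a nonnegative value of the form of \<open>M\<close>. Counting nonzero
  diagonal entries gives the induction, and no spectral theorem is involved.\<close>

lemma psd_trace_nonneg:
  fixes H M :: "real ^ 'n ^ 'n"
  assumes "transpose H = H" "\<And>w. w \<bullet> (H *v w) \<ge> 0" and M: "\<And>w. w \<bullet> (M *v w) \<ge> 0"
  shows "(\<Sum>j l. H $ j $ l * M $ j $ l) \<ge> 0"
  using assms(1,2)
proof (induction "card {j. H $ j $ j \<noteq> 0}" arbitrary: H rule: less_induct)
  case less
  have diag: "axis i 1 \<bullet> (K *v axis j 1) = K $ i $ j" for K :: "real ^ 'n ^ 'n" and i j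
    by (simp add: matrix_vector_mult_basis column_def inner_axis' )
  have sym: "H $ i $ j = H $ j $ i" for i j
    using arg_cong[OF less.prems(1), of "\<lambda>M. M $ j $ i"] by (simp add: transpose_def)
  have swap: "x \<bullet> (H *v y) = y \<bullet> (H *v x)" for x y
    by (metis dot_lmul_matrix inner_commute less.prems(1) transpose_matrix_vector)
  show ?case
  proof (cases "\<forall>i. H $ i $ i = 0")
    case True
    \<comment> \<open>With a zero diagonal the form at
      \<open>axis i 1 + s *\<^sub>R axis j 1\<close> is linear in \<open>s\<close>; being
      nonnegative for \<open>s = 1\<close> and for \<open>s = -1\<close> forces the entry to
      vanish.\<close>
    have "H $ i $ j = 0" for i j
    proof -
      have "0 \<le> (axis i 1 + s *\<^sub>R axis j 1) \<bullet> (H *v (axis i 1 + s *\<^sub>R axis j 1))" for s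
        by (rule less.prems(2))
      then have "0 \<le> 2 * s * H $ i $ j" for s
        using True by (simp add: matrix_vector_right_distrib inner_add_left inner_add_right matrix_vector_mult_scaleR diag sym[of j i])
      from this[of 1] this[of "-1"] show ?thesis by simp
    qed
    then show ?thesis by simp
  next
    case False
    then obtain i where i: "H $ i $ i \<noteq> 0" by blast
    define c where "c = H *v axis i 1"
    define d where "d = H $ i $ i"
    have d: "d > 0" using less.prems(2)[of "axis i 1"] i by (simp add: diag d_def)
    have cj: "c $ j = H $ j $ i" for j by (simp add: c_def matrix_vector_mult_basis column_def)
    \<comment> \<open>The subtracted rank-one matrix clears row and column \<open>i\<close>, since
      \<open>c $ i = d\<close>.\<close>
    define K where "K = (\<chi> j l. H $ j $ l - c $ j * c $ l / d)"
    have Kw: "w \<bullet> (K *v w) = w \<bullet> (H *v w) - (c \<bullet> w)\<^sup>2 / d" for w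
    proof -
      have "K *v w = H *v w - ((c \<bullet> w) / d) *\<^sub>R c"
        by (simp add: K_def vec_eq_iff matrix_vector_mult_def left_diff_distrib right_diff_distrib sum_subtractf inner_vec_def
            sum_divide_distrib sum_distrib_right sum_distrib_left mult_ac)
      then show ?thesis by (simp add: inner_diff_right inner_commute power2_eq_square)
    qed
    have Kpsd: "w \<bullet> (K *v w) \<ge> 0" for w
    proof -
      \<comment> \<open>This \<open>s\<close> minimises the form of \<open>H\<close> over the line
        through \<open>w\<close> in direction \<open>axis i 1\<close>, and the minimum is the value
        of the form of \<open>K\<close> at \<open>w\<close>.\<close>
      define s where "s = (c \<bullet> w) / d"
      have "0 \<le> (w - s *\<^sub>R axis i 1) \<bullet> (H *v (w - s *\<^sub>R axis i 1))" by (rule less.prems(2))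
      also have "\<dots> = w \<bullet> (H *v w) - 2 * s * (c \<bullet> w) + s * s * d"
        using swap[of "axis i 1" w]
        by (simp add: matrix_vector_mult_diff_distrib matrix_vector_mult_scaleR inner_diff_left inner_diff_right
            diag d_def flip: c_def) (simp add: inner_axis cj inner_commute algebra_simps)
      also have "\<dots> = w \<bullet> (K *v w)" using d by (simp add: Kw s_def field_simps power2_eq_square)
      finally show ?thesis .
    qed
    \<comment> \<open>The diagonal of \<open>K\<close> is nonnegative and nowhere above that of
      \<open>H\<close>, so zero entries stay zero while entry \<open>i\<close> is new among them;
      hence the measure drops.\<close>
    have Kd: "K $ j $ j = 0" if "H $ j $ j = 0" for j
    proof -
      have "K $ j $ j \<ge> 0" using Kpsd[of "axis j 1"] by (simp add: diag)
      moreover have "K $ j $ j = - ((c $ j)\<^sup>2 / d)" using that by (simp add: K_def power2_eq_square)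
      moreover have "(c $ j)\<^sup>2 / d \<ge> 0" using d by simp
      ultimately show ?thesis by linarith
    qed
    have "K $ i $ i = 0" using d by (simp add: K_def cj d_def)
    then have "{j. K $ j $ j \<noteq> 0} \<subset> {j. H $ j $ j \<noteq> 0}" using Kd i by blast
    then have "card {j. K $ j $ j \<noteq> 0} < card {j. H $ j $ j \<noteq> 0}" by (intro psubset_card_mono) auto
    moreover have "transpose K = K" by (simp add: K_def transpose_def vec_eq_iff sym mult.commute)
    ultimately have "0 \<le> (\<Sum>j l. K $ j $ l * M $ j $ l)" using less.hyps Kpsd by blast
    moreover have "(\<Sum>j l. H $ j $ l * M $ j $ l) =
        (\<Sum>j l. K $ j $ l * M $ j $ l) + (c \<bullet> (M *v c)) / d"
      by (simp add: K_def left_diff_distrib right_diff_distrib sum_subtractf inner_vec_def matrix_vector_mult_def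
          sum_distrib_left sum_divide_distrib mult_ac)
    moreover have "(c \<bullet> (M *v c)) / d \<ge> 0" using M d by simp
    ultimately show ?thesis by linarith
  qed
qed

context riem
begin

text \<open>The norm is the contraction of the inverse metric \<open>h\<close> with the matrix
  \<open>transpose S ** h ** S\<close>, and both are positive semidefinite, also when
  \<open>S\<close> is not symmetric.\<close>

lemma tensor_norm_sq_nonneg: "tensor_norm_sq A g S p \<ge> 0"
proof -
  let ?k = "chart_at A p"
  interpret metric_chart ?k g by (rule metric_chartI[OF chart_at(1)])
  let ?h = "matrix_inv (g ?k p)" and ?S = "S ?k p"
  let ?M = "transpose ?S ** ?h ** ?S"
  have hpsd: "w \<bullet> (?h *v w) \<ge> 0" for w
  proof -
    have "w = g ?k p *v (?h *v w)" using g_inv(1)[OF chart_at(2)] by (simp add: matrix_vector_mul_assoc)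
    then have "w \<bullet> (?h *v w) = (?h *v w) \<bullet> (g ?k p *v (?h *v w))" using inner_commute by metis
    also have "\<dots> \<ge> 0" using g_pos[OF chart_at(2), of "?h *v w"] by (cases "?h *v w = 0") auto
    finally show ?thesis .
  qed
  have "w \<bullet> (?M *v w) = (?S *v w) \<bullet> (?h *v (?S *v w))" for w
  proof -
    have "?M *v w = transpose ?S *v (?h *v (?S *v w))" by (simp add: matrix_vector_mul_assoc matrix_mul_assoc)
    then have "w \<bullet> (?M *v w) = ((?h *v (?S *v w)) v* ?S) \<bullet> w"
      by (simp add: transpose_matrix_vector inner_commute)
    then show ?thesis unfolding dot_lmul_matrix by (rule trans[OF _ inner_commute])
  qed
  then have "0 \<le> (\<Sum>j l. ?h $ j $ l * ?M $ j $ l)"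
    by (intro psd_trace_nonneg h_transpose chart_at) (simp_all add: hpsd)
  also have "\<dots> = (\<Sum>j l. \<Sum>k i. ?h $ i $ k * ?h $ j $ l * ?S $ i $ j * ?S $ k $ l)"
    by (simp add: matrix_matrix_mult_def transpose_def sum_distrib_left sum_distrib_right) (simp add: mult_ac)
  also have "\<dots> = (\<Sum>j i. \<Sum>k l. ?h $ i $ k * ?h $ j $ l * ?S $ i $ j * ?S $ k $ l)"
  proof (rule sum.cong[OF refl])
    fix j
    let ?F = "\<lambda>i k l. ?h $ i $ k * ?h $ j $ l * ?S $ i $ j * ?S $ k $ l"
    have "(\<Sum>l k i. ?F i k l) = (\<Sum>l i k. ?F i k l)"
      by (rule sum.cong[OF refl], rule sum.swap)
    also have "\<dots> = (\<Sum>i l k. ?F i k l)" by (rule sum.swap)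
    also have "\<dots> = (\<Sum>i k l. ?F i k l)"
      by (rule sum.cong[OF refl], rule sum.swap)
    finally show "(\<Sum>l k i. ?F i k l) = (\<Sum>i k l. ?F i k l)" .
  qed
  also have "\<dots> = tensor_norm_sq A g S p"
    unfolding tensor_norm_sq_def Let_def by (rule sum.swap)
  finally show ?thesis .
qed

lemma vinner_nonneg: "nonneg_tensor A R \<Longrightarrow> vinner A R X X p \<ge> 0"
proof -
  assume "nonneg_tensor A R"
  then have "X (chart_at A p) p \<bullet> (R (chart_at A p) p *v X (chart_at A p) p) \<ge> 0"
    using chart_at unfolding nonneg_tensor_def by blast
  also have "X (chart_at A p) p \<bullet> (R (chart_at A p) p *v X (chart_at A p) p) = vinner A R X X p"
    by (simp add: vinner_def Let_def inner_vec_def matrix_vector_mult_def sum_distrib_left mult_ac)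
  finally show ?thesis .
qed

end

section \<open>First and second derivative of the entropy along the flow\<close>

locale wasserstein_flow = riem_evolution A g \<nu> J
  for A :: "('m::t2_space, 'n::finite) chart set" and g \<nu> J +
  fixes c :: real and \<rho> \<phi> :: "real \<Rightarrow> 'm \<Rightarrow> real"
  assumes evr: "evol \<rho>" and evp: "evol \<phi>" and pos: "t \<in> J \<Longrightarrow> \<rho> t p > 0"
    and cont: "t \<in> J \<Longrightarrow> tderiv \<rho> t p = - (gamma (\<rho> t) (\<phi> t) p + \<rho> t p * lap (\<phi> t) p)"
    and hj: "t \<in> J \<Longrightarrow> tderiv \<phi> t p = - 1 * (1 / 2 * gamma (\<phi> t) (\<phi> t) p) + (- 1 / c\<^sup>2) * (\<phi> t p + (ln (\<rho> t p) + 1))"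
begin

lemma smooth_rho: "t \<in> J \<Longrightarrow> smoothM (\<rho> t)" by (rule evol_smoothM[OF evr])
lemma smooth_phi: "t \<in> J \<Longrightarrow> smoothM (\<phi> t)" by (rule evol_smoothM[OF evp])

lemmas smoothM_intros = smoothM_const smoothM_add smoothM_mult smoothM_gamma smoothM_lap smoothM_hess_norm smooth_rho smooth_phi

lemma integrable_smoothM: "smoothM f \<Longrightarrow> integrable \<nu> f"
  by (intro integrable_continuous smoothM_continuous)

lemma integral_rho_lap:
  assumes t: "t \<in> J"
  shows "(\<integral>p. \<rho> t p * lap (\<phi> t) p \<partial>\<nu>) = - (\<integral>p. gamma (\<rho> t) (\<phi> t) p \<partial>\<nu>)"
  by (rule ibp[OF smoothM_C1M[OF smooth_rho[OF t]] smooth_phi[OF t]])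

lemma entropy_derivative:
  assumes t: "t \<in> J"
  shows "((\<lambda>s. Ent \<nu> (\<rho> s)) has_real_derivative (\<integral>p. gamma (\<rho> t) (\<phi> t) p \<partial>\<nu>)) (at t)"
proof -
  have ev: "evol (\<lambda>t p. \<rho> t p * ln (\<rho> t p))" by (intro evol_mult evol_ln evr pos)
  have Sln: "smoothM (\<lambda>p. ln (\<rho> t p))" by (intro smoothM_ln smooth_rho pos t)
  \<comment> \<open>Chosen so that the Laplacian term of the continuity equation becomes
    \<open>?h\<close> times the Laplacian. Integrating it by parts cancels the other term, and what
    is left is \<open>\<rho>\<close> times the product of the gradients of \<open>ln \<rho>\<close>
    and \<open>\<phi>\<close>, which no longer contains a logarithm.\<close>
  let ?h = "\<lambda>p. (ln (\<rho> t p) + 1) * \<rho> t p"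
  have Sh: "smoothM ?h" by (intro smoothM_intros Sln t)
  have td: "tderiv (\<lambda>t p. \<rho> t p * ln (\<rho> t p)) t p = - (?h p * lap (\<phi> t) p) - (ln (\<rho> t p) + 1) * gamma (\<rho> t) (\<phi> t) p" for p
  proof -
    have r: "((\<lambda>s. \<rho> s p) has_real_derivative tderiv \<rho> t p) (at t)" by (rule evol_has_derivative[OF evr t])
    have "((\<lambda>s. \<rho> s p * ln (\<rho> s p)) has_real_derivative (ln (\<rho> t p) + 1) * tderiv \<rho> t p) (at t)"
      using pos[OF t, of p] by (auto intro!: derivative_eq_intros r simp: field_simps)
    then have "tderiv (\<lambda>t p. \<rho> t p * ln (\<rho> t p)) t p = (ln (\<rho> t p) + 1) * tderiv \<rho> t p" by (rule DERIV_imp_deriv)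
    then show ?thesis by (simp add: cont[OF t] algebra_simps)
  qed
  have Gh: "gamma ?h (\<phi> t) p = (ln (\<rho> t p) + 1) * gamma (\<rho> t) (\<phi> t) p + gamma (\<rho> t) (\<phi> t) p" for p
  proof -
    have "gamma ?h (\<phi> t) p = (ln (\<rho> t p) + 1) * gamma (\<rho> t) (\<phi> t) p + \<rho> t p * gamma (\<lambda>q. ln (\<rho> t q) + 1) (\<phi> t) p"
      by (rule gamma_mult) (intro smoothM_cdiffM smoothM_intros Sln t)+
    also have "gamma (\<lambda>q. ln (\<rho> t q) + 1) (\<phi> t) p = gamma (\<rho> t) (\<phi> t) p / \<rho> t p"
      using gamma_add[OF smoothM_cdiffM[OF Sln] smoothM_cdiffM[OF smoothM_const], of 1] gamma_const
        gamma_ln[OF smoothM_cdiffM[OF smooth_rho[OF t]] pos[OF t]] by simp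
    finally show ?thesis using pos[OF t, of p] by simp
  qed
  have i1: "integrable \<nu> (\<lambda>p. ?h p * lap (\<phi> t) p)" and i2: "integrable \<nu> (\<lambda>p. (ln (\<rho> t p) + 1) * gamma (\<rho> t) (\<phi> t) p)"
    and i3: "integrable \<nu> (\<lambda>p. gamma (\<rho> t) (\<phi> t) p)"
    by (intro integrable_smoothM smoothM_intros Sln t)+
  have "(\<integral>p. tderiv (\<lambda>t p. \<rho> t p * ln (\<rho> t p)) t p \<partial>\<nu>) = - (\<integral>p. ?h p * lap (\<phi> t) p \<partial>\<nu>) - (\<integral>p. (ln (\<rho> t p) + 1) * gamma (\<rho> t) (\<phi> t) p \<partial>\<nu>)"
    unfolding td using i1 i2 by simp
  also have "(\<integral>p. ?h p * lap (\<phi> t) p \<partial>\<nu>) = - (\<integral>p. gamma ?h (\<phi> t) p \<partial>\<nu>)"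
    by (rule ibp[OF smoothM_C1M[OF Sh] smooth_phi[OF t]])
  also have "(\<integral>p. gamma ?h (\<phi> t) p \<partial>\<nu>) = (\<integral>p. (ln (\<rho> t p) + 1) * gamma (\<rho> t) (\<phi> t) p \<partial>\<nu>) + (\<integral>p. gamma (\<rho> t) (\<phi> t) p \<partial>\<nu>)"
    unfolding Gh using i2 i3 by simp
  finally have "(\<integral>p. tderiv (\<lambda>t p. \<rho> t p * ln (\<rho> t p)) t p \<partial>\<nu>) = (\<integral>p. gamma (\<rho> t) (\<phi> t) p \<partial>\<nu>)" by simp
  then show ?thesis using integral_has_derivative[OF ev t] by (simp add: Ent_def[abs_def])
qed

lemma entropy_second_derivative:
  assumes t: "t \<in> J"
  shows "deriv (deriv (\<lambda>s. Ent \<nu> (\<rho> s))) t =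
    (\<integral>p. hess_norm (\<phi> t) p * \<rho> t p \<partial>\<nu>) + (\<integral>p. vinner A (ricci g) (grad g (\<phi> t)) (grad g (\<phi> t)) p * \<rho> t p \<partial>\<nu>)
    - 1 / c\<^sup>2 * ((\<integral>p. gamma (\<rho> t) (\<phi> t) p \<partial>\<nu>) + (\<integral>p. gamma (\<rho> t) (\<rho> t) p / \<rho> t p \<partial>\<nu>))"
    and "integrable \<nu> (\<lambda>p. vinner A (ricci g) (grad g (\<phi> t)) (grad g (\<phi> t)) p * \<rho> t p)"
proof -
  note S = smooth_rho[OF t] smooth_phi[OF t]
  have Sln: "smoothM (\<lambda>p. ln (\<rho> t p))" by (intro smoothM_ln smooth_rho pos t)
  let ?q = "\<lambda>p. 1 / 2 * gamma (\<phi> t) (\<phi> t) p"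
  let ?L = "lap (\<phi> t)"
  have Sq: "smoothM ?q" by (intro smoothM_intros t)
  have "((\<lambda>s. \<integral>p. gamma (\<rho> s) (\<phi> s) p \<partial>\<nu>) has_real_derivative (\<integral>p. tderiv (\<lambda>t. gamma (\<rho> t) (\<phi> t)) t p \<partial>\<nu>)) (at t)"
    by (rule integral_has_derivative[OF evol_gamma[OF evr evp] t])
  then have "(deriv (\<lambda>s. Ent \<nu> (\<rho> s)) has_real_derivative (\<integral>p. tderiv (\<lambda>t. gamma (\<rho> t) (\<phi> t)) t p \<partial>\<nu>)) (at t)"
    by (rule has_field_derivative_transform_within_open[OF _ J t]) (simp add: DERIV_imp_deriv[OF entropy_derivative])
  then have 1: "deriv (deriv (\<lambda>s. Ent \<nu> (\<rho> s))) t = (\<integral>p. tderiv (\<lambda>t. gamma (\<rho> t) (\<phi> t)) t p \<partial>\<nu>)"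
    by (rule DERIV_imp_deriv)
  have St: "smoothM (tderiv \<rho> t)" "smoothM (tderiv \<phi> t)" by (intro evol_smoothM evol_tderiv evr evp t)+
  have 2: "(\<integral>p. tderiv (\<lambda>t. gamma (\<rho> t) (\<phi> t)) t p \<partial>\<nu>) =
      (\<integral>p. gamma (tderiv \<rho> t) (\<phi> t) p \<partial>\<nu>) + (\<integral>p. gamma (\<rho> t) (tderiv \<phi> t) p \<partial>\<nu>)"
    unfolding tderiv_gamma[OF evr evp t]
    by (rule Bochner_Integration.integral_add) (intro integrable_smoothM smoothM_gamma St S)+
  \<comment> \<open>One integration by parts frees the time derivative of \<open>\<rho>\<close>, so
    that the continuity equation can be inserted. A second one, on the term quadratic in the
    Laplacian, cancels the mixed product.\<close>
  have 3: "(\<integral>p. gamma (tderiv \<rho> t) (\<phi> t) p \<partial>\<nu>) = - (\<integral>p. \<rho> t p * gamma ?L (\<phi> t) p \<partial>\<nu>)"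
  proof -
    have "(\<integral>p. gamma (tderiv \<rho> t) (\<phi> t) p \<partial>\<nu>) = - (\<integral>p. tderiv \<rho> t p * ?L p \<partial>\<nu>)"
      using ibp[OF smoothM_C1M[OF St(1)] S(2)] by simp
    also have "\<dots> = (\<integral>p. ?L p * gamma (\<rho> t) (\<phi> t) p + (\<rho> t p * ?L p) * ?L p \<partial>\<nu>)"
      unfolding cont[OF t] by (subst integral_minus[symmetric]) (simp add: algebra_simps)
    also have "\<dots> = (\<integral>p. ?L p * gamma (\<rho> t) (\<phi> t) p \<partial>\<nu>) + (\<integral>p. (\<rho> t p * ?L p) * ?L p \<partial>\<nu>)"
      by (rule Bochner_Integration.integral_add) (intro integrable_smoothM smoothM_intros t)+
    also have "(\<integral>p. (\<rho> t p * ?L p) * ?L p \<partial>\<nu>) = - (\<integral>p. gamma (\<lambda>p. \<rho> t p * ?L p) (\<phi> t) p \<partial>\<nu>)"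
      by (rule ibp[OF smoothM_C1M S(2)]) (intro smoothM_intros t)
    also have "(\<integral>p. gamma (\<lambda>p. \<rho> t p * ?L p) (\<phi> t) p \<partial>\<nu>) = (\<integral>p. \<rho> t p * gamma ?L (\<phi> t) p + ?L p * gamma (\<rho> t) (\<phi> t) p \<partial>\<nu>)"
      by (simp only: gamma_mult[OF smoothM_cdiffM[OF S(1)] smoothM_cdiffM[OF smoothM_lap[OF S(2)]]])
    also have "\<dots> = (\<integral>p. \<rho> t p * gamma ?L (\<phi> t) p \<partial>\<nu>) + (\<integral>p. ?L p * gamma (\<rho> t) (\<phi> t) p \<partial>\<nu>)"
      by (rule Bochner_Integration.integral_add) (intro integrable_smoothM smoothM_intros t)+
    finally show ?thesis by simp
  qed
  \<comment> \<open>The logarithm in the Hamilton-Jacobi equation is the source of the Fisher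
    information \<open>|\<nabla>\<rho>|^2 / \<rho>\<close>.\<close>
  have G: "gamma (\<rho> t) (tderiv \<phi> t) p = - gamma (\<rho> t) ?q p - 1 / c\<^sup>2 * (gamma (\<rho> t) (\<phi> t) p + gamma (\<rho> t) (\<rho> t) p / \<rho> t p)" for p
  proof -
    note cd = smoothM_cdiffM
    have e: "tderiv \<phi> t = (\<lambda>p. - 1 * ?q p + (- 1 / c\<^sup>2) * (\<phi> t p + (ln (\<rho> t p) + 1)))"
      using hj[OF t] by (rule ext)
    have "gamma (tderiv \<phi> t) (\<rho> t) p = gamma (\<lambda>p. - 1 * ?q p) (\<rho> t) p + gamma (\<lambda>p. (- 1 / c\<^sup>2) * (\<phi> t p + (ln (\<rho> t p) + 1))) (\<rho> t) p"
      unfolding e by (rule gamma_add) (intro cd smoothM_intros Sln t)+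
    also have "gamma (\<lambda>p. - 1 * ?q p) (\<rho> t) p = - 1 * gamma ?q (\<rho> t) p"
      by (rule gamma_cmult[OF cd[OF Sq]])
    also have "gamma (\<lambda>p. (- 1 / c\<^sup>2) * (\<phi> t p + (ln (\<rho> t p) + 1))) (\<rho> t) p = (- 1 / c\<^sup>2) * gamma (\<lambda>p. \<phi> t p + (ln (\<rho> t p) + 1)) (\<rho> t) p"
      by (rule gamma_cmult) (intro cd smoothM_intros Sln t)
    also have "gamma (\<lambda>p. \<phi> t p + (ln (\<rho> t p) + 1)) (\<rho> t) p = gamma (\<phi> t) (\<rho> t) p + gamma (\<lambda>p. ln (\<rho> t p) + 1) (\<rho> t) p"
      by (rule gamma_add) (intro cd smoothM_intros Sln t)+
    also have "gamma (\<lambda>p. ln (\<rho> t p) + 1) (\<rho> t) p = gamma (\<rho> t) (\<rho> t) p / \<rho> t p"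
      using gamma_add[OF cd[OF Sln] cd[OF smoothM_const], of 1] gamma_const gamma_ln[OF cd[OF S(1)] pos[OF t]] by simp
    finally show ?thesis
      unfolding gamma_sym[of "tderiv \<phi> t" "\<rho> t" p] gamma_sym[of ?q "\<rho> t" p] gamma_sym[of "\<phi> t" "\<rho> t" p] by simp
  qed
  have Sdiv: "integrable \<nu> (\<lambda>p. gamma (\<rho> t) (\<rho> t) p / \<rho> t p)"
    by (intro integrable_continuous continuous_on_divide smoothM_continuous smoothM_gamma S) (use pos[OF t] in \<open>force simp: less_le\<close>)
  have 4: "(\<integral>p. gamma (\<rho> t) (tderiv \<phi> t) p \<partial>\<nu>) = (\<integral>p. \<rho> t p * lap ?q p \<partial>\<nu>)
      - 1 / c\<^sup>2 * ((\<integral>p. gamma (\<rho> t) (\<phi> t) p \<partial>\<nu>) + (\<integral>p. gamma (\<rho> t) (\<rho> t) p / \<rho> t p \<partial>\<nu>))"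
  proof -
    have i1: "integrable \<nu> (\<lambda>p. gamma (\<rho> t) ?q p)" and i2: "integrable \<nu> (\<lambda>p. gamma (\<rho> t) (\<phi> t) p)"
      by (intro integrable_smoothM smoothM_gamma S Sq)+
    have "(\<integral>p. gamma (\<rho> t) (tderiv \<phi> t) p \<partial>\<nu>) = - (\<integral>p. gamma (\<rho> t) ?q p \<partial>\<nu>)
        - 1 / c\<^sup>2 * ((\<integral>p. gamma (\<rho> t) (\<phi> t) p \<partial>\<nu>) + (\<integral>p. gamma (\<rho> t) (\<rho> t) p / \<rho> t p \<partial>\<nu>))"
      unfolding G using i1 i2 Sdiv by simp
    then show ?thesis using ibp[OF smoothM_C1M[OF S(1)] Sq] by simp
  qed
  let ?R = "\<lambda>p. vinner A (ricci g) (grad g (\<phi> t)) (grad g (\<phi> t)) p"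
  \<comment> \<open>Bochner's formula solved for the Ricci term: a combination of smooth functions
    on a compact manifold, hence integrable.\<close>
  have B: "?R p * \<rho> t p = \<rho> t p * lap ?q p - \<rho> t p * gamma ?L (\<phi> t) p - hess_norm (\<phi> t) p * \<rho> t p" for p
    using bochnerM[OF S(2), of p] by (simp add: algebra_simps)
  have i: "integrable \<nu> (\<lambda>p. \<rho> t p * lap ?q p)" "integrable \<nu> (\<lambda>p. \<rho> t p * gamma ?L (\<phi> t) p)" "integrable \<nu> (\<lambda>p. hess_norm (\<phi> t) p * \<rho> t p)"
    by (intro integrable_smoothM smoothM_intros Sq t)+
  show "integrable \<nu> (\<lambda>p. ?R p * \<rho> t p)" unfolding B using i by simp
  have "(\<integral>p. ?R p * \<rho> t p \<partial>\<nu>) = (\<integral>p. \<rho> t p * lap ?q p \<partial>\<nu>) - (\<integral>p. \<rho> t p * gamma ?L (\<phi> t) p \<partial>\<nu>) - (\<integral>p. hess_norm (\<phi> t) p * \<rho> t p \<partial>\<nu>)"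
    unfolding B using i by simp
  then show "deriv (deriv (\<lambda>s. Ent \<nu> (\<rho> s))) t =
    (\<integral>p. hess_norm (\<phi> t) p * \<rho> t p \<partial>\<nu>) + (\<integral>p. ?R p * \<rho> t p \<partial>\<nu>)
    - 1 / c\<^sup>2 * ((\<integral>p. gamma (\<rho> t) (\<phi> t) p \<partial>\<nu>) + (\<integral>p. gamma (\<rho> t) (\<rho> t) p / \<rho> t p \<partial>\<nu>))"
    unfolding 1 2 3 4 by simp
qed

text \<open>An identity for every real \<open>a\<close>. The terms with \<open>1 / c\<^sup>2\<close>
  cancel those of the second derivative, \<open>2 * a\<close> times the first derivative is the
  cross term of the square, and unit mass turns the norm of \<open>a\<close> times the metric into
  the constant.\<close>

lemma W_entropy_rate:
  assumes t: "t \<in> J" and mass: "(\<integral>p. \<rho> t p \<partial>\<nu>) = 1"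
  shows "deriv (deriv (\<lambda>s. Ent \<nu> (\<rho> s))) t + (2 * a + 1 / c\<^sup>2) * deriv (\<lambda>s. Ent \<nu> (\<rho> s)) t
      + 1 / c\<^sup>2 * (\<integral>p. grad_sq A g (\<rho> t) p / \<rho> t p \<partial>\<nu>)
    = (\<integral>p. tensor_norm_sq A g (\<lambda>\<kappa> q. hess g (\<phi> t) \<kappa> q - a *\<^sub>R g \<kappa> q) p * \<rho> t p \<partial>\<nu>)
      + (\<integral>p. vinner A (ricci g) (grad g (\<phi> t)) (grad g (\<phi> t)) p * \<rho> t p \<partial>\<nu>) - a\<^sup>2 * real CARD('n)"
proof -
  have i: "integrable \<nu> (\<lambda>p. hess_norm (\<phi> t) p * \<rho> t p)" "integrable \<nu> (\<lambda>p. \<rho> t p * lap (\<phi> t) p)" "integrable \<nu> (\<rho> t)"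
    by (intro integrable_smoothM smoothM_intros t)+
  have "(\<integral>p. tensor_norm_sq A g (\<lambda>\<kappa> q. hess g (\<phi> t) \<kappa> q - a *\<^sub>R g \<kappa> q) p * \<rho> t p \<partial>\<nu>)
      = (\<integral>p. hess_norm (\<phi> t) p * \<rho> t p - 2 * a * (\<rho> t p * lap (\<phi> t) p) + a\<^sup>2 * real CARD('n) * \<rho> t p \<partial>\<nu>)"
    unfolding tensor_norm_sq_eq[OF smooth_phi[OF t]] by (simp add: algebra_simps)
  also have "\<dots> = (\<integral>p. hess_norm (\<phi> t) p * \<rho> t p \<partial>\<nu>) - 2 * a * (\<integral>p. \<rho> t p * lap (\<phi> t) p \<partial>\<nu>) + a\<^sup>2 * real CARD('n)"
    using i mass by simp
  finally show ?thesis
    unfolding entropy_second_derivative(1)[OF t] DERIV_imp_deriv[OF entropy_derivative[OF t]] integral_rho_lap[OF t] grad_sq_eq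
    by (simp add: algebra_simps)
qed

end

section \<open>The Gaussian reference density\<close>

context
  fixes a :: real assumes a: "a > 0"
begin

definition gauss :: "real ^ 'n::finite \<Rightarrow> real" where
  "gauss x = exp (- ((norm x)\<^sup>2 / (4 * a\<^sup>2))) / (4 * pi * a\<^sup>2) powr (real CARD('n) / 2)"

lemma gauss_pos: "gauss x > 0"
  using a by (simp add: gauss_def)

text \<open>Each coordinate is a centred normal variable of variance \<open>2 * a\<^sup>2\<close>,
  which gives the exponent \<open>(norm x)\<^sup>2 / (4 * a\<^sup>2)\<close>.\<close>

lemma gauss_prod: "gauss (x :: real ^ 'n::finite) = (\<Prod>b\<in>Basis. normal_density 0 (sqrt 2 * a) (x \<bullet> b))"
proof -
  have "(\<Prod>b\<in>Basis. normal_density 0 (sqrt 2 * a) (x \<bullet> b))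
      = (\<Prod>b\<in>(Basis :: (real ^ 'n) set). 1 / sqrt (4 * pi * a\<^sup>2)) * (\<Prod>b\<in>Basis. exp (- ((x \<bullet> b)\<^sup>2 / (4 * a\<^sup>2))))"
    unfolding prod.distrib[symmetric] by (rule prod.cong) (simp_all add: normal_density_def power_mult_distrib mult.commute)
  also have "(\<Prod>b\<in>(Basis :: (real ^ 'n) set). 1 / sqrt (4 * pi * a\<^sup>2)) = 1 / (4 * pi * a\<^sup>2) powr (real CARD('n) / 2)"
  proof -
    have "sqrt (4 * pi * a\<^sup>2) ^ CARD('n) = ((4 * pi * a\<^sup>2) powr (1 / 2)) powr real CARD('n)"
    proof -
      have "(4 * pi * a\<^sup>2) powr (1 / 2) = sqrt (4 * pi * a\<^sup>2)" by (rule powr_half_sqrt) simp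
      then show ?thesis using a by (simp add: powr_realpow)
    qed
    then show ?thesis by (simp add: powr_powr power_one_over[symmetric] power_divide)
  qed
  also have "(\<Prod>b\<in>Basis. exp (- ((x \<bullet> b)\<^sup>2 / (4 * a\<^sup>2)))) = exp (- ((norm x)\<^sup>2 / (4 * a\<^sup>2)))"
  proof -
    have "(norm x)\<^sup>2 = (\<Sum>b\<in>Basis. (x \<bullet> b)\<^sup>2)"
      unfolding power2_norm_eq_inner by (subst euclidean_inner) (simp add: power2_eq_square)
    then show ?thesis by (simp add: exp_sum[symmetric] sum_negf sum_divide_distrib)
  qed
  finally show ?thesis by (simp add: gauss_def)
qed

text \<open>One statement for the total mass, \<open>k = 0\<close>, and the second moment of a
  coordinate, \<open>k = 1\<close>. The power is absorbed into the single factor at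
  \<open>b0\<close>, so the integral still splits into one-dimensional ones, and nonnegativity
  avoids integrability questions.\<close>

lemma nn_integral_gauss_moment:
  assumes k: "k \<le> 1" and b0: "b0 \<in> Basis"
  shows "(\<integral>\<^sup>+x. ennreal ((x \<bullet> b0) ^ (2 * k) * gauss (x :: real ^ 'n::finite)) \<partial>lborel) = ennreal ((2 * a\<^sup>2) ^ k)"
proof -
  let ?nd = "normal_density 0 (sqrt 2 * a)"
  have s: "sqrt 2 * a > 0" using a by simp
  define f :: "real ^ 'n \<Rightarrow> real \<Rightarrow> real" where "f b y = (if b = b0 then ?nd y * y ^ (2 * k) else ?nd y)" for b y
  have nn: "f b y \<ge> 0" for b y by (simp add: f_def zero_le_even_power)
  have mom: "(\<integral>\<^sup>+y. ennreal (f b y) \<partial>lborel) = (if b = b0 then ennreal ((2 * a\<^sup>2) ^ k) else 1)" for b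
  proof (cases "b = b0")
    case True
    have "has_bochner_integral lborel (\<lambda>y. ?nd y * y ^ (2 * k)) ((2 * a\<^sup>2) ^ k)"
    proof -
      consider "k = 0" | "k = 1" using k by linarith
      then show ?thesis
      proof cases
        case 1
        then show ?thesis using normal_moment_even[OF s, of 0 0] by simp
      next
        case 2
        have v: "fact (2 * 1) / ((2 / (sqrt 2 * a)\<^sup>2) ^ 1 * fact 1) = 2 * a\<^sup>2"
          using a by (simp add: power_mult_distrib)
        show ?thesis using 2 normal_moment_even[OF s, of 0 1, unfolded v] by simp
      qed
    qed
    then have "(\<integral>\<^sup>+y. ennreal (?nd y * y ^ (2 * k)) \<partial>lborel) = ennreal ((2 * a\<^sup>2) ^ k)"
      by (subst nn_integral_eq_integral) (auto simp: has_bochner_integral_iff zero_le_even_power)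
    then show ?thesis using True by (simp add: f_def)
  next
    case False
    have "(\<integral>\<^sup>+y. ennreal (?nd y) \<partial>lborel) = 1"
      using s by (subst nn_integral_eq_integral) auto
    then show ?thesis using False by (simp add: f_def)
  qed
  have "(x \<bullet> b0) ^ (2 * k) * gauss x = (\<Prod>b\<in>Basis. f b (x \<bullet> b))" for x :: "real ^ 'n"
  proof -
    have "(\<Prod>b\<in>Basis. f b (x \<bullet> b)) = (\<Prod>b\<in>Basis. ?nd (x \<bullet> b) * (if b = b0 then (x \<bullet> b0) ^ (2 * k) else 1))"
      by (rule prod.cong) (auto simp: f_def)
    then show ?thesis using b0 by (simp add: gauss_prod prod.distrib mult.commute)
  qed
  then have "(\<integral>\<^sup>+x. ennreal ((x \<bullet> b0) ^ (2 * k) * gauss (x :: real ^ 'n)) \<partial>lborel)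
      = (\<integral>\<^sup>+x. (\<Prod>b\<in>Basis. ennreal (f b (x \<bullet> b))) \<partial>lborel)"
    by (simp add: prod_ennreal nn)
  also have "\<dots> = (\<Prod>b\<in>Basis. (\<integral>\<^sup>+y. ennreal (f b y) \<partial>lborel))"
    by (rule nn_integral_lborel_prod) (simp_all add: f_def)
  also have "\<dots> = ennreal ((2 * a\<^sup>2) ^ k)" using b0 by (simp add: mom)
  finally show ?thesis .
qed

lemma gauss_measurable: "(gauss :: real ^ 'n::finite \<Rightarrow> real) \<in> borel_measurable lborel"
  unfolding gauss_def[abs_def] by measurable

lemma gauss_moments:
  shows "has_bochner_integral lborel (gauss :: real ^ 'n::finite \<Rightarrow> real) 1"
    and "has_bochner_integral lborel (\<lambda>x :: real ^ 'n::finite. (norm x)\<^sup>2 * gauss x) (real CARD('n) * (2 * a\<^sup>2))"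
proof -
  obtain b0 :: "real ^ 'n" where b0: "b0 \<in> Basis" using nonempty_Basis by blast
  have hb: "has_bochner_integral lborel (\<lambda>x :: real ^ 'n. (x \<bullet> b) ^ (2 * k) * gauss x) ((2 * a\<^sup>2) ^ k)"
    if "k \<le> 1" "b \<in> Basis" for k b
  proof (rule has_bochner_integral_nn_integral)
    show "(\<lambda>x :: real ^ 'n. (x \<bullet> b) ^ (2 * k) * gauss x) \<in> borel_measurable lborel"
      using gauss_measurable by measurable
    show "AE x in lborel. 0 \<le> ((x :: real ^ 'n) \<bullet> b) ^ (2 * k) * gauss x"
      using gauss_pos by (intro always_eventually allI mult_nonneg_nonneg zero_le_even_power less_imp_le) auto
    show "(\<integral>\<^sup>+x. ennreal (((x :: real ^ 'n) \<bullet> b) ^ (2 * k) * gauss x) \<partial>lborel) = ennreal ((2 * a\<^sup>2) ^ k)"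
      by (rule nn_integral_gauss_moment[OF that])
  qed simp
  from hb[of 0 b0] b0 show "has_bochner_integral lborel (gauss :: real ^ 'n::finite \<Rightarrow> real) 1" by simp
  have "has_bochner_integral lborel (\<lambda>x :: real ^ 'n. \<Sum>b\<in>Basis. (x \<bullet> b) ^ (2 * 1) * gauss x) (\<Sum>b\<in>(Basis :: (real ^ 'n) set). (2 * a\<^sup>2) ^ 1)"
    by (intro has_bochner_integral_sum hb) auto
  moreover have "(\<Sum>b\<in>Basis. (x \<bullet> b) ^ (2 * 1) * gauss x) = (norm x)\<^sup>2 * gauss x" for x :: "real ^ 'n"
  proof -
    have "(norm x)\<^sup>2 = (\<Sum>b\<in>Basis. (x \<bullet> b)\<^sup>2)"
      unfolding power2_norm_eq_inner by (subst euclidean_inner) (simp add: power2_eq_square)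
    then show ?thesis by (simp add: sum_distrib_right)
  qed
  ultimately show "has_bochner_integral lborel (\<lambda>x :: real ^ 'n::finite. (norm x)\<^sup>2 * gauss x) (real CARD('n) * (2 * a\<^sup>2))"
    by simp
qed

text \<open>The logarithm of the density is a constant plus a multiple of the squared norm, so mass
  and second moment determine the entropy.\<close>

lemma Ent_gauss:
  "Ent lborel (gauss :: real ^ 'n::finite \<Rightarrow> real) = - real CARD('n) / 2 - real CARD('n) / 2 * ln (4 * pi * a\<^sup>2)"
proof -
  have ln: "gauss x * ln (gauss x) = - (1 / (4 * a\<^sup>2)) * ((norm x)\<^sup>2 * gauss x) - (real CARD('n) / 2 * ln (4 * pi * a\<^sup>2)) * gauss x"
    for x :: "real ^ 'n"
  proof -
    have l: "ln (gauss x) = - ((norm x)\<^sup>2 / (4 * a\<^sup>2)) - real CARD('n) / 2 * ln (4 * pi * a\<^sup>2)"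
      using a unfolding gauss_def by (subst ln_div) (auto simp: ln_powr)
    show ?thesis unfolding l by (simp add: algebra_simps)
  qed
  have m: "integrable lborel (gauss :: real ^ 'n \<Rightarrow> real)" "integral\<^sup>L lborel (gauss :: real ^ 'n \<Rightarrow> real) = 1"
    "integrable lborel (\<lambda>x :: real ^ 'n. (norm x)\<^sup>2 * gauss x)"
    "integral\<^sup>L lborel (\<lambda>x :: real ^ 'n. (norm x)\<^sup>2 * gauss x) = real CARD('n) * (2 * a\<^sup>2)"
    using gauss_moments[where 'n = 'n] by (auto simp: has_bochner_integral_iff)
  have "Ent lborel (gauss :: real ^ 'n \<Rightarrow> real) = - (1 / (4 * a\<^sup>2)) * (real CARD('n) * (2 * a\<^sup>2)) - (real CARD('n) / 2 * ln (4 * pi * a\<^sup>2)) * 1"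
    unfolding Ent_def ln by (subst Bochner_Integration.integral_diff) (use m in simp_all)
  then show ?thesis using a by (simp add: field_simps)
qed

section \<open>Fisher information of the Gaussian\<close>

lemma matrix_inv_mat1: "matrix_inv (mat 1 :: real ^ 'n ^ 'n) = mat 1"
proof -
  have "invertible (mat 1 :: real ^ 'n ^ 'n)" unfolding invertible_def by (intro exI[of _ "mat 1"]) simp
  from matrix_inv_right_left(1)[OF this] show ?thesis by simp
qed

lemma grad_sq_flat:
  "grad_sq euclidean_atlas flat_metric f p = (\<Sum>i. (frechet_derivative f (at p) (axis i 1))\<^sup>2)"
proof -
  have ch: "chart_at euclidean_atlas p = (UNIV, \<lambda>x. x)" unfolding chart_at_def euclidean_atlas_def by (rule some_equality) auto
  have pd: "pd (UNIV, \<lambda>x. x) i f p = frechet_derivative f (at p) (axis i 1)" for i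
  proof -
    have "inv (\<lambda>x :: real ^ 'a. x) = (\<lambda>x. x)" using inv_id by (simp add: id_def)
    then show ?thesis by (simp add: pd_def)
  qed
  show ?thesis
    unfolding grad_sq_def vinner_def Let_def ch grad_def flat_metric_def matrix_inv_mat1
    by (simp add: mat_def pd if_distrib[of "\<lambda>x. x * _"] power2_eq_square cong: if_cong)
qed

text \<open>The gradient is \<open>- x / (2 * a\<^sup>2)\<close> times the density, so the integrand
  is the squared norm times the density over \<open>4 * a ^ 4\<close>; the second moment
  \<open>2 * a\<^sup>2\<close> per coordinate does the rest.\<close>

lemma gauss_fisher:
  "(\<integral>x. grad_sq euclidean_atlas flat_metric gauss x / gauss (x :: real ^ 'n::finite) \<partial>lborel) = real CARD('n) / (2 * a\<^sup>2)"
proof -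
  have fd: "frechet_derivative gauss (at x) (axis i 1) = - (x $ i / (2 * a\<^sup>2)) * gauss x" for x :: "real ^ 'n" and i
  proof -
    define k where "k = 1 / (4 * a\<^sup>2)"
    define C where "C = 1 / (4 * pi * a\<^sup>2) powr (real CARD('n) / 2)"
    have g: "gauss = (\<lambda>x :: real ^ 'n. exp (- (k * (x \<bullet> x))) * C)"
      by (rule ext) (simp add: gauss_def power2_norm_eq_inner k_def C_def)
    have "((\<lambda>x :: real ^ 'n. exp (- (k * (x \<bullet> x))) * C) has_derivative
        (\<lambda>v. exp (- (k * (x \<bullet> x))) * - (k * (x \<bullet> v + v \<bullet> x)) * C)) (at x)"
      by (auto intro!: derivative_eq_intros)
    from frechet_derivative_at[OF this, symmetric]
    have "frechet_derivative (\<lambda>x :: real ^ 'n. exp (- (k * (x \<bullet> x))) * C) (at x) (axis i 1)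
        = exp (- (k * (x \<bullet> x))) * - (k * (2 * x $ i)) * C"
      by (simp add: inner_axis inner_axis')
    also have "k * (2 * x $ i) = x $ i / (2 * a\<^sup>2)" by (simp add: k_def)
    finally show ?thesis unfolding g by simp
  qed
  have "grad_sq euclidean_atlas flat_metric gauss x / gauss x = (1 / (4 * a ^ 4)) * ((norm x)\<^sup>2 * gauss x)" for x :: "real ^ 'n"
  proof -
    have "grad_sq euclidean_atlas flat_metric gauss x = (\<Sum>i. (x $ i)\<^sup>2) * (gauss x / (2 * a\<^sup>2))\<^sup>2"
      unfolding grad_sq_flat fd by (simp add: sum_distrib_right sum_divide_distrib power_mult_distrib power_divide)
    also have "(\<Sum>i. (x $ i)\<^sup>2) = (norm x)\<^sup>2"
      unfolding power2_norm_eq_inner by (simp add: inner_vec_def power2_eq_square)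
    also have "(gauss x / (2 * a\<^sup>2))\<^sup>2 = gauss x * gauss x * (1 / (4 * a ^ 4))"
      by (simp add: power_divide power_mult_distrib power2_eq_square[of "gauss x"] flip: power_mult)
    finally show ?thesis using gauss_pos[of x] by simp
  qed
  then have "(\<integral>x. grad_sq euclidean_atlas flat_metric gauss x / gauss (x :: real ^ 'n) \<partial>lborel)
     = (1 / (4 * a ^ 4)) * (\<integral>x. (norm (x :: real ^ 'n))\<^sup>2 * gauss x \<partial>lborel)" by simp
  also have "(\<integral>x. (norm (x :: real ^ 'n))\<^sup>2 * gauss x \<partial>lborel) = real CARD('n) * (2 * a\<^sup>2)"
    using gauss_moments(2)[where 'n = 'n] by (simp add: has_bochner_integral_iff)
  finally show ?thesis by (simp add: power2_eq_square power4_eq_xxxx)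
qed

end

lemma reference_density_gauss: "u t > 0 \<Longrightarrow> reference_density u t = gauss (u t)"
  by (rule ext) (simp add: reference_density_def gauss_def)

section \<open>The W-entropy formula\<close>

lemma smooth_on_real_derivatives:
  fixes u :: "real \<Rightarrow> real"
  assumes J: "open J" and u: "smooth_on J u" and t: "t \<in> J"
  shows "(u has_real_derivative deriv u t) (at t)" "(deriv u has_real_derivative deriv (deriv u) t) (at t)"
proof -
  have d: "(f has_real_derivative frechet_derivative f (at s) 1) (at s)" if "smooth_on J f" "s \<in> J" for f :: "real \<Rightarrow> real" and s
    using frechet_derivative_line[of f 0 s 1] smooth_on_imp_differentiable[OF that] by simp
  have e: "frechet_derivative u (at s) 1 = deriv u s" if "s \<in> J" for s
    by (rule DERIV_imp_deriv[OF d[OF u that], symmetric])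
  show "(u has_real_derivative deriv u t) (at t)" using d[OF u t] by (simp add: e[OF t])
  have "smooth_on J (deriv u)"
    using smooth_on_cong[OF J, of "\<lambda>s. frechet_derivative u (at s) 1" "deriv u"] e smooth_on_frechet_derivative[OF u, of 1] by blast
  from d[OF this t] have "(deriv u has_real_derivative frechet_derivative (deriv u) (at t) 1) (at t)" .
  then show "(deriv u has_real_derivative deriv (deriv u) t) (at t)" using DERIV_imp_deriv by metis
qed

text \<open>With \<open>n = CARD('n)\<close> the entropy has first derivative \<open>- n * a\<close>
  and second derivative \<open>- n * (u'' / u - a\<^sup>2)\<close>. The equation for
  \<open>u\<close> splits \<open>u'' / u\<close> into one part cancelled by the Fisher information
  and one cancelled by the \<open>1 / c\<^sup>2\<close> multiple of the first derivative. What
  remains is \<open>n * a\<^sup>2 - 2 * n * a\<^sup>2\<close>.\<close>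

lemma reference_W_entropy_rate:
  fixes u :: "real \<Rightarrow> real"
  defines "E \<equiv> \<lambda>s. Ent lborel (reference_density u s :: real ^ 'n::finite \<Rightarrow> real)"
  assumes J: "open J" and u: "smooth_on J u" and pos: "\<And>t. t \<in> J \<Longrightarrow> u t > 0" and c: "c > 0"
    and ode: "\<And>t. t \<in> J \<Longrightarrow> c\<^sup>2 * deriv (deriv u) t + deriv u t = 1 / (2 * u t)"
    and t: "t \<in> J"
  defines "a \<equiv> deriv u t / u t"
  shows "deriv (deriv E) t + (2 * a + 1 / c\<^sup>2) * deriv E t
      + 1 / c\<^sup>2 * (\<integral>x. grad_sq euclidean_atlas flat_metric (reference_density u t) x / reference_density u t (x :: real ^ 'n) \<partial>lborel)
    = - (a\<^sup>2 * real CARD('n))"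
proof -
  let ?n = "real CARD('n)"
  note du = smooth_on_real_derivatives[OF J u]
  have E: "E s = - ?n / 2 - ?n / 2 * ln (4 * pi * (u s)\<^sup>2)" if "s \<in> J" for s
    unfolding E_def reference_density_gauss[of u, OF pos[OF that]] by (rule Ent_gauss[OF pos[OF that]])
  have dE: "(E has_real_derivative - ?n * (deriv u s / u s)) (at s)" if s: "s \<in> J" for s
  proof -
    have "((\<lambda>s. - ?n / 2 - ?n / 2 * ln (4 * pi * (u s)\<^sup>2)) has_real_derivative - ?n * (deriv u s / u s)) (at s)"
      using pos[OF s] by (auto intro!: derivative_eq_intros du(1)[OF s] simp: power2_eq_square)
    then show ?thesis by (rule has_field_derivative_transform_within_open[OF _ J s]) (simp add: E)
  qed
  have "((\<lambda>s. - ?n * (deriv u s / u s)) has_real_derivative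
      - ?n * ((deriv (deriv u) t * u t - deriv u t * deriv u t) / (u t * u t))) (at t)"
    using pos[OF t] by (intro DERIV_cmult DERIV_divide du t) simp
  then have "(deriv E has_real_derivative - ?n * ((deriv (deriv u) t * u t - deriv u t * deriv u t) / (u t * u t))) (at t)"
    by (rule has_field_derivative_transform_within_open[OF _ J t]) (simp only: DERIV_imp_deriv[OF dE])
  then have ddE: "deriv (deriv E) t = - ?n * (deriv (deriv u) t / u t - a * a)"
    using pos[OF t] by (subst DERIV_imp_deriv) (auto simp: a_def diff_divide_distrib)
  have u2: "deriv (deriv u) t = (1 / (2 * u t) - deriv u t) / c\<^sup>2"
    using ode[OF t] c by (simp add: field_simps)
  have u2': "deriv (deriv u) t / u t = 1 / c\<^sup>2 * (1 / (2 * (u t)\<^sup>2)) - 1 / c\<^sup>2 * a"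
    unfolding u2 a_def using pos[OF t] by (simp add: power2_eq_square diff_divide_distrib)
  show ?thesis
    unfolding reference_density_gauss[of u, OF pos[OF t]] gauss_fisher[OF pos[OF t]] ddE DERIV_imp_deriv[OF dE[OF t]] a_def[symmetric] u2'
    by (simp add: algebra_simps power2_eq_square)
qed

theorem theorem1p11:
  fixes A :: "('m::t2_space, 'n::finite) chart set"
    and g :: "('m, 'n) tensor2"
    and \<nu> :: "'m measure"
    and c :: real and T :: ereal
    and u \<alpha> W Wn :: "real \<Rightarrow> real"
    and \<rho> \<phi> :: "real \<Rightarrow> 'm \<Rightarrow> real"
  assumes "compact (UNIV :: 'm set)"
    and "smooth_atlas A"
    and "riemannian_metric A g"
    and "riemannian_volume A g \<nu>"
    and "c > 0" and "T > 0"
    and "smooth_on (einterval 0 T) u"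
    and "\<And>t. t \<in> einterval 0 T \<Longrightarrow> u t > 0"
    and "\<And>t. t \<in> einterval 0 T \<Longrightarrow> c\<^sup>2 * deriv (deriv u) t + deriv u t = 1 / (2 * u t)"
    and "\<And>t. t \<in> einterval 0 T \<Longrightarrow> \<alpha> t = deriv u t / u t"
    and "smooth_evolution A (einterval 0 T) \<rho>"
    and "smooth_evolution A (einterval 0 T) \<phi>"
    and "\<And>t p. t \<in> einterval 0 T \<Longrightarrow> \<rho> t p > 0"
    and "\<And>t. t \<in> einterval 0 T \<Longrightarrow> (\<integral>p. \<rho> t p \<partial>\<nu>) = 1"
    and "\<And>t p. t \<in> einterval 0 T \<Longrightarrow>
      deriv (\<lambda>s. \<rho> s p) t + divergence A g (\<lambda>\<kappa> q. \<rho> t q *\<^sub>R grad g (\<phi> t) \<kappa> q) p = 0"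
    and "\<And>t p. t \<in> einterval 0 T \<Longrightarrow>
      c\<^sup>2 * (deriv (\<lambda>s. \<phi> s p) t + 1 / 2 * grad_sq A g (\<phi> t) p) = - \<phi> t p - ln (\<rho> t p) - 1"
    and "is_W_entropy A g \<nu> c \<alpha> (einterval 0 T) \<rho> W"
    and "is_W_entropy euclidean_atlas flat_metric lborel c \<alpha> (einterval 0 T)
      (reference_density u :: real \<Rightarrow> real ^ 'n \<Rightarrow> real) Wn"
  shows "(\<forall>t \<in> einterval 0 T.
      ((\<lambda>s. W s - Wn s) has_real_derivative
        (\<integral>p. tensor_norm_sq A g (\<lambda>\<kappa> q. hess g (\<phi> t) \<kappa> q - \<alpha> t *\<^sub>R g \<kappa> q) p * \<rho> t p \<partial>\<nu>)
        + (\<integral>p. vinner A (ricci g) (grad g (\<phi> t)) (grad g (\<phi> t)) p * \<rho> t p \<partial>\<nu>)) (at t))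
    \<and> (nonneg_tensor A (ricci g) \<longrightarrow>
      (\<forall>t \<in> einterval 0 T. deriv W t \<ge> deriv Wn t))"
proof -
  let ?J = "einterval 0 T"
  interpret riem_evolution A g \<nu> ?J
    by unfold_locales (rule assms(2) assms(3) assms(1) assms(4) open_einterval)+
  have evr: "evol \<rho>" and evp: "evol \<phi>" using assms(11,12) by (simp_all add: evol_smooth_evolution)
  interpret wasserstein_flow A g \<nu> ?J c \<rho> \<phi>
  proof unfold_locales
    fix t p assume t: "t \<in> ?J"
    have S: "smoothM (\<rho> t)" "smoothM (\<phi> t)" by (rule evol_smoothM[OF evr t], rule evol_smoothM[OF evp t])
    show "tderiv \<rho> t p = - (gamma (\<rho> t) (\<phi> t) p + \<rho> t p * lap (\<phi> t) p)"
      using assms(15)[OF t, of p] by (simp only: divergence_eq[OF S])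
    have hj: "tderiv \<phi> t p + 1 / 2 * gamma (\<phi> t) (\<phi> t) p = (- \<phi> t p - ln (\<rho> t p) - 1) / c\<^sup>2"
      using assms(16)[OF t, of p] assms(5) by (simp add: grad_sq_eq field_simps)
    \<comment> \<open>The explicit coefficients shape the right-hand side as a linear combination to
      which \<open>gamma_add\<close> and \<open>gamma_cmult\<close> apply.\<close>
    show "tderiv \<phi> t p = - 1 * (1 / 2 * gamma (\<phi> t) (\<phi> t) p) + (- 1 / c\<^sup>2) * (\<phi> t p + (ln (\<rho> t p) + 1))"
    proof -
      have "(- \<phi> t p - ln (\<rho> t p) - 1) / c\<^sup>2 = (- 1 / c\<^sup>2) * (\<phi> t p + (ln (\<rho> t p) + 1))"
        by (simp add: diff_divide_distrib add_divide_distrib distrib_left)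
      then show ?thesis using hj by linarith
    qed
  qed (use assms(13) evr evp in auto)
  let ?D = "\<lambda>t. (\<integral>p. tensor_norm_sq A g (\<lambda>\<kappa> q. hess g (\<phi> t) \<kappa> q - \<alpha> t *\<^sub>R g \<kappa> q) p * \<rho> t p \<partial>\<nu>)
        + (\<integral>p. vinner A (ricci g) (grad g (\<phi> t)) (grad g (\<phi> t)) p * \<rho> t p \<partial>\<nu>)"
  have dW: "(W has_real_derivative ?D t - (\<alpha> t)\<^sup>2 * real CARD('n)) (at t)" if t: "t \<in> ?J" for t
    using assms(17) t W_entropy_rate[OF t assms(14)[OF t], of "\<alpha> t"] unfolding is_W_entropy_def by fastforce
  have dWn: "(Wn has_real_derivative - ((\<alpha> t)\<^sup>2 * real CARD('n))) (at t)" if t: "t \<in> ?J" for t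
    using assms(18) t reference_W_entropy_rate[OF open_einterval assms(7,8,5,9) t, where 'n = 'n, folded assms(10)[OF t]]
    unfolding is_W_entropy_def by fastforce
  \<comment> \<open>Both rates contain the same constant \<open>- (\<alpha> t)\<^sup>2 * n\<close>
    with \<open>n = CARD('n)\<close>, which drops out of the difference.\<close>
  have main: "((\<lambda>s. W s - Wn s) has_real_derivative ?D t) (at t)" if t: "t \<in> ?J" for t
    using DERIV_diff[OF dW[OF t] dWn[OF t]] by simp
  moreover have "deriv W t \<ge> deriv Wn t" if R: "nonneg_tensor A (ricci g)" and t: "t \<in> ?J" for t
  proof -
    have "0 \<le> (\<integral>p. tensor_norm_sq A g (\<lambda>\<kappa> q. hess g (\<phi> t) \<kappa> q - \<alpha> t *\<^sub>R g \<kappa> q) p * \<rho> t p \<partial>\<nu>)"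
      by (intro integral_nonneg_AE always_eventually allI mult_nonneg_nonneg tensor_norm_sq_nonneg less_imp_le[OF pos[OF t]])
    moreover have "0 \<le> (\<integral>p. vinner A (ricci g) (grad g (\<phi> t)) (grad g (\<phi> t)) p * \<rho> t p \<partial>\<nu>)"
      by (intro integral_nonneg_AE always_eventually allI mult_nonneg_nonneg vinner_nonneg[OF R] less_imp_le[OF pos[OF t]])
    ultimately show ?thesis using DERIV_imp_deriv[OF dW[OF t]] DERIV_imp_deriv[OF dWn[OF t]] by linarith
  qed
  ultimately show ?thesis by blast
qed

end
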